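(* The dual Littlewood--Richardson polynomials have the following symmetry property: for all partitions $\lambda,\mu,\nu$, $$\widehat c_{\lambda\mu}^{\,\nu}(a)=\widehat c_{\lambda'\mu'}^{\,\nu'}(a'),$$ where $\lambda',\mu',\nu'$ are the conjugate partitions and $a'$ is the sequence with $(a')_i=-a_{-i+1}$ for $i\in\mathbb Z$.
   Context: Let $a=(a_i)_{i\in\mathbb Z}$ be a sequence of commuting indeterminates and $\mathbb Q[a]$ the polynomial ring in the $a_i$. The polynomial $\widehat c(a')$ is obtained from $\widehat c(a)$ by substituting $(a')_i=-a_{-i+1}$ for $a_i$ for all $i$. The ring $\Lambda(x\|a)$: its elements are sequences $P=(P_0,P_1,P_2,\dots)$, where $P_n$ is a symmetric polynomial in $x_1,\dots,x_n$ with coefficients in $\mathbb Q[a]$, the total degrees of the $P_n$ in the $x_i$ are bounded, and $P_n(x_1,\dots,x_{n-1},a_n)=P_{n-1}(x_1,\dots,x_{n-1})$ for all $n\geqslant 1$; multiplication is componentwise. It is freely generated over $\mathbb Q[a]$ by the double power sums $p_k(x\|a)=\sum_{i\geqslant 1}(x_i^k-a_i^k)$, $k\geqslant 1$. Double Schur functions: for a partition $\lambda$ with $\ell(\lambda)\leqslant n$, $$s_\lambda(x_1,\dots,x_n\|a)=\frac{\det\big[(x_i\|a)^{\lambda_j+n-j}\big]_{i,j=1}^n}{\prod_{1\leqslant i<j\leqslant n}(x_i-x_j)},\qquad (x_i\|a)^r=(x_i-a_n)(x_i-a_{n-1})\cdots(x_i-a_{n-r+1}),\ (x_i\|a)^0=1,$$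 and $0$ if $\ell(\lambda)>n$. This sequence is $s_\lambda(x\|a)\in\Lambda(x\|a)$; the $s_\lambda(x\|a)$ form a $\mathbb Q[a]$-basis. Dual Littlewood--Richardson polynomials: let $\Delta:\Lambda(x\|a)\to\Lambda(x\|a)\otimes_{\mathbb Q[a]}\Lambda(x\|a)$ be the $\mathbb Q[a]$-linear ring homomorphism with $\Delta(p_k(x\|a))=p_k(x\|a)\otimes 1+1\otimes p_k(x\|a)$. The $\widehat c_{\lambda\mu}^{\,\nu}(a)\in\mathbb Q[a]$ are defined by $\Delta(s_\nu(x\|a))=\sum_{\lambda,\mu}\widehat c_{\lambda\mu}^{\,\nu}(a)\,s_\lambda(x\|a)\otimes s_\mu(x\|a)$. *)

theory Defs
  imports "HOL-Library.Poly_Mapping" "Jordan_Normal_Form.Determinant"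
begin

section \<open>Multivariate polynomials\<close>

text \<open>
  A polynomial in variables indexed by \<^typ>\<open>'v\<close> with coefficients in \<^typ>\<open>'c\<close> is a finitely
  supported map from exponent vectors to coefficients.  The term \<open>mpoly_eval f h p\<close> is the value of
  \<open>p\<close> when its coefficients are mapped by \<open>f\<close> and the variable \<open>v\<close> is replaced by \<open>h v\<close>.
\<close>

definition monom_eval :: "('v \<Rightarrow> 'r::comm_ring_1) \<Rightarrow> ('v \<Rightarrow>\<^sub>0 nat) \<Rightarrow> 'r"
  where "monom_eval h m = (\<Prod>v\<in>Poly_Mapping.keys m. h v ^ Poly_Mapping.lookup m v)"

definition mpoly_eval ::
    "('c::zero \<Rightarrow> 'r::comm_ring_1) \<Rightarrow> ('v \<Rightarrow> 'r) \<Rightarrow> (('v \<Rightarrow>\<^sub>0 nat) \<Rightarrow>\<^sub>0 'c) \<Rightarrow> 'r"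
  where "mpoly_eval f h p =
    (\<Sum>m\<in>Poly_Mapping.keys p. f (Poly_Mapping.lookup p m) * monom_eval h m)"

definition mpoly_const :: "'c \<Rightarrow> (('v \<Rightarrow>\<^sub>0 nat) \<Rightarrow>\<^sub>0 'c::zero)"
  where "mpoly_const c = Poly_Mapping.single 0 c"

definition mpoly_var :: "'v \<Rightarrow> (('v \<Rightarrow>\<^sub>0 nat) \<Rightarrow>\<^sub>0 'c::zero_neq_one)"
  where "mpoly_var v = Poly_Mapping.single (Poly_Mapping.single v 1) 1"

definition monom_degree :: "('v \<Rightarrow>\<^sub>0 nat) \<Rightarrow> nat"
  where "monom_degree m = (\<Sum>v\<in>Poly_Mapping.keys m. Poly_Mapping.lookup m v)"

definition mpoly_vars :: "(('v \<Rightarrow>\<^sub>0 nat) \<Rightarrow>\<^sub>0 'c::zero) \<Rightarrow> 'v set"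
  where "mpoly_vars p = (\<Union>m\<in>Poly_Mapping.keys p. Poly_Mapping.keys m)"

lemma monom_eval_superset:
  assumes "finite S" "Poly_Mapping.keys m \<subseteq> S"
  shows "monom_eval h m = (\<Prod>v\<in>S. h v ^ Poly_Mapping.lookup m v)"
  unfolding monom_eval_def using assms
  by (intro prod.mono_neutral_left) (auto simp: in_keys_iff)

lemma monom_eval_0 [simp]: "monom_eval h 0 = 1"
  by (simp add: monom_eval_def)

lemma monom_eval_single [simp]: "monom_eval h (Poly_Mapping.single v k) = h v ^ k"
  by (simp add: monom_eval_def)

lemma monom_eval_add: "monom_eval h (m + m') = monom_eval h m * monom_eval h m'"
proof -
  let ?S = "Poly_Mapping.keys m \<union> Poly_Mapping.keys m'"
  have "monom_eval h (m + m') = (\<Prod>v\<in>?S. h v ^ Poly_Mapping.lookup (m + m') v)"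
    by (rule monom_eval_superset) (auto dest: subsetD[OF keys_add])
  also have "\<dots> = (\<Prod>v\<in>?S. h v ^ Poly_Mapping.lookup m v) * (\<Prod>v\<in>?S. h v ^ Poly_Mapping.lookup m' v)"
    by (simp add: lookup_add power_add prod.distrib)
  also have "\<dots> = monom_eval h m * monom_eval h m'"
    by (simp add: monom_eval_superset[of ?S, symmetric])
  finally show ?thesis .
qed

lemma monom_degree_superset:
  assumes "finite S" "Poly_Mapping.keys m \<subseteq> S"
  shows "monom_degree m = (\<Sum>v\<in>S. Poly_Mapping.lookup m v)"
  unfolding monom_degree_def using assms
  by (intro sum.mono_neutral_left) (auto simp: in_keys_iff)

lemma monom_degree_add: "monom_degree (m + m') = monom_degree m + monom_degree m'"
proof -
  let ?S = "Poly_Mapping.keys m \<union> Poly_Mapping.keys m'"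
  have "monom_degree (m + m') = (\<Sum>v\<in>?S. Poly_Mapping.lookup (m + m') v)"
    by (rule monom_degree_superset) (auto dest: subsetD[OF keys_add])
  also have "\<dots> = (\<Sum>v\<in>?S. Poly_Mapping.lookup m v) + (\<Sum>v\<in>?S. Poly_Mapping.lookup m' v)"
    by (simp add: lookup_add sum.distrib)
  also have "\<dots> = monom_degree m + monom_degree m'"
    by (simp add: monom_degree_superset[of ?S, symmetric])
  finally show ?thesis .
qed

lemma poly_mapping_sum_single:
  "p = (\<Sum>k\<in>Poly_Mapping.keys p. Poly_Mapping.single k (Poly_Mapping.lookup p k))"
  by (rule poly_mapping_eqI)
    (auto simp: lookup_sum lookup_single when_def in_keys_iff if_distrib cong: if_cong)

locale coeff_hom =
  fixes f :: "'c::comm_ring_1 \<Rightarrow> 'r::comm_ring_1"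
  assumes f_0 [simp]: "f 0 = 0" and f_1 [simp]: "f 1 = 1"
    and f_add: "f (a + b) = f a + f b" and f_mult: "f (a * b) = f a * f b"
begin

lemma eval_superset:
  assumes "finite S" "Poly_Mapping.keys p \<subseteq> S"
  shows "mpoly_eval f h p = (\<Sum>m\<in>S. f (Poly_Mapping.lookup p m) * monom_eval h m)"
  unfolding mpoly_eval_def using assms
  by (intro sum.mono_neutral_left) (auto simp: in_keys_iff)

lemma eval_single [simp]: "mpoly_eval f h (Poly_Mapping.single m c) = f c * monom_eval h m"
  by (cases "c = 0") (auto simp: mpoly_eval_def)

lemma eval_0 [simp]: "mpoly_eval f h 0 = 0"
  by (simp add: mpoly_eval_def)

lemma eval_add: "mpoly_eval f h (p + q) = mpoly_eval f h p + mpoly_eval f h q"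
proof -
  let ?S = "Poly_Mapping.keys p \<union> Poly_Mapping.keys q"
  have "mpoly_eval f h (p + q) = (\<Sum>m\<in>?S. f (Poly_Mapping.lookup (p + q) m) * monom_eval h m)"
    by (rule eval_superset) (auto dest: subsetD[OF keys_add])
  also have "\<dots> = (\<Sum>m\<in>?S. f (Poly_Mapping.lookup p m) * monom_eval h m)
      + (\<Sum>m\<in>?S. f (Poly_Mapping.lookup q m) * monom_eval h m)"
    by (simp add: lookup_add f_add distrib_right sum.distrib)
  also have "\<dots> = mpoly_eval f h p + mpoly_eval f h q"
    by (simp add: eval_superset[of ?S, symmetric])
  finally show ?thesis .
qed

lemma eval_uminus: "mpoly_eval f h (- p) = - mpoly_eval f h p"
  using eval_add[of h p "- p"] by (simp add: eq_neg_iff_add_eq_0 add.commute)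

lemma eval_diff: "mpoly_eval f h (p - q) = mpoly_eval f h p - mpoly_eval f h q"
  using eval_add[of h p "- q"] by (simp add: eval_uminus)

lemma eval_sum: "mpoly_eval f h (sum g A) = (\<Sum>x\<in>A. mpoly_eval f h (g x))"
  by (induct A rule: infinite_finite_induct) (simp_all add: eval_add)

lemma eval_mult: "mpoly_eval f h (p * q) = mpoly_eval f h p * mpoly_eval f h q"
proof -
  let ?s = "\<lambda>p k. Poly_Mapping.single k (Poly_Mapping.lookup p k)"
  have "mpoly_eval f h (p * q)
      = mpoly_eval f h ((\<Sum>k\<in>Poly_Mapping.keys p. ?s p k) * (\<Sum>l\<in>Poly_Mapping.keys q. ?s q l))"
    using poly_mapping_sum_single[of p] poly_mapping_sum_single[of q] by simp
  also have "\<dots> = (\<Sum>k\<in>Poly_Mapping.keys p. \<Sum>l\<in>Poly_Mapping.keys q.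
      (f (Poly_Mapping.lookup p k) * monom_eval h k) * (f (Poly_Mapping.lookup q l) * monom_eval h l))"
    by (simp add: sum_product eval_sum mult_single f_mult monom_eval_add mult_ac)
  also have "\<dots> = mpoly_eval f h p * mpoly_eval f h q"
    unfolding mpoly_eval_def by (simp add: sum_product)
  finally show ?thesis .
qed

lemma eval_const [simp]: "mpoly_eval f h (mpoly_const c) = f c"
  by (simp add: mpoly_const_def)

lemma eval_1 [simp]: "mpoly_eval f h 1 = 1"
  using eval_const[of h 1] by (simp add: mpoly_const_def)

lemma eval_var [simp]: "mpoly_eval f h (mpoly_var v) = h v"
  by (simp add: mpoly_var_def)

lemma eval_power: "mpoly_eval f h (p ^ k) = mpoly_eval f h p ^ k"
  by (induct k) (simp_all add: eval_mult)

end

interpretation mpoly_const: coeff_hom "mpoly_const :: 'c::comm_ring_1 \<Rightarrow> (('v \<Rightarrow>\<^sub>0 nat) \<Rightarrow>\<^sub>0 'c)"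
  by standard (simp_all add: mpoly_const_def single_add mult_single)


section \<open>The coefficient ring and its involution\<close>

type_synonym qa = "(int \<Rightarrow>\<^sub>0 nat) \<Rightarrow>\<^sub>0 rat"

abbreviation avar :: "int \<Rightarrow> qa"
  where "avar \<equiv> mpoly_var"

definition subst_dual :: "qa \<Rightarrow> qa"
  where "subst_dual = mpoly_eval mpoly_const (\<lambda>i. - avar (- i + 1))"


section \<open>The ring of double symmetric functions\<close>

text \<open>
  The indices of \<open>x\<^sub>1, x\<^sub>2, \<dots>\<close> are natural numbers, of which \<open>0\<close> is unused.
\<close>

type_synonym xpoly = "(nat \<Rightarrow>\<^sub>0 nat) \<Rightarrow>\<^sub>0 qa"

abbreviation xvar :: "nat \<Rightarrow> xpoly"
  where "xvar \<equiv> mpoly_var"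

abbreviation xconst :: "qa \<Rightarrow> xpoly"
  where "xconst \<equiv> mpoly_const"

definition xsubst :: "(nat \<Rightarrow> xpoly) \<Rightarrow> xpoly \<Rightarrow> xpoly"
  where "xsubst = mpoly_eval mpoly_const"

definition symmetric_xpoly :: "nat \<Rightarrow> xpoly \<Rightarrow> bool"
  where "symmetric_xpoly n p \<longleftrightarrow>
    mpoly_vars p \<subseteq> {1..n} \<and> (\<forall>\<pi>. \<pi> permutes {1..n} \<longrightarrow> xsubst (\<lambda>i. xvar (\<pi> i)) p = p)"

definition xdegree_le :: "xpoly \<Rightarrow> nat \<Rightarrow> bool"
  where "xdegree_le p d \<longleftrightarrow> (\<forall>m\<in>Poly_Mapping.keys p. monom_degree m \<le> d)"

definition double_symmetric :: "(nat \<Rightarrow> xpoly) \<Rightarrow> bool"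
  where "double_symmetric P \<longleftrightarrow>
    (\<forall>n. symmetric_xpoly n (P n)) \<and>
    (\<exists>d. \<forall>n. xdegree_le (P n) d) \<and>
    (\<forall>n\<ge>1. xsubst (xvar(n := xconst (avar (int n)))) (P n) = P (n - 1))"

lemma xsubst_simps:
  "xsubst h 0 = 0" "xsubst h 1 = 1" "xsubst h (p + q) = xsubst h p + xsubst h q"
  "xsubst h (- p) = - xsubst h p" "xsubst h (p - q) = xsubst h p - xsubst h q"
  "xsubst h (p * q) = xsubst h p * xsubst h q" "xsubst h (xconst c) = xconst c"
  "xsubst h (xvar i) = h i" "xsubst h (p ^ k) = xsubst h p ^ k"
  "xsubst h (sum g A) = (\<Sum>x\<in>A. xsubst h (g x))"
  by (simp_all add: xsubst_def mpoly_const.eval_add mpoly_const.eval_uminus mpoly_const.eval_diff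
      mpoly_const.eval_mult mpoly_const.eval_power mpoly_const.eval_sum)

lemma mpoly_vars_add: "mpoly_vars (p + q) \<subseteq> mpoly_vars p \<union> mpoly_vars q"
  unfolding mpoly_vars_def using keys_add[of p q] by blast

lemma mpoly_vars_mult: "mpoly_vars (p * q) \<subseteq> mpoly_vars p \<union> mpoly_vars q"
  unfolding mpoly_vars_def using keys_mult[of p q] keys_add by fastforce

lemma mpoly_vars_uminus [simp]: "mpoly_vars (- p) = mpoly_vars p"
  by (simp add: mpoly_vars_def in_keys_iff set_eq_iff)

lemma mpoly_vars_const [simp]: "mpoly_vars (mpoly_const c) = {}"
  by (simp add: mpoly_vars_def mpoly_const_def)

lemma mpoly_vars_1 [simp]: "mpoly_vars 1 = {}"
  by (simp add: mpoly_vars_def)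

lemma mpoly_vars_var [simp]: "mpoly_vars (mpoly_var v :: ('v \<Rightarrow>\<^sub>0 nat) \<Rightarrow>\<^sub>0 'c::zero_neq_one) = {v}"
  by (simp add: mpoly_vars_def mpoly_var_def)

lemma xdegree_le_mono: "xdegree_le p d \<Longrightarrow> d \<le> e \<Longrightarrow> xdegree_le p e"
  by (force simp: xdegree_le_def)

lemma xdegree_le_add:
  assumes "xdegree_le p d" "xdegree_le q e" shows "xdegree_le (p + q) (d + e)"
  using assms subsetD[OF keys_add[of p q]] unfolding xdegree_le_def
  by (metis Un_iff trans_le_add1 trans_le_add2)

lemma xdegree_le_uminus: "xdegree_le p d \<Longrightarrow> xdegree_le (- p) d"
  by (simp add: xdegree_le_def in_keys_iff)

lemma xdegree_le_mult:
  assumes "xdegree_le p d" "xdegree_le q e" shows "xdegree_le (p * q) (d + e)"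
  using assms subsetD[OF keys_mult[of p q]] unfolding xdegree_le_def
  by (fastforce simp: monom_degree_add intro: add_mono)

lemma xdegree_le_const: "xdegree_le (xconst c) 0"
  by (simp add: xdegree_le_def mpoly_const_def monom_degree_def)

lemma xdegree_le_var: "xdegree_le (xvar i) 1"
  by (simp add: xdegree_le_def mpoly_var_def monom_degree_def)

lemma xdegree_le_power: "xdegree_le p d \<Longrightarrow> xdegree_le (p ^ k) (k * d)"
  by (induct k) (use xdegree_le_const[of 1] in \<open>auto intro: xdegree_le_mult\<close>)

lemma double_symmetric_const: "double_symmetric (\<lambda>n. xconst c)"
  unfolding double_symmetric_def symmetric_xpoly_def
  using xdegree_le_const by (auto simp: xsubst_simps)

lemma double_symmetric_0: "double_symmetric (\<lambda>n. 0)"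
  using double_symmetric_const[of 0] by simp

lemma double_symmetric_1: "double_symmetric (\<lambda>n. 1)"
  using double_symmetric_const[of 1] by simp

lemma double_symmetric_add:
  assumes "double_symmetric P" "double_symmetric Q"
  shows "double_symmetric (\<lambda>n. P n + Q n)"
proof -
  from assms obtain d e where "\<forall>n. xdegree_le (P n) d" "\<forall>n. xdegree_le (Q n) e"
    unfolding double_symmetric_def by blast
  then have "\<forall>n. xdegree_le (P n + Q n) (d + e)"
    by (blast intro: xdegree_le_add)
  moreover have "mpoly_vars (P n + Q n) \<subseteq> {1..n}" for n
    using assms mpoly_vars_add[of "P n" "Q n"]
    unfolding double_symmetric_def symmetric_xpoly_def by blast
  ultimately show ?thesis
    using assms unfolding double_symmetric_def symmetric_xpoly_def
    by (auto simp: xsubst_simps)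
qed

lemma double_symmetric_mult:
  assumes "double_symmetric P" "double_symmetric Q"
  shows "double_symmetric (\<lambda>n. P n * Q n)"
proof -
  from assms obtain d e where "\<forall>n. xdegree_le (P n) d" "\<forall>n. xdegree_le (Q n) e"
    unfolding double_symmetric_def by blast
  then have "\<forall>n. xdegree_le (P n * Q n) (d + e)"
    by (blast intro: xdegree_le_mult)
  moreover have "mpoly_vars (P n * Q n) \<subseteq> {1..n}" for n
    using assms mpoly_vars_mult[of "P n" "Q n"]
    unfolding double_symmetric_def symmetric_xpoly_def by blast
  ultimately show ?thesis
    using assms unfolding double_symmetric_def symmetric_xpoly_def
    by (auto simp: xsubst_simps)
qed

lemma double_symmetric_uminus: "double_symmetric P \<Longrightarrow> double_symmetric (\<lambda>n. - P n)"
  unfolding double_symmetric_def symmetric_xpoly_def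
  by (auto simp: xsubst_simps) (blast intro: xdegree_le_uminus)

lemma double_symmetric_diff:
  "double_symmetric P \<Longrightarrow> double_symmetric Q \<Longrightarrow> double_symmetric (\<lambda>n. P n - Q n)"
  using double_symmetric_add[OF _ double_symmetric_uminus, of P Q] by simp

typedef dsym = "{P. double_symmetric P}"
  morphisms component Abs_dsym
  using double_symmetric_0 by blast

setup_lifting type_definition_dsym

instantiation dsym :: comm_ring_1
begin

lift_definition zero_dsym :: dsym is "\<lambda>n. 0" by (rule double_symmetric_0)
lift_definition one_dsym :: dsym is "\<lambda>n. 1" by (rule double_symmetric_1)
lift_definition plus_dsym :: "dsym \<Rightarrow> dsym \<Rightarrow> dsym" is "\<lambda>P Q n. P n + Q n"
  by (rule double_symmetric_add)
lift_definition minus_dsym :: "dsym \<Rightarrow> dsym \<Rightarrow> dsym" is "\<lambda>P Q n. P n - Q n"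
  by (rule double_symmetric_diff)
lift_definition uminus_dsym :: "dsym \<Rightarrow> dsym" is "\<lambda>P n. - P n"
  by (rule double_symmetric_uminus)
lift_definition times_dsym :: "dsym \<Rightarrow> dsym \<Rightarrow> dsym" is "\<lambda>P Q n. P n * Q n"
  by (rule double_symmetric_mult)

instance
  by standard (transfer; simp add: fun_eq_iff algebra_simps)+

end

lift_definition dsym_scale :: "qa \<Rightarrow> dsym \<Rightarrow> dsym" is "\<lambda>c P n. xconst c * P n"
  by (intro double_symmetric_mult double_symmetric_const)

lemma dsym_scale_mult:
  "dsym_scale c P * Q = dsym_scale c (P * Q)" "P * dsym_scale c Q = dsym_scale c (P * Q)"
  by (transfer; simp add: mult_ac)+

interpretation dsym: Modules.module dsym_scale
  by standard (transfer; simp add: fun_eq_iff algebra_simps mpoly_const.f_add mpoly_const.f_mult)+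

definition double_psum_poly :: "nat \<Rightarrow> nat \<Rightarrow> xpoly"
  where "double_psum_poly k n = (\<Sum>i=1..n. xvar i ^ k - xconst (avar (int i) ^ k))"

lemma double_symmetric_psum: "double_symmetric (double_psum_poly k)"
  unfolding double_symmetric_def symmetric_xpoly_def
proof (intro conjI allI impI exI)
  fix n
  show "mpoly_vars (double_psum_poly k n) \<subseteq> {1..n}"
  proof (induct n)
    case 0
    then show ?case by (simp add: double_psum_poly_def mpoly_vars_def)
  next
    case (Suc n)
    have pow: "mpoly_vars (xvar i ^ k) \<subseteq> {i}" for i
      by (induct k) (auto dest!: subsetD[OF mpoly_vars_mult])
    have "double_psum_poly k (Suc n) = double_psum_poly k n
        + (xvar (Suc n) ^ k + - xconst (avar (int (Suc n)) ^ k))"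
      by (simp add: double_psum_poly_def)
    then have "mpoly_vars (double_psum_poly k (Suc n)) \<subseteq> {1..n} \<union> ({Suc n} \<union> {})"
      using Suc pow[of "Suc n"] mpoly_vars_add[of "double_psum_poly k n"
          "xvar (Suc n) ^ k + - xconst (avar (int (Suc n)) ^ k)"]
        mpoly_vars_add[of "xvar (Suc n) ^ k" "- xconst (avar (int (Suc n)) ^ k)"]
      by auto
    then show ?case by auto
  qed
next
  fix n :: nat and \<pi> assume \<pi>: "\<pi> permutes {1..n}"
  show "xsubst (\<lambda>i. xvar (\<pi> i)) (double_psum_poly k n) = double_psum_poly k n"
    using sum.permute[OF \<pi>, of "\<lambda>i. xvar i ^ k", symmetric]
    by (simp add: double_psum_poly_def xsubst_simps sum_subtractf o_def)
next
  fix n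
  show "xdegree_le (double_psum_poly k n) k"
  proof -
    have "Poly_Mapping.keys (double_psum_poly k n)
        \<subseteq> (\<Union>i\<in>{1..n}. Poly_Mapping.keys (xvar i ^ k - xconst (avar (int i) ^ k)))"
    proof
      fix m assume "m \<in> Poly_Mapping.keys (double_psum_poly k n)"
      then show "m \<in> (\<Union>i\<in>{1..n}. Poly_Mapping.keys (xvar i ^ k - xconst (avar (int i) ^ k)))"
        unfolding double_psum_poly_def in_keys_iff lookup_sum
        by (metis (no_types, lifting) UN_I in_keys_iff sum.not_neutral_contains_not_neutral)
    qed
    moreover have "xdegree_le (xvar i ^ k - xconst (avar (int i) ^ k)) k" for i
      using xdegree_le_add[OF xdegree_le_power[OF xdegree_le_var, of i k]
          xdegree_le_uminus[OF xdegree_le_const, of "avar (int i) ^ k"]] by simp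
    ultimately show ?thesis unfolding xdegree_le_def by blast
  qed
next
  fix n :: nat assume "1 \<le> n"
  then obtain m where n: "n = Suc m" by (cases n) auto
  have "xconst (c ^ k) = xconst c ^ k" for c
    by (induct k) (simp_all add: mpoly_const.f_mult)
  moreover have "(\<Sum>i=1..m. (xvar(Suc m := xconst (avar (int (Suc m))))) i ^ k) = (\<Sum>i=1..m. xvar i ^ k)"
    by (rule sum.cong) auto
  ultimately show "xsubst (xvar(n := xconst (avar (int n)))) (double_psum_poly k n)
      = double_psum_poly k (n - 1)"
    by (simp add: n double_psum_poly_def xsubst_simps sum_subtractf)
qed

lift_definition double_psum :: "nat \<Rightarrow> dsym" is double_psum_poly
  by (rule double_symmetric_psum)


section \<open>Partitions and double Schur functions\<close>

text \<open>Parts are indexed from zero: \<open>part l j\<close> is the part \<open>l\<^sub>j\<^sub>+\<^sub>1\<close>.\<close>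

typedef partition = "{l :: nat \<Rightarrow> nat. antimono l \<and> finite {j. l j \<noteq> 0}}"
  morphisms part Abs_partition
  by (rule exI[of _ "\<lambda>_. 0"]) (simp add: monotone_def)

setup_lifting type_definition_partition

definition partition_length :: "partition \<Rightarrow> nat"
  where "partition_length l = card {j. part l j \<noteq> 0}"

lift_definition conj_partition :: "partition \<Rightarrow> partition"
  is "\<lambda>l j. card {i. j < l i}"
proof
  fix l :: "nat \<Rightarrow> nat"
  assume l: "antimono l \<and> finite {j. l j \<noteq> 0}"
  have fin: "finite {i. j < l i}" for j
  proof (rule finite_subset)
    show "{i. j < l i} \<subseteq> {j. l j \<noteq> 0}" by auto
    show "finite {j. l j \<noteq> 0}" using l by blast
  qed
  show "antimono (\<lambda>j. card {i. j < l i})"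
  proof (rule antimonoI)
    fix j k :: nat assume "j \<le> k"
    then have "{i. k < l i} \<subseteq> {i. j < l i}" by auto
    then show "card {i. k < l i} \<le> card {i. j < l i}" by (rule card_mono[OF fin])
  qed
  have "j < l 0" if "card {i. j < l i} \<noteq> 0" for j
  proof -
    from that have "{i. j < l i} \<noteq> {}" by (metis card.empty)
    then obtain i where "j < l i" by blast
    moreover from l have "l i \<le> l 0" using antimonoD[of l 0 i] by simp
    ultimately show ?thesis by simp
  qed
  then have "{j. card {i. j < l i} \<noteq> 0} \<subseteq> {..<l 0}" by blast
  then show "finite {j. card {i. j < l i} \<noteq> 0}" by (rule finite_subset) simp
qed

text \<open>
  The factorial power \<open>(x\<^sub>i \<parallel> a)\<^sup>r\<close>; it depends on the number \<open>n\<close> of variables.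
\<close>

definition factorial_power :: "nat \<Rightarrow> nat \<Rightarrow> nat \<Rightarrow> xpoly"
  where "factorial_power n i r = (\<Prod>k<r. xvar i - xconst (avar (int n - int k)))"

definition schur_numerator :: "nat \<Rightarrow> partition \<Rightarrow> xpoly"
  where "schur_numerator n l =
    det (mat n n (\<lambda>(i, j). factorial_power n (i + 1) (part l j + (n - (j + 1)))))"

definition vandermonde_prod :: "nat \<Rightarrow> xpoly"
  where "vandermonde_prod n = (\<Prod>(i, j)\<in>{(i, j). 1 \<le> i \<and> i < j \<and> j \<le> n}. xvar i - xvar j)"

text \<open>
  The polynomials in the \<open>x\<^sub>i\<close> over \<^typ>\<open>qa\<close> form an integral domain without a division
  operation; the quotient of the two alternants is the unique polynomial whose product with the
  denominator is the numerator.
\<close>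

definition double_schur_poly :: "partition \<Rightarrow> nat \<Rightarrow> xpoly"
  where "double_schur_poly l n =
    (if partition_length l \<le> n then THE q. q * vandermonde_prod n = schur_numerator n l else 0)"

text \<open>
  The sequence \<^term>\<open>double_schur_poly l\<close> satisfies \<^const>\<open>double_symmetric\<close>, so that its
  image under \<^const>\<open>Abs_dsym\<close> is this sequence.
\<close>

definition double_schur :: "partition \<Rightarrow> dsym"
  where "double_schur l = Abs_dsym (double_schur_poly l)"


section \<open>The tensor square over the coefficient ring\<close>

datatype dsym_pair = DPair dsym dsym

instantiation dsym_pair :: comm_monoid_add
begin

definition zero_dsym_pair :: dsym_pair where "zero_dsym_pair = DPair 1 1"

fun plus_dsym_pair :: "dsym_pair \<Rightarrow> dsym_pair \<Rightarrow> dsym_pair"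
  where "plus_dsym_pair (DPair P Q) (DPair P' Q') = DPair (P * P') (Q * Q')"

instance
proof
  fix u v w :: dsym_pair
  show "u + v + w = u + (v + w)" by (cases u; cases v; cases w) (simp add: mult_ac)
  show "u + v = v + u" by (cases u; cases v) (simp add: mult_ac)
  show "0 + u = u" by (cases u) (simp add: zero_dsym_pair_def)
qed

end

text \<open>
  The type \<^typ>\<open>dsym_pair\<close> is the monoid of pairs under componentwise multiplication, written additively
  so that \<^typ>\<open>dsym_pair \<Rightarrow>\<^sub>0 qa\<close> is its monoid algebra: the free \<^typ>\<open>qa\<close>-module on all pairs,
  with the product \<open>(P, Q) (P', Q') = (P P', Q Q')\<close>.  The tensor square is the quotient of this
  free module by the submodule spanned by the bilinearity relations.
\<close>

type_synonym free_pairs = "dsym_pair \<Rightarrow>\<^sub>0 qa"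

definition free_scale :: "qa \<Rightarrow> free_pairs \<Rightarrow> free_pairs"
  where "free_scale c u = Poly_Mapping.single 0 c * u"

lemma lookup_free_scale: "Poly_Mapping.lookup (free_scale c u) k = c * Poly_Mapping.lookup u k"
  unfolding free_scale_def mult_map_scale_conv_mult[symmetric]
  by (simp add: Poly_Mapping.map.rep_eq when_def)

interpretation free_pairs: Modules.module free_scale
  by standard (simp_all add: free_scale_def distrib_left distrib_right single_add mult_single
      flip: mult.assoc)

definition free_gen :: "dsym \<Rightarrow> dsym \<Rightarrow> free_pairs"
  where "free_gen P Q = Poly_Mapping.single (DPair P Q) 1"

inductive_set bilinear_relators :: "free_pairs set"
  where
    add_left: "free_gen (P + P') Q - free_gen P Q - free_gen P' Q \<in> bilinear_relators"
  | add_right: "free_gen P (Q + Q') - free_gen P Q - free_gen P Q' \<in> bilinear_relators"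
  | scale_left: "free_gen (dsym_scale c P) Q - free_scale c (free_gen P Q) \<in> bilinear_relators"
  | scale_right: "free_gen P (dsym_scale c Q) - free_scale c (free_gen P Q) \<in> bilinear_relators"

definition tensor_null :: "free_pairs set"
  where "tensor_null = free_pairs.span bilinear_relators"

lemma free_gen_mult: "free_gen P Q * free_gen P' Q' = free_gen (P * P') (Q * Q')"
  by (simp add: free_gen_def mult_single)

lemma free_scale_mult:
  "free_scale c u * v = free_scale c (u * v)" "u * free_scale c v = free_scale c (u * v)"
  by (simp_all add: free_scale_def mult_ac)

lemma free_gen_mult_relator:
  assumes "r \<in> bilinear_relators" shows "free_gen A B * r \<in> bilinear_relators"
  using assms
  by cases (simp_all add: right_diff_distrib free_gen_mult free_scale_mult dsym_scale_mult
      distrib_left bilinear_relators.intros)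

lemma free_gen_mult_null:
  assumes "u \<in> tensor_null" shows "free_gen A B * u \<in> tensor_null"
  using assms unfolding tensor_null_def
proof (induct rule: free_pairs.span_induct_alt)
  case base
  then show ?case by (simp add: free_pairs.span_zero)
next
  case (step c x y)
  have "free_scale c (free_gen A B * x) \<in> free_pairs.span bilinear_relators"
    by (intro free_pairs.span_scale free_pairs.span_base free_gen_mult_relator step.hyps)
  with step show ?case
    by (simp add: distrib_left free_scale_mult free_pairs.span_add)
qed

lemma tensor_null_mult:
  assumes "u \<in> tensor_null" shows "w * u \<in> tensor_null"
proof -
  have *: "Poly_Mapping.single k c * u \<in> tensor_null" for k c
  proof -
    obtain A B where k: "k = DPair A B" by (cases k)
    have "Poly_Mapping.single k c * u = free_scale c (free_gen A B * u)"
      by (simp add: k free_scale_def free_gen_def mult_single flip: mult.assoc)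
    then show ?thesis
      using free_gen_mult_null[OF assms] free_pairs.span_scale by (simp add: tensor_null_def)
  qed
  have "(\<Sum>k\<in>Poly_Mapping.keys w. Poly_Mapping.single k (Poly_Mapping.lookup w k)) * u \<in> tensor_null"
    unfolding sum_distrib_right using * unfolding tensor_null_def by (intro free_pairs.span_sum)
  then show ?thesis using poly_mapping_sum_single[of w] by simp
qed

definition tensor_rel :: "free_pairs \<Rightarrow> free_pairs \<Rightarrow> bool"
  where "tensor_rel u v \<longleftrightarrow> u - v \<in> tensor_null"

text \<open>A bilinear form on double symmetric functions which shows that the quotient is not trivial.\<close>

definition constant_form :: "dsym_pair \<Rightarrow> qa"
  where "constant_form k = (case k of DPair P Q \<Rightarrow>
    Poly_Mapping.lookup (component P 0) 0 * Poly_Mapping.lookup (component Q 0) 0)"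

definition free_form :: "free_pairs \<Rightarrow> qa"
  where "free_form u = (\<Sum>k\<in>Poly_Mapping.keys u. Poly_Mapping.lookup u k * constant_form k)"

lemma free_form_superset:
  assumes "finite S" "Poly_Mapping.keys u \<subseteq> S"
  shows "free_form u = (\<Sum>k\<in>S. Poly_Mapping.lookup u k * constant_form k)"
  unfolding free_form_def using assms
  by (intro sum.mono_neutral_left) (auto simp: in_keys_iff)

lemma free_form_add: "free_form (u + v) = free_form u + free_form v"
proof -
  let ?S = "Poly_Mapping.keys u \<union> Poly_Mapping.keys v"
  have "free_form (u + v) = (\<Sum>k\<in>?S. Poly_Mapping.lookup (u + v) k * constant_form k)"
    by (rule free_form_superset) (auto dest: subsetD[OF keys_add])
  then show ?thesis
    by (simp add: free_form_superset[of ?S] lookup_add distrib_right sum.distrib)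
qed

lemma free_form_scale: "free_form (free_scale c u) = c * free_form u"
proof -
  have "free_form (free_scale c u)
      = (\<Sum>k\<in>Poly_Mapping.keys u. Poly_Mapping.lookup (free_scale c u) k * constant_form k)"
    by (rule free_form_superset) (auto simp: in_keys_iff lookup_free_scale)
  then show ?thesis
    by (simp add: free_form_def lookup_free_scale sum_distrib_left mult.assoc)
qed

interpretation free_form: Modules.module_hom free_scale "(*)" free_form
  by (intro Modules.module_hom.intro free_pairs.module_axioms Modules.module_hom_axioms.intro
      Modules.module.intro)
    (simp_all add: free_form_add free_form_scale algebra_simps)

lemma free_form_gen: "free_form (free_gen P Q) = constant_form (DPair P Q)"
  by (simp add: free_form_def free_gen_def)

lemma component_simps:
  "component (P + Q) n = component P n + component Q n"
  "component (dsym_scale c P) n = xconst c * component P n"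
  "component 1 n = 1"
  by (simp_all add: plus_dsym.rep_eq dsym_scale.rep_eq one_dsym.rep_eq)

lemma lookup_xconst_mult:
  "Poly_Mapping.lookup (xconst c * p) m = c * Poly_Mapping.lookup p m"
  unfolding mpoly_const_def mult_map_scale_conv_mult[symmetric]
  by (simp add: Poly_Mapping.map.rep_eq when_def)

lemma constant_form_simps:
  "constant_form (DPair (P + P') Q) = constant_form (DPair P Q) + constant_form (DPair P' Q)"
  "constant_form (DPair P (Q + Q')) = constant_form (DPair P Q) + constant_form (DPair P Q')"
  "constant_form (DPair (dsym_scale c P) Q) = c * constant_form (DPair P Q)"
  "constant_form (DPair P (dsym_scale c Q)) = c * constant_form (DPair P Q)"
  "constant_form (DPair 1 1) = 1"
  by (simp_all only: constant_form_def dsym_pair.case component_simps lookup_add lookup_xconst_mult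
      distrib_right distrib_left mult.assoc mult.left_commute[of _ c] lookup_one_zero mult_1)

lemma one_notin_tensor_null: "1 \<notin> tensor_null"
proof
  assume "1 \<in> tensor_null"
  have "free_form r = 0" if "r \<in> bilinear_relators" for r
    using that
    by cases (simp_all add: free_form.diff free_form_scale free_form_gen constant_form_simps)
  then have "free_form u = 0" if "u \<in> tensor_null" for u
    using that free_form.eq_0_on_span unfolding tensor_null_def by blast
  with \<open>1 \<in> tensor_null\<close> have "free_form 1 = 0" by blast
  moreover have "(1 :: free_pairs) = free_gen 1 1"
    unfolding free_gen_def zero_dsym_pair_def[symmetric] by (rule single_one[symmetric])
  ultimately show False
    by (metis free_form_gen constant_form_simps(5) zero_neq_one)
qed

lemma tensor_rel_refl: "tensor_rel u u"
  by (simp add: tensor_rel_def tensor_null_def free_pairs.span_zero)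

quotient_type tensor2 = free_pairs / tensor_rel
proof (rule equivpI)
  show "reflp tensor_rel"
    by (simp add: reflp_def tensor_rel_refl)
  show "symp tensor_rel"
  proof (rule sympI)
    fix u v assume "tensor_rel u v"
    then have "- (u - v) \<in> tensor_null"
      unfolding tensor_rel_def tensor_null_def by (rule free_pairs.span_neg)
    then show "tensor_rel v u" by (simp add: tensor_rel_def)
  qed
  show "transp tensor_rel"
  proof (rule transpI)
    fix u v w assume "tensor_rel u v" "tensor_rel v w"
    then have "(u - v) + (v - w) \<in> tensor_null"
      unfolding tensor_rel_def tensor_null_def by (rule free_pairs.span_add)
    then show "tensor_rel u w" by (simp add: tensor_rel_def)
  qed
qed

instantiation tensor2 :: comm_ring_1
begin

lift_definition zero_tensor2 :: tensor2 is 0 .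
lift_definition one_tensor2 :: tensor2 is 1 .

lift_definition plus_tensor2 :: "tensor2 \<Rightarrow> tensor2 \<Rightarrow> tensor2" is "(+)"
  unfolding tensor_rel_def tensor_null_def
  by (simp only: add_diff_add free_pairs.span_add)

lift_definition minus_tensor2 :: "tensor2 \<Rightarrow> tensor2 \<Rightarrow> tensor2" is "(-)"
proof -
  fix u u' v v' assume "tensor_rel u u'" "tensor_rel v v'"
  then have "(u - u') - (v - v') \<in> tensor_null"
    unfolding tensor_rel_def tensor_null_def by (rule free_pairs.span_diff)
  then show "tensor_rel (u - v) (u' - v')"
    by (simp add: tensor_rel_def algebra_simps)
qed

lift_definition uminus_tensor2 :: "tensor2 \<Rightarrow> tensor2" is uminus
  unfolding tensor_rel_def tensor_null_def
  by (simp only: minus_diff_minus free_pairs.span_neg)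

lift_definition times_tensor2 :: "tensor2 \<Rightarrow> tensor2 \<Rightarrow> tensor2" is "(*)"
proof -
  fix u u' v v' assume "tensor_rel u u'" "tensor_rel v v'"
  then have "u * (v - v') \<in> tensor_null" "v' * (u - u') \<in> tensor_null"
    unfolding tensor_rel_def by (simp_all only: tensor_null_mult)
  then have "u * (v - v') + v' * (u - u') \<in> tensor_null"
    unfolding tensor_null_def by (rule free_pairs.span_add)
  then show "tensor_rel (u * v) (u' * v')"
    by (simp add: tensor_rel_def algebra_simps)
qed

instance
proof
  show "(0::tensor2) \<noteq> 1"
    by transfer (use one_notin_tensor_null free_pairs.span_neg[of "- 1" bilinear_relators] in
        \<open>auto simp: tensor_rel_def tensor_null_def\<close>)
qed (transfer; simp add: tensor_rel_refl algebra_simps)+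

end

lift_definition tensor_scale :: "qa \<Rightarrow> tensor2 \<Rightarrow> tensor2" is free_scale
  unfolding tensor_rel_def tensor_null_def
  by (simp only: free_pairs.span_scale flip: free_pairs.scale_right_diff_distrib)

interpretation tensor2: Modules.module tensor_scale
  by standard (transfer; simp add: tensor_rel_refl algebra_simps)+

lift_definition tensor :: "dsym \<Rightarrow> dsym \<Rightarrow> tensor2" is free_gen .


section \<open>The comultiplication and the dual Littlewood--Richardson polynomials\<close>

definition is_coproduct :: "(dsym \<Rightarrow> tensor2) \<Rightarrow> bool"
  where "is_coproduct D \<longleftrightarrow>
    Modules.module_hom dsym_scale tensor_scale D \<and>
    D 1 = 1 \<and> (\<forall>P Q. D (P * Q) = D P * D Q) \<and>
    (\<forall>k\<ge>1. D (double_psum k) = tensor (double_psum k) 1 + tensor 1 (double_psum k))"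

text \<open>
  The double power sums generate the algebra freely, so exactly one map satisfies
  \<^const>\<open>is_coproduct\<close>; the double Schur functions form a basis, so the coefficients of
  \<open>coproduct (double_schur n)\<close> below are unique as well.
\<close>

definition coproduct :: "dsym \<Rightarrow> tensor2"
  where "coproduct = (THE D. is_coproduct D)"

definition coproduct_coeffs :: "partition \<Rightarrow> (partition \<times> partition \<Rightarrow>\<^sub>0 qa)"
  where "coproduct_coeffs n = (THE c. coproduct (double_schur n) =
    (\<Sum>(l, m)\<in>Poly_Mapping.keys c.
      tensor_scale (Poly_Mapping.lookup c (l, m)) (tensor (double_schur l) (double_schur m))))"

definition dual_lr :: "partition \<Rightarrow> partition \<Rightarrow> partition \<Rightarrow> qa"
  where "dual_lr l m n = Poly_Mapping.lookup (coproduct_coeffs n) (l, m)"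

end

theory Submission
  imports Defs
begin

text \<open>
  An element of \<open>\<Lambda>(x\<parallel>a)\<close> is determined by its values at the points
  \<open>a\<^sub>\<mu> = (a\<^sub>1\<^sub>-\<^sub>\<mu>\<^sub>1, a\<^sub>2\<^sub>-\<^sub>\<mu>\<^sub>2, \<dots>)\<close>, because \<open>s\<^sub>\<lambda>(a\<^sub>\<mu>)\<close> vanishes unless \<open>\<lambda> \<subseteq> \<mu>\<close> and is nonzero for
  \<open>\<lambda> = \<mu>\<close>.  Let \<open>\<sigma>\<close> be the substitution of \<open>a'\<close> for \<open>a\<close>.  Telescoping along the rows and along the
  columns of \<open>\<mu>\<close> shows that \<open>\<sigma>(p\<^sub>k(a\<^sub>\<mu>\<^sub>')) = (-1)\<^sup>k\<^sup>-\<^sup>1 p\<^sub>k(a\<^sub>\<mu>)\<close>.  The Pieri rule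
  \<open>(p\<^sub>1 - p\<^sub>1(a\<^sub>\<lambda>)) s\<^sub>\<lambda> = \<Sum> s\<^sub>\<kappa>\<close>, summed over the partitions \<open>\<kappa>\<close> covering \<open>\<lambda>\<close>, determines the values
  \<open>s\<^sub>\<lambda>(a\<^sub>\<mu>)\<close> for fixed \<open>\<mu>\<close> up to a common factor, and that factor is fixed by \<open>s\<^sub>\<emptyset> = 1\<close>; hence
  \<open>\<sigma>(s\<^sub>\<lambda>\<^sub>'(a\<^sub>\<mu>\<^sub>')) = s\<^sub>\<lambda>(a\<^sub>\<mu>)\<close>.  So the \<open>\<sigma>\<close>-semilinear ring homomorphism \<open>\<omega>\<close> with
  \<open>\<omega>(p\<^sub>k) = (-1)\<^sup>k\<^sup>-\<^sup>1 p\<^sub>k\<close> sends \<open>s\<^sub>\<lambda>\<close> to \<open>s\<^sub>\<lambda>\<^sub>'\<close>.  It commutes with \<open>\<Delta>\<close> because the \<open>p\<^sub>k\<close> are primitive, and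
  comparing coefficients in the basis \<open>s\<^sub>\<lambda> \<otimes> s\<^sub>\<mu>\<close> gives the symmetry.
\<close>

section \<open>Polynomial evaluation\<close>

text \<open>The quotient of alternants, the comultiplication and its coefficients are introduced by
  definite description, so most of the work is to show that they exist and are unique. The quotient
  is realized by a determinant of divided differences, which makes sense over any commutative ring
  and so survives every substitution. The comultiplication needs generation and algebraic
  independence of the p_k; the first comes from averaging over permutations, the second from
  differentiating a relation. A degree or weight bound that does not depend on n makes the data
  found for each n stabilize. \<open>\<omega>\<close> is never built as a map of the ring: it acts
  on polynomials in the p_k, and identities of tensors are checked at pairs of partitions, so no
  semilinear map on the tensor square is needed. The Pieri recurrence determines the values up to a
  factor because p_1(a_\<mu>) - p_1(a_\<lambda>) is nonzero for \<lambda> strictly inside \<mu>, so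
  that one can descend from \<lambda> = \<mu>.\<close>

lemma coeff_hom_id: "coeff_hom id"
  by standard auto

lemma coeff_hom_comp:
  assumes "coeff_hom f" "coeff_hom g" shows "coeff_hom (g \<circ> f)"
  using assms by (simp add: coeff_hom_def)

lemma coeff_hom_mpoly_eval: "coeff_hom f \<Longrightarrow> coeff_hom (mpoly_eval f h)"
  by (simp add: coeff_hom_def[of "mpoly_eval f h"] coeff_hom.eval_0 coeff_hom.eval_1
      coeff_hom.eval_add coeff_hom.eval_mult)

lemma coeff_hom_comm_ring_hom: "coeff_hom f \<Longrightarrow> comm_ring_hom f"
  by unfold_locales (simp_all add: coeff_hom_def)

lemma coeff_hom_diff: "coeff_hom f \<Longrightarrow> f (a - b) = f a - f b"
  by (metis coeff_hom.f_add diff_add_cancel add_diff_cancel_right')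

lemma coeff_hom_uminus: "coeff_hom f \<Longrightarrow> f (- a) = - f a"
  by (metis coeff_hom.f_0 coeff_hom_diff diff_0)

lemma coeff_hom_sum: "coeff_hom f \<Longrightarrow> f (sum g A) = (\<Sum>x\<in>A. f (g x))"
  by (induct A rule: infinite_finite_induct) (simp_all add: coeff_hom.f_0 coeff_hom.f_add)

lemma coeff_hom_prod: "coeff_hom f \<Longrightarrow> f (prod g A) = (\<Prod>x\<in>A. f (g x))"
  by (induct A rule: infinite_finite_induct) (simp_all add: coeff_hom.f_1 coeff_hom.f_mult)

lemma coeff_hom_power: "coeff_hom f \<Longrightarrow> f (a ^ k) = f a ^ k"
  by (induct k) (simp_all add: coeff_hom.f_1 coeff_hom.f_mult)

lemma coeff_hom_det_mat:
  assumes "coeff_hom f"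
  shows "f (det (mat n n g)) = det (mat n n (\<lambda>ij. f (g ij)))"
proof -
  interpret comm_ring_hom f using assms by (rule coeff_hom_comm_ring_hom)
  have "map_mat f (mat n n g) = mat n n (\<lambda>ij. f (g ij))" by (intro eq_matI) auto
  then show ?thesis by (simp flip: hom_det)
qed

lemma hom_mpoly_eval:
  assumes "coeff_hom g"
  shows "g (mpoly_eval f h p) = mpoly_eval (g \<circ> f) (g \<circ> h) p"
  by (simp add: mpoly_eval_def monom_eval_def coeff_hom_sum[OF assms] coeff_hom.f_mult[OF assms]
      coeff_hom_prod[OF assms] coeff_hom_power[OF assms])

lemma prod_single:
  "(\<Prod>v\<in>A. Poly_Mapping.single (k v) (1 :: 'c::comm_ring_1)) = Poly_Mapping.single (\<Sum>v\<in>A. k v :: 'v \<Rightarrow>\<^sub>0 nat) 1"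
  by (induct A rule: infinite_finite_induct) (simp_all add: mult_single)

lemma mpoly_var_power:
  "(mpoly_var v :: ('v \<Rightarrow>\<^sub>0 nat) \<Rightarrow>\<^sub>0 'c::comm_ring_1) ^ k = Poly_Mapping.single (Poly_Mapping.single v k) 1"
  by (induct k) (simp_all add: mpoly_var_def mult_single flip: single_add)

lemma monom_eval_var: "monom_eval mpoly_var m = Poly_Mapping.single m (1 :: 'c::comm_ring_1)"
  unfolding monom_eval_def mpoly_var_power prod_single
  using poly_mapping_sum_single[of m] by simp

lemma mpoly_eval_ident: "mpoly_eval mpoly_const mpoly_var (p :: ('v \<Rightarrow>\<^sub>0 nat) \<Rightarrow>\<^sub>0 'c::comm_ring_1) = p"
  unfolding mpoly_eval_def monom_eval_var mpoly_const_def
  using poly_mapping_sum_single[of p] by (simp add: mult_single)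

lemma mpoly_sum_monom:
  "p = (\<Sum>m\<in>Poly_Mapping.keys p. mpoly_const (Poly_Mapping.lookup p m) * monom_eval mpoly_var m)"
  for p :: "('v \<Rightarrow>\<^sub>0 nat) \<Rightarrow>\<^sub>0 'c::comm_ring_1"
  using mpoly_eval_ident[of p] by (simp add: mpoly_eval_def)

section \<open>Alternants of factorial powers\<close>

text \<open>Generalizes \<open>factorial_power\<close> to any commutative ring and any sequence, so
  that the same identities serve the polynomials and their values at partitions.\<close>

definition fpow :: "(int \<Rightarrow> 'r::comm_ring_1) \<Rightarrow> nat \<Rightarrow> 'r \<Rightarrow> nat \<Rightarrow> 'r"
  where "fpow \<alpha> n z r = (\<Prod>k<r. z - \<alpha> (int n - int k))"

definition alt :: "(int \<Rightarrow> 'r::comm_ring_1) \<Rightarrow> (nat \<Rightarrow> 'r) \<Rightarrow> nat \<Rightarrow> (nat \<Rightarrow> nat) \<Rightarrow> 'r"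
  where "alt \<alpha> x n l = det (mat n n (\<lambda>(i, j). fpow \<alpha> n (x (Suc i)) (l j)))"

definition vand :: "(nat \<Rightarrow> 'r::comm_ring_1) \<Rightarrow> nat \<Rightarrow> 'r"
  where "vand x n = (\<Prod>(i, j)\<in>{(i, j). 1 \<le> i \<and> i < j \<and> j \<le> n}. x i - x j)"

lemma fpow_0 [simp]: "fpow \<alpha> n z 0 = 1"
  by (simp add: fpow_def)

lemma fpow_Suc: "fpow \<alpha> n z (Suc r) = (z - \<alpha> (int n - int r)) * fpow \<alpha> n z r"
  by (simp add: fpow_def mult.commute)

lemma fpow_Suc_Suc: "fpow \<alpha> (Suc n) z (Suc r) = (z - \<alpha> (int (Suc n))) * fpow \<alpha> n z r"
  unfolding fpow_def by (subst prod.lessThan_Suc_shift) (simp add: algebra_simps)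

lemma hom_fpow: "coeff_hom f \<Longrightarrow> f (fpow \<alpha> n z r) = fpow (f \<circ> \<alpha>) n (f z) r"
  by (simp add: fpow_def coeff_hom_prod coeff_hom_diff)

lemma hom_vand: "coeff_hom f \<Longrightarrow> f (vand x n) = vand (f \<circ> x) n"
  by (simp add: vand_def coeff_hom_prod coeff_hom_diff split_beta)

lemma det_mat_leibniz:
  "det (mat n n (\<lambda>(i, j). f i j)) =
    (\<Sum>\<pi> | \<pi> permutes {0..<n}. of_int (sign \<pi>) * (\<Prod>i = 0..<n. f i (\<pi> i)))"
  by (subst det_def'[of _ n], simp, intro sum.cong refl arg_cong2[where f = "(*)"] prod.cong)
    (auto dest: permutes_in_image[THEN iffD2])

lemma alt_leibniz:
  "alt \<alpha> x n l =
    (\<Sum>\<pi> | \<pi> permutes {0..<n}. of_int (sign \<pi>) * (\<Prod>i = 0..<n. fpow \<alpha> n (x (Suc i)) (l (\<pi> i))))"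
  unfolding alt_def by (rule det_mat_leibniz)

lemma alt_cong:
  assumes "\<And>i. i \<in> {1..n} \<Longrightarrow> x i = y i" "\<And>j. j < n \<Longrightarrow> l j = l' j"
  shows "alt \<alpha> x n l = alt \<alpha> y n l'"
  unfolding alt_def using assms by (intro arg_cong[where f = det] eq_matI) auto

lemma vand_Suc: "vand x (Suc n) = vand x n * (\<Prod>i = 1..n. x i - x (Suc n))"
proof -
  have "{(i, j). 1 \<le> i \<and> i < j \<and> j \<le> Suc n} = {(i, j). 1 \<le> i \<and> i < j \<and> j \<le> n} \<union> (\<lambda>i. (i, Suc n)) ` {1..n}"
    by auto
  moreover have "finite {(i, j). 1 \<le> i \<and> i < j \<and> j \<le> n}"
    by (rule finite_subset[of _ "{..n} \<times> {..n}"]) auto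
  ultimately show ?thesis unfolding vand_def
    by (simp only:, subst prod.union_disjoint) (auto simp: prod.reindex inj_on_def)
qed

lemma vand_prod: "vand x n = (\<Prod>i = 1..n. \<Prod>j = Suc i..n. x i - x j)"
proof -
  have "{(i, j). 1 \<le> i \<and> i < j \<and> j \<le> n} = (SIGMA i:{1..n}. {Suc i..n})" by auto
  then show ?thesis by (simp add: vand_def prod.Sigma)
qed

lemma vand_nonzero:
  fixes x :: "nat \<Rightarrow> 'r::idom"
  assumes "inj_on x {1..n}" shows "vand x n \<noteq> 0"
proof -
  have "x i \<noteq> x j" if "i \<in> {1..n}" "j \<in> {Suc i..n}" for i j
    using inj_onD[OF assms, of i j] that by auto
  then show ?thesis by (auto simp: vand_prod)
qed

section \<open>Divided differences and the quotient of alternants\<close>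

text \<open>
  The coefficients \<open>newton_coeff y b r k\<close> are the divided differences of
  \<open>(z - b\<^sub>0) \<cdots> (z - b\<^sub>r\<^sub>-\<^sub>1)\<close> at the nodes \<open>y\<^sub>0, \<dots>, y\<^sub>k\<close>.
\<close>

fun newton_coeff :: "(nat \<Rightarrow> 'r::comm_ring_1) \<Rightarrow> (nat \<Rightarrow> 'r) \<Rightarrow> nat \<Rightarrow> nat \<Rightarrow> 'r"
  where
    "newton_coeff y b 0 k = (if k = 0 then 1 else 0)"
  | "newton_coeff y b (Suc r) k =
      (if k = 0 then 0 else newton_coeff y b r (k - 1)) + (y k - b r) * newton_coeff y b r k"

lemma newton_coeff_eq_0: "r < k \<Longrightarrow> newton_coeff y b r k = 0"
  by (induct r arbitrary: k) auto

lemma newton_coeff_diag [simp]: "newton_coeff y b r r = 1"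
  by (induct r) (auto simp: newton_coeff_eq_0)

lemma newton_expansion:
  "(\<Prod>k<r. z - b k) = (\<Sum>k\<le>r. newton_coeff y b r k * (\<Prod>m<k. z - y m))"
proof (induct r)
  case 0
  then show ?case by simp
next
  case (Suc r)
  let ?N = "\<lambda>k. \<Prod>m<k. z - y m"
  let ?c = "newton_coeff y b"
  have "(\<Prod>k<Suc r. z - b k) = (\<Sum>k\<le>r. ?c r k * ?N k) * (z - b r)"
    by (simp add: Suc)
  \<comment> \<open>In summand k, \<open>z - b r\<close> is split as
    \<open>(z - y k) + (y k - b r)\<close>; the first part extends the Newton product, the second is
    a scalar.\<close>
  also have "\<dots> = (\<Sum>k\<le>r. ?c r k * ?N (Suc k)) + (\<Sum>k\<le>r. (y k - b r) * ?c r k * ?N k)"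
    unfolding sum_distrib_right sum.distrib[symmetric]
    by (intro sum.cong) (simp_all add: algebra_simps)
  also have "(\<Sum>k\<le>r. ?c r k * ?N (Suc k)) = (\<Sum>k\<le>Suc r. (if k = 0 then 0 else ?c r (k - 1)) * ?N k)"
    by (subst sum.atMost_Suc_shift) simp
  also have "(\<Sum>k\<le>r. (y k - b r) * ?c r k * ?N k) = (\<Sum>k\<le>Suc r. (y k - b r) * ?c r k * ?N k)"
    by (simp add: newton_coeff_eq_0)
  finally show ?case
    by (simp add: sum.distrib[symmetric] algebra_simps)
qed

text \<open>At a node \<open>y m\<close> with \<open>m < n\<close> the Newton products of length at
  least n vanish, and coefficients beyond r are zero. The range of summation thus no longer depends
  on r, and the expansion becomes a product of n by n matrices.\<close>

lemma newton_expansion_node: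
  assumes "m < n"
  shows "(\<Prod>k<r. y m - b k) = (\<Sum>k<n. newton_coeff y b r k * (\<Prod>i<k. y m - y i))"
proof -
  let ?t = "\<lambda>k. newton_coeff y b r k * (\<Prod>i<k. y m - y i)"
  have "sum ?t {..r} = sum ?t ({..r} \<inter> {..<n})"
  proof (rule sum.mono_neutral_right; clarsimp)
    fix k assume "\<not> k < n"
    then have "(\<Prod>i<k. y m - y i) = 0" using assms by (intro prod_zero) auto
    then show "newton_coeff y b r k * (\<Prod>i<k. y m - y i) = 0" by simp
  qed
  also have "\<dots> = sum ?t {..<n}"
    by (rule sum.mono_neutral_left) (auto, metis newton_coeff_eq_0 mult_zero_left not_le)
  finally show ?thesis using newton_expansion[of "y m" b r y] by simp
qed

text \<open>A division-free form of the ratio of alternants, meaningful even where the Vandermonde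
  product vanishes. Row k holds divided differences of order n - 1 - k, in line with the decreasing
  exponents.\<close>

definition schur_quot :: "(int \<Rightarrow> 'r::comm_ring_1) \<Rightarrow> (nat \<Rightarrow> 'r) \<Rightarrow> nat \<Rightarrow> (nat \<Rightarrow> nat) \<Rightarrow> 'r"
  where "schur_quot \<alpha> x n l = det (mat n n (\<lambda>(k, j).
    newton_coeff (\<lambda>m. x (n - m)) (\<lambda>m. \<alpha> (int n - int m)) (l j) (n - 1 - k)))"

text \<open>
  Newton interpolation at \<open>x\<^sub>n, \<dots>, x\<^sub>1\<close> factors the matrix of the alternant into an upper triangular
  one with determinant \<^const>\<open>vand\<close> and the matrix of divided differences.
\<close>

lemma alt_eq_schur_quot: "alt \<alpha> x n l = schur_quot \<alpha> x n l * vand x n"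
proof -
  let ?y = "\<lambda>m. x (n - m)"
  let ?b = "\<lambda>m. \<alpha> (int n - int m)"
  let ?L = "mat n n (\<lambda>(i, k). \<Prod>m<n - 1 - k. x (Suc i) - ?y m)"
  let ?D = "mat n n (\<lambda>(k, j). newton_coeff ?y ?b (l j) (n - 1 - k))"
  have "mat n n (\<lambda>(i, j). fpow \<alpha> n (x (Suc i)) (l j)) = ?L * ?D"
  proof (rule eq_matI)
    fix i j assume ij: "i < dim_row (?L * ?D)" "j < dim_col (?L * ?D)"
    then have i: "i < n" and j: "j < n" by auto
    have "fpow \<alpha> n (?y (n - 1 - i)) (l j)
        = (\<Sum>k<n. newton_coeff ?y ?b (l j) k * (\<Prod>m<k. ?y (n - 1 - i) - ?y m))"
      unfolding fpow_def by (rule newton_expansion_node[where y = ?y]) (use i in auto)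
    also have "?y (n - 1 - i) = x (Suc i)" using i by (simp add: Suc_diff_Suc)
    also have "(\<Sum>k<n. newton_coeff ?y ?b (l j) k * (\<Prod>m<k. x (Suc i) - ?y m))
        = (\<Sum>k<n. newton_coeff ?y ?b (l j) (n - Suc k) * (\<Prod>m<n - Suc k. x (Suc i) - ?y m))"
      by (rule sum.nat_diff_reindex[symmetric])
    finally show "mat n n (\<lambda>(i, j). fpow \<alpha> n (x (Suc i)) (l j)) $$ (i, j) = (?L * ?D) $$ (i, j)"
      using i j by (simp add: scalar_prod_def mult.commute atLeast0LessThan)
  qed auto
  then have "alt \<alpha> x n l = det ?L * schur_quot \<alpha> x n l"
    unfolding alt_def schur_quot_def by (simp add: det_mult[of _ n])
  also have "det ?L = (\<Prod>i<n. \<Prod>m<n - 1 - i. x (Suc i) - ?y m)"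
  proof -
    have "upper_triangular ?L"
    proof (rule upper_triangularI)
      fix i j assume "j < i" "i < dim_row ?L"
      \<comment> \<open>The factor with \<open>m = n - Suc i\<close> is
        \<open>x (Suc i) - x (Suc i)\<close>; it occurs because j < i.\<close>
      then show "?L $$ (i, j) = 0"
        by (auto intro!: prod_zero bexI[of _ "n - Suc i"])
    qed
    then have "det ?L = prod_list (diag_mat ?L)"
      by (rule det_upper_triangular[of _ n]) auto
    then show ?thesis by (simp add: prod_list_diag_prod atLeast0LessThan)
  qed
  also have "\<dots> = (\<Prod>i<n. \<Prod>j = Suc (Suc i)..n. x (Suc i) - x j)"
  proof (rule prod.cong)
    fix i assume "i \<in> {..<n}"
    then show "(\<Prod>m<n - 1 - i. x (Suc i) - ?y m) = (\<Prod>j = Suc (Suc i)..n. x (Suc i) - x j)"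
      by (intro prod.reindex_bij_witness[of _ "\<lambda>j. n - j" "\<lambda>m. n - m"]) auto
  qed simp
  also have "\<dots> = vand x n"
    unfolding vand_prod
    by (rule prod.reindex_bij_witness[of _ "\<lambda>j. j - 1" Suc]) auto
  finally show ?thesis by (simp add: mult.commute)
qed

text \<open>Above the diagonal the order exceeds the exponent, and on the diagonal stand leading
  coefficients. Hence the Vandermonde product is itself an alternant and inherits the sign rules for
  alternants.\<close>

lemma schur_quot_staircase [simp]: "schur_quot \<alpha> x n (\<lambda>j. n - Suc j) = 1"
proof -
  let ?D = "mat n n (\<lambda>(k, j).
    newton_coeff (\<lambda>m. x (n - m)) (\<lambda>m. \<alpha> (int n - int m)) (n - Suc j) (n - 1 - k))"
  have "det ?D = prod_list (diag_mat ?D)"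
    by (rule det_lower_triangular[of n]) (auto intro: newton_coeff_eq_0)
  also have "\<dots> = 1"
    by (simp add: prod_list_diag_prod)
  finally show ?thesis by (simp add: schur_quot_def)
qed

lemma alt_staircase: "alt \<alpha> x n (\<lambda>j. n - Suc j) = vand x n"
  by (simp add: alt_eq_schur_quot)

lemma hom_newton_coeff:
  "coeff_hom f \<Longrightarrow> f (newton_coeff y b r k) = newton_coeff (\<lambda>m. f (y m)) (\<lambda>m. f (b m)) r k"
  by (induct y b r k rule: newton_coeff.induct)
    (simp_all add: coeff_hom.f_0 coeff_hom.f_1 coeff_hom.f_add coeff_hom.f_mult coeff_hom_diff)

lemma hom_schur_quot: "coeff_hom f \<Longrightarrow> f (schur_quot \<alpha> x n l) = schur_quot (f \<circ> \<alpha>) (f \<circ> x) n l"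
  by (simp add: schur_quot_def coeff_hom_det_mat hom_newton_coeff split_def)

lemma permutes_shift:
  assumes "\<pi> permutes {1..n::nat}"
  shows "(\<lambda>i. if i < n then \<pi> (Suc i) - 1 else i) permutes {0..<n}"
proof (rule bij_imp_permutes)
  have "bij_betw (\<lambda>i. i - 1) {1..n} {0..<n}"
    by (rule bij_betw_byWitness[of _ Suc]) auto
  moreover have "bij_betw Suc {0..<n} {1..n}"
    by (rule bij_betw_byWitness[of _ "\<lambda>i. i - 1"]) auto
  ultimately have "bij_betw ((\<lambda>i. i - 1) \<circ> \<pi> \<circ> Suc) {0..<n} {0..<n}"
    using permutes_imp_bij[OF assms] by (blast intro: bij_betw_trans)
  then show "bij_betw (\<lambda>i. if i < n then \<pi> (Suc i) - 1 else i) {0..<n} {0..<n}"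
    by (rule bij_betw_cong[THEN iffD1, rotated]) auto
qed auto

lemma permutes_unshift:
  assumes "\<pi> permutes {0..<n}"
  shows "(\<lambda>i. if i \<in> {1..n} then Suc (\<pi> (i - 1)) else i) permutes {1..n::nat}"
proof (rule bij_imp_permutes)
  have "bij_betw (\<lambda>i. i - 1) {1..n} {0..<n}"
    by (rule bij_betw_byWitness[of _ Suc]) auto
  moreover have "bij_betw Suc {0..<n} {1..n}"
    by (rule bij_betw_byWitness[of _ "\<lambda>i. i - 1"]) auto
  ultimately have "bij_betw (Suc \<circ> (\<pi> \<circ> (\<lambda>i. i - 1))) {1..n} {1..n}"
    using permutes_imp_bij[OF assms] by (blast intro: bij_betw_trans)
  then show "bij_betw (\<lambda>i. if i \<in> {1..n} then Suc (\<pi> (i - 1)) else i) {1..n} {1..n}"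
    by (rule bij_betw_cong[THEN iffD1, rotated]) auto
qed auto

lemma alt_permute_vars:
  assumes "\<pi> permutes {0..<n}" "\<And>i. i < n \<Longrightarrow> y (Suc i) = x (Suc (\<pi> i))"
  shows "alt \<alpha> y n l = of_int (sign \<pi>) * alt \<alpha> x n l"
proof -
  let ?A = "mat n n (\<lambda>(i, j). fpow \<alpha> n (x (Suc i)) (l j))"
  have "mat n n (\<lambda>(i, j). fpow \<alpha> n (y (Suc i)) (l j)) = mat n n (\<lambda>(i, j). ?A $$ (\<pi> i, j))"
    using assms(2) permutes_in_image[OF assms(1)] by (intro eq_matI) auto
  then show ?thesis unfolding alt_def by (simp add: det_permute_rows[OF _ assms(1)])
qed

lemma alt_transpose: "alt \<alpha> x n l = det (mat n n (\<lambda>(j, i). fpow \<alpha> n (x (Suc i)) (l j)))"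
  unfolding alt_def by (subst det_transpose[of _ n, symmetric])
    (auto simp: transpose_mat_def intro!: arg_cong[where f = det] eq_matI)

lemma alt_permute_exponents:
  assumes "\<pi> permutes {0..<n}"
  shows "alt \<alpha> x n (l \<circ> \<pi>) = of_int (sign \<pi>) * alt \<alpha> x n l"
proof -
  let ?A = "mat n n (\<lambda>(j, i). fpow \<alpha> n (x (Suc i)) (l j))"

  have "mat n n (\<lambda>(j, i). fpow \<alpha> n (x (Suc i)) ((l \<circ> \<pi>) j)) = mat n n (\<lambda>(j, i). ?A $$ (\<pi> j, i))"
    using permutes_in_image[OF assms(1)] by (intro eq_matI) auto
  then show ?thesis by (simp add: alt_transpose det_permute_rows[OF _ assms(1)])
qed

lemma alt_eq_exponents:
  assumes "i < n" "j < n" "i \<noteq> j" "l i = l j" shows "alt \<alpha> x n l = 0"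
  unfolding alt_def using assms
  by (intro det_identical_columns[of _ n i j]) (auto intro!: eq_vecI)

text \<open>Every positive factorial power contains the factor
  \<open>z - \<alpha> (int (Suc n))\<close>, so the last row is zero.\<close>

lemma alt_last_eq_0:
  assumes "x (Suc n) = \<alpha> (int (Suc n))" "\<And>j. j \<le> n \<Longrightarrow> 0 < l j"
  shows "alt \<alpha> x (Suc n) l = 0"
proof -
  have "fpow \<alpha> (Suc n) (\<alpha> (int (Suc n))) r = 0" if "0 < r" for r
    unfolding fpow_def using that by (intro prod_zero bexI[of _ 0]) auto
  then have "(\<Prod>i = 0..<Suc n. fpow \<alpha> (Suc n) (x (Suc i)) (l (\<pi> i))) = 0"
    if "\<pi> permutes {0..<Suc n}" for \<pi>
    using assms permutes_in_image[OF that, of n] by (intro prod_zero bexI[of _ n]) auto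
  then show ?thesis unfolding alt_leibniz by (intro sum.neutral) auto
qed

lemma det_scale_rows:
  "det (mat n n (\<lambda>(i, j). c i * f i j)) = (\<Prod>i = 0..<n. c i) * det (mat n n (\<lambda>(i, j). f i j))"
  for c :: "nat \<Rightarrow> 'r::comm_ring_1"
  by (simp add: det_mat_leibniz prod.distrib sum_distrib_left mult.left_commute)

text \<open>The last row reduces to a single 1 in the last column, and every other row gives up one
  factor \<open>x i - x (Suc n)\<close>. By \<open>vand_Suc\<close> the Vandermonde product acquires
  the same factors, so the ratio is stable.\<close>

lemma alt_last:
  assumes "x (Suc n) = \<alpha> (int (Suc n))" "l n = 0" "\<And>j. j < n \<Longrightarrow> l j = Suc (l' j)"
  shows "alt \<alpha> x (Suc n) l = (\<Prod>i = 1..n. x i - x (Suc n)) * alt \<alpha> x n l'"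
proof -
  let ?A = "mat (Suc n) (Suc n) (\<lambda>(i, j). fpow \<alpha> (Suc n) (x (Suc i)) (l j))"
  have 0: "fpow \<alpha> (Suc n) (\<alpha> (int (Suc n))) r = 0" if "0 < r" for r
    unfolding fpow_def using that by (intro prod_zero bexI[of _ 0]) auto
  have "alt \<alpha> x (Suc n) l = (\<Sum>j<Suc n. ?A $$ (n, j) * cofactor ?A n j)"
    unfolding alt_def by (rule laplace_expansion_row) auto
  also have "\<dots> = cofactor ?A n n"
    using assms 0 by (simp add: sum.neutral)
  also have "\<dots> = det (mat n n (\<lambda>(i, j). (x (Suc i) - x (Suc n)) * fpow \<alpha> n (x (Suc i)) (l' j)))"
    unfolding cofactor_def mat_delete_def
    by (simp, intro arg_cong[where f = det] eq_matI) (auto simp: assms fpow_Suc_Suc)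
  also have "\<dots> = (\<Prod>i = 0..<n. x (Suc i) - x (Suc n)) * alt \<alpha> x n l'"
    unfolding alt_def by (rule det_scale_rows)
  also have "(\<Prod>i = 0..<n. x (Suc i) - x (Suc n)) = (\<Prod>i = 1..n. x i - x (Suc n))"
    by (rule prod.reindex_bij_witness[of _ "\<lambda>i. i - 1" Suc]) auto
  finally show ?thesis .
qed

text \<open>
  Multiplication by \<open>x\<close> acts on factorial powers by \<open>x (x\<parallel>a)\<^sup>r = (x\<parallel>a)\<^sup>r\<^sup>+\<^sup>1 + a\<^sub>n\<^sub>-\<^sub>r (x\<parallel>a)\<^sup>r\<close>.
\<close>

lemma alt_pieri:
  "(\<Sum>i = 1..n. x i) * alt \<alpha> x n l =
    (\<Sum>j<n. alt \<alpha> x n (l(j := Suc (l j)))) + (\<Sum>j<n. \<alpha> (int n - int (l j))) * alt \<alpha> x n l"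
proof -
  let ?F = "\<lambda>i r. fpow \<alpha> n (x (Suc i)) r"
  let ?P = "\<lambda>l \<pi>. \<Prod>i = 0..<n. ?F i (l (\<pi> i))"
  have *: "(\<Sum>i = 0..<n. x (Suc i)) * ?P l \<pi> =
      (\<Sum>j = 0..<n. ?P (l(j := Suc (l j))) \<pi>) + (\<Sum>j = 0..<n. \<alpha> (int n - int (l j))) * ?P l \<pi>"
    if \<pi>: "\<pi> permutes {0..<n}" for \<pi>
  proof -
    \<comment> \<open>The variable of row i acts on the exponent in column \<open>\<pi> i\<close>;
      summing over i then reaches every column once.\<close>
    have step: "x (Suc i) * ?P l \<pi> =
        ?P (l(\<pi> i := Suc (l (\<pi> i)))) \<pi> + \<alpha> (int n - int (l (\<pi> i))) * ?P l \<pi>" if "i < n" for i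
    proof -
      let ?R = "\<Prod>k\<in>{0..<n} - {i}. ?F k (l (\<pi> k))"
      have "?P (l(\<pi> i := Suc (l (\<pi> i)))) \<pi> = ?F i (Suc (l (\<pi> i))) *
          (\<Prod>k\<in>{0..<n} - {i}. ?F k ((l(\<pi> i := Suc (l (\<pi> i)))) (\<pi> k)))"
        using that by (subst prod.remove[of _ i]) auto
      also have "(\<Prod>k\<in>{0..<n} - {i}. ?F k ((l(\<pi> i := Suc (l (\<pi> i)))) (\<pi> k))) = ?R"
        using permutes_inj[OF \<pi>] by (intro prod.cong) (auto simp: inj_def)
      moreover have "?P l \<pi> = ?F i (l (\<pi> i)) * ?R"
        using that by (subst prod.remove[of _ i]) auto
      ultimately show ?thesis by (simp add: fpow_Suc algebra_simps)
    qed
    have "(\<Sum>i = 0..<n. x (Suc i)) * ?P l \<pi> = (\<Sum>i = 0..<n. ?P (l(\<pi> i := Suc (l (\<pi> i)))) \<pi>)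
        + (\<Sum>i = 0..<n. \<alpha> (int n - int (l (\<pi> i)))) * ?P l \<pi>"
      by (simp add: sum_distrib_right step sum.distrib)
    also have "(\<Sum>i = 0..<n. ?P (l(\<pi> i := Suc (l (\<pi> i)))) \<pi>) = (\<Sum>j = 0..<n. ?P (l(j := Suc (l j))) \<pi>)"
      using sum.permute[OF \<pi>, of "\<lambda>j. ?P (l(j := Suc (l j))) \<pi>"] by (simp add: o_def)
    also have "(\<Sum>i = 0..<n. \<alpha> (int n - int (l (\<pi> i)))) = (\<Sum>j = 0..<n. \<alpha> (int n - int (l j)))"
      using sum.permute[OF \<pi>, of "\<lambda>j. \<alpha> (int n - int (l j))"] by (simp add: o_def)
    finally show ?thesis .
  qed
  have "(\<Sum>i = 1..n. x i) = (\<Sum>i = 0..<n. x (Suc i))"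
    by (rule sum.reindex_bij_witness[of _ Suc "\<lambda>i. i - 1"]) auto
  then have "(\<Sum>i = 1..n. x i) * alt \<alpha> x n l = (\<Sum>\<pi> | \<pi> permutes {0..<n}.
      of_int (sign \<pi>) * ((\<Sum>i = 0..<n. x (Suc i)) * ?P l \<pi>))"
    by (simp add: alt_leibniz sum_distrib_left mult.left_commute)
  also have "\<dots> = (\<Sum>\<pi> | \<pi> permutes {0..<n}. (\<Sum>j = 0..<n. of_int (sign \<pi>) * ?P (l(j := Suc (l j))) \<pi>)
      + (\<Sum>j = 0..<n. \<alpha> (int n - int (l j))) * (of_int (sign \<pi>) * ?P l \<pi>))"
    by (intro sum.cong refl) (simp add: * distrib_left sum_distrib_left mult.left_commute)
  also have "\<dots> = (\<Sum>j<n. alt \<alpha> x n (l(j := Suc (l j)))) + (\<Sum>j<n. \<alpha> (int n - int (l j))) * alt \<alpha> x n l"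
    unfolding alt_leibniz sum.distrib sum_distrib_left[symmetric]
    by (subst sum.swap) (simp add: atLeast0LessThan sum_distrib_left)
  finally show ?thesis .
qed

text \<open>A permutation matrix inside the support would need \<open>n - k\<close> rows in \<open>n - k - 1\<close> columns.\<close>

lemma alt_zero_block:
  assumes "k < n" "\<And>i j. k \<le> i \<Longrightarrow> i < n \<Longrightarrow> j \<le> k \<Longrightarrow> fpow \<alpha> n (x (Suc i)) (l j) = 0"
  shows "alt \<alpha> x n l = 0"
proof -
  have "(\<Prod>i = 0..<n. fpow \<alpha> n (x (Suc i)) (l (\<pi> i))) = 0" if \<pi>: "\<pi> permutes {0..<n}" for \<pi>
  proof -
    have "\<exists>i\<in>{k..<n}. \<pi> i \<le> k"
    proof (rule ccontr)
      assume "\<not> ?thesis"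
      then have "\<pi> ` {k..<n} \<subseteq> {Suc k..<n}"
        using permutes_in_image[OF \<pi>] by (force simp: not_le Suc_le_eq)
      moreover have "card (\<pi> ` {k..<n}) = n - k"
        using permutes_inj_on[OF \<pi>] by (simp add: card_image)
      ultimately have "n - k \<le> n - Suc k"
        by (metis card_atLeastLessThan card_mono finite_atLeastLessThan)
      with assms(1) show False by simp
    qed
    then obtain i where "k \<le> i" "i < n" "\<pi> i \<le> k" by auto
    with assms(2) show ?thesis by (intro prod_zero bexI[of _ i]) auto
  qed
  then show ?thesis unfolding alt_leibniz by (intro sum.neutral) auto
qed

section \<open>Partitions\<close>

lemma part_antimono: "i \<le> j \<Longrightarrow> part l j \<le> part l i"
  using part[of l] by (auto simp: monotone_on_def)

lemma finite_part_support: "finite {j. part l j \<noteq> 0}"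
  using part[of l] by auto

lemma downset_eq_lessThan_card:
  fixes S :: "nat set"
  assumes "finite S" "\<And>i j. j \<in> S \<Longrightarrow> i \<le> j \<Longrightarrow> i \<in> S"
  shows "S = {..<card S}"
proof (cases "S = {}")
  case False
  define m where "m = Max S"
  have "m \<in> S" "\<And>i. i \<in> S \<Longrightarrow> i \<le> m"
    using assms(1) False by (simp_all add: m_def)
  then have "S = {..m}" using assms(2)[of m] by blast
  then show ?thesis by (simp add: lessThan_Suc_atMost)
qed simp

lemma part_support: "{j. part l j \<noteq> 0} = {..<partition_length l}"
  unfolding partition_length_def
proof (rule downset_eq_lessThan_card[OF finite_part_support])
  fix i j assume "j \<in> {j. part l j \<noteq> 0}" "i \<le> j"
  then show "i \<in> {j. part l j \<noteq> 0}" using part_antimono[of i j l] by auto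
qed

lemma part_eq_0_iff: "part l j = 0 \<longleftrightarrow> partition_length l \<le> j"
  using part_support[of l] by (metis (mono_tags, lifting) lessThan_iff mem_Collect_eq not_less)

lemma partition_eqI: "(\<And>j. part l j = part m j) \<Longrightarrow> l = m"
  by (simp add: part_inject[symmetric] fun_eq_iff)

section \<open>Diagrams, size and containment\<close>

definition boxes :: "partition \<Rightarrow> (nat \<times> nat) set"
  where "boxes l = {(i, j). j < part l i}"

definition psize :: "partition \<Rightarrow> nat"
  where "psize l = card (boxes l)"

definition contained :: "partition \<Rightarrow> partition \<Rightarrow> bool"
  where "contained l m \<longleftrightarrow> (\<forall>i. part l i \<le> part m i)"

lemma boxes_eq_Sigma: "partition_length l \<le> n \<Longrightarrow> boxes l = (SIGMA i:{..<n}. {..<part l i})"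
  unfolding boxes_def by (auto, metis not_less part_eq_0_iff order_trans less_nat_zero_code)

lemma finite_boxes [simp]: "finite (boxes l)"
  using boxes_eq_Sigma[of l "partition_length l"] by simp

lemma psize_eq_sum: "partition_length l \<le> n \<Longrightarrow> psize l = (\<Sum>i<n. part l i)"
  by (simp add: psize_def boxes_eq_Sigma[of l n])

lemma part_conj: "part (conj_partition l) j = card {i. j < part l i}"
  by (simp add: conj_partition.rep_eq)

text \<open>The rows longer than j form an initial segment, so their number marks where it ends; on
  boxes, conjugation becomes the exchange of coordinates.\<close>

lemma less_part_conj_iff: "i < part (conj_partition l) j \<longleftrightarrow> j < part l i"
proof -
  have "{i. j < part l i} = {..<card {i. j < part l i}}"
  proof (rule downset_eq_lessThan_card)
    show "finite {i. j < part l i}"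
      by (rule finite_subset[OF _ finite_part_support[of l]]) auto
    show "m \<in> {i. j < part l i}" if "k \<in> {i. j < part l i}" "m \<le> k" for k m
      using that part_antimono[of m k l] by auto
  qed
  then have "i \<in> {i. j < part l i} \<longleftrightarrow> i \<in> {..<card {i. j < part l i}}"
    by (rule arg_cong)
  then show ?thesis unfolding part_conj by simp
qed

lemma boxes_conj: "boxes (conj_partition l) = prod.swap ` boxes l"
  by (auto simp: boxes_def less_part_conj_iff image_iff)

lemma psize_conj [simp]: "psize (conj_partition l) = psize l"
  unfolding psize_def boxes_conj by (simp add: card_image)

lemma contained_iff_boxes: "contained l m \<longleftrightarrow> boxes l \<subseteq> boxes m"
proof
  show "boxes l \<subseteq> boxes m" if "contained l m"
    using that by (auto simp: contained_def boxes_def intro: less_le_trans)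
  show "contained l m" if "boxes l \<subseteq> boxes m"
    unfolding contained_def
  proof (rule allI, rule ccontr)
    fix i assume "\<not> part l i \<le> part m i"
    then have "(i, part m i) \<in> boxes l" by (simp add: boxes_def)
    with that show False by (auto simp: boxes_def)
  qed
qed

lemma boxes_inject: "boxes l = boxes m \<longleftrightarrow> l = m"
proof
  assume "boxes l = boxes m"
  then have "j < part l i \<longleftrightarrow> j < part m i" for i j by (auto simp: boxes_def set_eq_iff)
  then show "l = m" by (intro partition_eqI) (meson linorder_neq_iff less_irrefl)
qed simp

lemma conj_conj [simp]: "conj_partition (conj_partition l) = l"
  by (simp add: boxes_conj image_image flip: boxes_inject)

lemma conj_inject [simp]: "conj_partition l = conj_partition m \<longleftrightarrow> l = m"
  by (metis conj_conj)

lemma contained_conj [simp]: "contained (conj_partition l) (conj_partition m) \<longleftrightarrow> contained l m"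
  by (simp add: contained_iff_boxes boxes_conj inj_image_subset_iff)

lemma contained_psize: "contained l m \<Longrightarrow> psize l \<le> psize m"
  by (simp add: contained_iff_boxes psize_def card_mono)

lemma contained_psize_eq: "contained l m \<Longrightarrow> psize m \<le> psize l \<Longrightarrow> l = m"
  by (metis boxes_inject card_subset_eq contained_iff_boxes contained_psize finite_boxes le_antisym psize_def)

lemma partition_length_le_psize: "partition_length l \<le> psize l"
proof -
  have "(\<Sum>i<partition_length l. 1) \<le> (\<Sum>i<partition_length l. part l i)"
    by (rule sum_mono) (metis One_nat_def Suc_leI lessThan_iff not_gr_zero not_less part_eq_0_iff)
  then show ?thesis by (simp add: psize_eq_sum[OF order_refl])
qed

lemma part_le_psize: "part l i \<le> psize l"
proof (cases "i < partition_length l")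
  case True
  then show ?thesis by (simp add: psize_eq_sum[OF order_refl] member_le_sum)
next
  case False
  then show ?thesis using part_eq_0_iff[of l i] by simp
qed

text \<open>Both the number of rows and the parts are bounded by the size. This supplies the finite
  index sets of the expansions in double Schur functions.\<close>

lemma finite_psize_le: "finite {l. psize l \<le> d}"
proof -
  have "part ` {l. psize l \<le> d} \<subseteq> {f. \<forall>i. (i \<in> {..<d} \<longrightarrow> f i \<in> {..d}) \<and> (i \<notin> {..<d} \<longrightarrow> f i = 0)}"
    by (auto simp: part_eq_0_iff not_less intro: order_trans[OF part_le_psize])
      (metis order_trans partition_length_le_psize)
  then have "finite (part ` {l. psize l \<le> d})"
    by (rule finite_subset) (intro finite_set_of_finite_funs finite_lessThan finite_atMost)
  then show ?thesis by (rule finite_imageD) (simp add: inj_on_def part_inject)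
qed

lift_definition empty_partition :: partition is "\<lambda>_. 0"
  by (simp add: monotone_def)

lemma part_empty [simp]: "part empty_partition j = 0"
  by (simp add: empty_partition.rep_eq)

lemma partition_length_empty [simp]: "partition_length empty_partition = 0"
  by (simp add: partition_length_def)

lemma conj_empty [simp]: "conj_partition empty_partition = empty_partition"
  by (rule partition_eqI) (simp add: part_conj)

definition expo :: "nat \<Rightarrow> partition \<Rightarrow> nat \<Rightarrow> nat"
  where "expo n l j = part l j + (n - Suc j)"

text \<open>The numerator is given by \<open>alt_last\<close> or \<open>alt_last_eq_0\<close>,
  according to whether the last exponent is zero; distinct points let the Vandermonde product be
  cancelled. This yields the compatibility condition of the ring.\<close>

lemma schur_quot_Suc:
  fixes x :: "nat \<Rightarrow> 'r::idom"
  assumes "inj_on x {1..Suc n}" "x (Suc n) = \<alpha> (int (Suc n))"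
  shows "schur_quot \<alpha> x (Suc n) (expo (Suc n) l)
    = (if part l n = 0 then schur_quot \<alpha> x n (expo n l) else 0)"
proof -
  have V: "vand x (Suc n) \<noteq> 0" using assms(1) by (rule vand_nonzero)
  have *: "schur_quot \<alpha> x (Suc n) (expo (Suc n) l) * vand x (Suc n) = alt \<alpha> x (Suc n) (expo (Suc n) l)"
    by (simp only: alt_eq_schur_quot)
  show ?thesis
  proof (cases "part l n = 0")
    case True
    have "alt \<alpha> x (Suc n) (expo (Suc n) l) = (\<Prod>i = 1..n. x i - x (Suc n)) * alt \<alpha> x n (expo n l)"
      by (rule alt_last) (use assms True in \<open>auto simp: expo_def Suc_diff_Suc\<close>)
    also have "\<dots> = schur_quot \<alpha> x n (expo n l) * vand x (Suc n)"
      by (simp add: alt_eq_schur_quot vand_Suc mult_ac)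
    finally show ?thesis using * V True by (metis mult_right_cancel)
  next
    case False
    have "alt \<alpha> x (Suc n) (expo (Suc n) l) = 0"
    proof (rule alt_last_eq_0[where \<alpha> = \<alpha>])
      show "0 < expo (Suc n) l j" if "j \<le> n" for j
        using False part_antimono[OF that, of l] by (simp add: expo_def)
    qed (rule assms(2))
    with * V False show ?thesis by simp
  qed
qed

lemma schur_quot_empty [simp]: "schur_quot \<alpha> x n (expo n empty_partition) = 1"
  using schur_quot_staircase[of \<alpha> x n] by (simp add: expo_def[abs_def])

section \<open>Double Schur functions\<close>

abbreviation aconst :: "int \<Rightarrow> xpoly"
  where "aconst \<equiv> \<lambda>i. xconst (avar i)"

lemma xvar_inj: "xvar i = xvar j \<longleftrightarrow> i = j"
  by (metis mpoly_vars_var singleton_inject)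

lemma xvar_neq_xconst: "xvar i \<noteq> xconst c"
  by (metis mpoly_vars_var mpoly_vars_const insert_not_empty)

lemma xconst_hom: "coeff_hom xconst"
  by (rule mpoly_const.coeff_hom_axioms)

lemma xsubst_hom: "coeff_hom (xsubst h)"
  unfolding xsubst_def by (rule coeff_hom_mpoly_eval[OF xconst_hom])

lemma schur_numerator_eq_alt: "schur_numerator n l = alt aconst xvar n (expo n l)"
  unfolding schur_numerator_def alt_def
  by (intro arg_cong[where f = det] eq_matI) (auto simp: factorial_power_def fpow_def expo_def)

lemma vandermonde_prod_eq_vand: "vandermonde_prod n = vand xvar n"
  by (simp add: vandermonde_prod_def vand_def)

lemma vand_xvar_nonzero: "vand xvar n \<noteq> 0"
  by (rule vand_nonzero) (simp add: inj_on_def xvar_inj)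

text \<open>The determinant of divided differences is a witness for the description, and cancelling
  the nonzero Vandermonde product shows that it is the only one.\<close>

lemma double_schur_poly_eq:
  "double_schur_poly l n =
    (if partition_length l \<le> n then schur_quot aconst xvar n (expo n l) else 0)"
proof -
  have "(THE q. q * vand xvar n = alt aconst xvar n (expo n l)) = schur_quot aconst xvar n (expo n l)"
    using vand_xvar_nonzero by (intro the_equality) (auto simp: alt_eq_schur_quot)
  then show ?thesis
    by (simp add: double_schur_poly_def schur_numerator_eq_alt vandermonde_prod_eq_vand)
qed

lemma xsubst_schur_quot: "xsubst h (schur_quot aconst xvar n l) = schur_quot aconst h n l"
  using hom_schur_quot[OF xsubst_hom, of h aconst xvar n l] by (simp add: o_def xsubst_simps)

lemma schur_quot_cong:
  assumes "\<And>i. i \<in> {1..n} \<Longrightarrow> x i = y i" shows "schur_quot \<alpha> x n l = schur_quot \<alpha> y n l"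
proof -
  have "newton_coeff (\<lambda>m. x (n - m)) b r k = newton_coeff (\<lambda>m. y (n - m)) b r k" if "k < n" for b r k
    using that by (induct r arbitrary: k) (auto simp: assms)
  then show ?thesis unfolding schur_quot_def by (intro arg_cong[where f = det] eq_matI) auto
qed

section \<open>Variables and degrees of the quotient\<close>

lemma mpoly_vars_0 [simp]: "mpoly_vars 0 = {}"
  by (simp add: mpoly_vars_def)

lemma mpoly_vars_sum:
  "(\<And>i. i \<in> A \<Longrightarrow> mpoly_vars (g i) \<subseteq> S) \<Longrightarrow> mpoly_vars (sum g A) \<subseteq> S"
  by (induct A rule: infinite_finite_induct) (auto dest!: subsetD[OF mpoly_vars_add])

lemma mpoly_vars_prod:
  "(\<And>i. i \<in> A \<Longrightarrow> mpoly_vars (g i) \<subseteq> S) \<Longrightarrow> mpoly_vars (prod g A) \<subseteq> S"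
  by (induct A rule: infinite_finite_induct) (auto dest!: subsetD[OF mpoly_vars_mult])

lemma mpoly_vars_power: "mpoly_vars p \<subseteq> S \<Longrightarrow> mpoly_vars (p ^ k) \<subseteq> S"
  by (induct k) (auto dest!: subsetD[OF mpoly_vars_mult])

lemma mpoly_vars_xsubst:
  assumes "\<And>i. mpoly_vars (h i) \<subseteq> S" shows "mpoly_vars (xsubst h p) \<subseteq> S"
  unfolding xsubst_def mpoly_eval_def monom_eval_def
  by (intro mpoly_vars_sum order_trans[OF mpoly_vars_mult] Un_least mpoly_vars_prod mpoly_vars_power assms)
    simp

lemma xdegree_le_0 [simp]: "xdegree_le 0 d"
  by (simp add: xdegree_le_def)

lemma xdegree_le_1 [simp]: "xdegree_le 1 d"
  using xdegree_le_mono[OF xdegree_le_const[of 1]] by simp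

lemma xdegree_le_plus: "xdegree_le p d \<Longrightarrow> xdegree_le q d \<Longrightarrow> xdegree_le (p + q) d"
  using keys_add[of p q] by (fastforce simp: xdegree_le_def)

lemma xdegree_le_minus: "xdegree_le p d \<Longrightarrow> xdegree_le q d \<Longrightarrow> xdegree_le (p - q) d"
  using xdegree_le_plus[of p d "- q"] xdegree_le_uminus[of q d] by simp

lemma xdegree_le_sum: "(\<And>i. i \<in> A \<Longrightarrow> xdegree_le (g i) d) \<Longrightarrow> xdegree_le (sum g A) d"
  by (induct A rule: infinite_finite_induct) (auto intro: xdegree_le_plus)

lemma xdegree_le_prod:
  "(\<And>i. i \<in> A \<Longrightarrow> xdegree_le (g i) (d i)) \<Longrightarrow> xdegree_le (prod g A) (sum d A)"
  by (induct A rule: infinite_finite_induct) (auto intro: xdegree_le_mult)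

text \<open>The recursion either raises r and k together or multiplies by a linear factor. For k > r
  the coefficient is zero, so the truncated difference does no harm.\<close>

lemma xdegree_le_newton_coeff:
  assumes "\<And>m. xdegree_le (y m) 1" "\<And>m. xdegree_le (b m) 1"
  shows "xdegree_le (newton_coeff y b r k) (r - k)"
proof (induct r arbitrary: k)
  case 0
  then show ?case by simp
next
  case (Suc r)
  have "xdegree_le (if k = 0 then 0 else newton_coeff y b r (k - 1)) (Suc r - k)"
    using Suc[of "k - 1"] by (cases k) auto
  moreover have "xdegree_le ((y k - b r) * newton_coeff y b r k) (Suc r - k)"
  proof (cases "k \<le> r")
    case True
    then have "Suc r - k = 1 + (r - k)" by simp
    then show ?thesis by (simp only:) (intro xdegree_le_mult xdegree_le_minus assms Suc)
  qed (simp add: newton_coeff_eq_0)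
  ultimately show ?case by (simp only: newton_coeff.simps) (rule xdegree_le_plus)
qed

text \<open>In the Leibniz expansion the orders of the divided differences cancel the staircase part
  of the exponents, which leaves a bound that does not grow with n.\<close>

lemma xdegree_le_schur_quot:
  "xdegree_le (schur_quot aconst xvar n (expo n l)) (\<Sum>j<n. part l j)"
proof -
  let ?c = "newton_coeff (\<lambda>m. xvar (n - m)) (\<lambda>m. aconst (int n - int m))"
  have "xdegree_le (\<Prod>k = 0..<n. ?c (expo n l (\<pi> k)) (n - 1 - k)) (\<Sum>j<n. part l j)"
    if \<pi>: "\<pi> permutes {0..<n}" for \<pi>
  \<comment> \<open>A factor whose order exceeds its exponent is zero; in the other case the
    truncated differences are exact and can be summed separately.\<close>
  proof (cases "\<exists>k<n. expo n l (\<pi> k) < n - 1 - k")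
    case True
    then have "(\<Prod>k = 0..<n. ?c (expo n l (\<pi> k)) (n - 1 - k)) = 0"
      by (intro prod_zero) (auto intro: newton_coeff_eq_0)
    then show ?thesis by (simp only: xdegree_le_0)
  next
    case False
    have "xdegree_le (\<Prod>k = 0..<n. ?c (expo n l (\<pi> k)) (n - 1 - k))
        (\<Sum>k = 0..<n. expo n l (\<pi> k) - (n - 1 - k))"
      by (intro xdegree_le_prod xdegree_le_newton_coeff xdegree_le_var
          xdegree_le_mono[OF xdegree_le_const]) simp
    also have "(\<Sum>k = 0..<n. expo n l (\<pi> k) - (n - 1 - k))
        = (\<Sum>k = 0..<n. expo n l (\<pi> k)) - (\<Sum>k = 0..<n. n - 1 - k)"
      using False by (intro sum_subtractf_nat) (meson atLeastLessThan_iff not_less)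
    also have "(\<Sum>k = 0..<n. expo n l (\<pi> k)) = (\<Sum>k = 0..<n. expo n l k)"
      using sum.permute[OF \<pi>, of "expo n l"] by (simp add: o_def)
    also have "\<dots> - (\<Sum>k = 0..<n. n - 1 - k) = (\<Sum>j<n. part l j)"
      unfolding expo_def sum.distrib by (simp add: atLeast0LessThan)
    finally show ?thesis .
  qed
  moreover have "xdegree_le (of_int (sign \<pi>) * p) d" if "xdegree_le p d" for p d and \<pi> :: "nat \<Rightarrow> nat"
    using that xdegree_le_uminus by (cases \<pi> rule: sign_cases) auto
  moreover have "schur_quot aconst xvar n (expo n l) = (\<Sum>\<pi> | \<pi> permutes {0..<n}.
      of_int (sign \<pi>) * (\<Prod>k = 0..<n. ?c (expo n l (\<pi> k)) (n - 1 - k)))"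
    unfolding schur_quot_def by (rule det_mat_leibniz)
  ultimately show ?thesis by (auto intro: xdegree_le_sum)
qed

text \<open>Numerator and denominator change by the same sign, the denominator being the staircase
  alternant.\<close>

lemma schur_quot_symmetric:
  assumes "\<pi> permutes {1..n}"
  shows "schur_quot aconst (\<lambda>i. xvar (\<pi> i)) n l = schur_quot aconst xvar n l"
proof -
  let ?\<pi> = "\<lambda>i. if i < n then \<pi> (Suc i) - 1 else i"
  let ?s = "of_int (sign ?\<pi>) :: xpoly"
  have "\<pi> (Suc i) \<noteq> 0" if "i < n" for i
    using permutes_in_image[OF assms, of "Suc i"] that by auto
  then have *: "alt aconst (\<lambda>i. xvar (\<pi> i)) n l = ?s * alt aconst xvar n l" for l
    by (intro alt_permute_vars permutes_shift assms) auto
  have "schur_quot aconst (\<lambda>i. xvar (\<pi> i)) n l * (?s * vand xvar n)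
      = schur_quot aconst xvar n l * (?s * vand xvar n)"
    using *[of l] *[of "\<lambda>j. n - Suc j"]
    by (simp only: alt_staircase) (simp add: alt_eq_schur_quot mult_ac)
  moreover have "?s * vand xvar n \<noteq> 0"
    using vand_xvar_nonzero[of n] by (cases ?\<pi> rule: sign_cases) auto
  ultimately show ?thesis by simp
qed

lemma double_symmetric_double_schur_poly: "double_symmetric (double_schur_poly l)"
  unfolding double_symmetric_def symmetric_xpoly_def
proof (intro conjI allI impI exI)
  fix n
  let ?q = "schur_quot aconst xvar n (expo n l)"
  \<comment> \<open>Killing all other variables leaves the quotient unchanged, since it is built
    from \<open>xvar 1\<close> to \<open>xvar n\<close> only, and the result visibly involves no
    others.\<close>
  let ?h = "\<lambda>i. if i \<in> {1..n} then xvar i else 0"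
  have "mpoly_vars ?q \<subseteq> {1..n}"
  proof -
    have "mpoly_vars (xsubst ?h ?q) \<subseteq> {1..n}"
      by (rule mpoly_vars_xsubst) auto
    also have "xsubst ?h ?q = ?q"
      unfolding xsubst_schur_quot by (rule schur_quot_cong) auto
    finally show ?thesis .
  qed
  then show "mpoly_vars (double_schur_poly l n) \<subseteq> {1..n}"
    by (simp add: double_schur_poly_eq)
  show "xsubst (\<lambda>i. xvar (\<pi> i)) (double_schur_poly l n) = double_schur_poly l n"
    if "\<pi> permutes {1..n}" for \<pi>
    using that by (simp add: double_schur_poly_eq xsubst_schur_quot xsubst_simps schur_quot_symmetric)
  show "xdegree_le (double_schur_poly l n) (psize l)"
    using xdegree_le_schur_quot[of n l] by (simp add: double_schur_poly_eq psize_eq_sum)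
  assume "1 \<le> n"
  then obtain m where n: "n = Suc m" by (cases n) auto
  let ?h = "xvar(n := xconst (avar (int n)))"
  have "inj_on ?h {1..Suc m}"
    by (auto simp: inj_on_def xvar_inj xvar_neq_xconst xvar_neq_xconst[symmetric] n)
  then have "schur_quot aconst ?h n (expo n l)
      = (if part l m = 0 then schur_quot aconst xvar m (expo m l) else 0)"
    using schur_quot_Suc[of ?h m aconst l] schur_quot_cong[of m ?h xvar] by (simp add: n)
  then show "xsubst ?h (double_schur_poly l n) = double_schur_poly l (n - 1)"
    using part_eq_0_iff[of l m]
    by (auto simp: double_schur_poly_eq xsubst_schur_quot xsubst_simps n)
qed

lemma component_double_schur: "component (double_schur l) = double_schur_poly l"
  by (simp add: double_schur_def Abs_dsym_inverse double_symmetric_double_schur_poly)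

section \<open>Evaluation at partitions\<close>

definition xeval :: "(nat \<Rightarrow> qa) \<Rightarrow> xpoly \<Rightarrow> qa"
  where "xeval = mpoly_eval id"

lemma xeval_hom: "coeff_hom (xeval y)"
  unfolding xeval_def by (rule coeff_hom_mpoly_eval[OF coeff_hom_id])

lemma xeval_simps [simp]: "xeval y (xconst c) = c" "xeval y (xvar i) = y i"
  by (simp_all add: xeval_def coeff_hom.eval_const[OF coeff_hom_id] coeff_hom.eval_var[OF coeff_hom_id])

lemma xeval_schur_quot: "xeval y (schur_quot aconst xvar n l) = schur_quot avar y n l"
  using hom_schur_quot[OF xeval_hom, of y aconst xvar n l] by (simp add: o_def)

lemma avar_inj [simp]: "avar i = avar j \<longleftrightarrow> i = j"
  by (metis mpoly_vars_var singleton_inject)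

text \<open>The point \<open>a\<^sub>\<mu> = (a\<^sub>1\<^sub>-\<^sub>\<mu>\<^sub>1, a\<^sub>2\<^sub>-\<^sub>\<mu>\<^sub>2, \<dots>)\<close> of the vanishing theorem.\<close>

definition apoint :: "partition \<Rightarrow> nat \<Rightarrow> qa"
  where "apoint m i = avar (int i - int (part m (i - 1)))"

lemma apoint_inj: "inj_on (apoint m) {1..n}"
proof (rule linorder_inj_onI')
  fix i j assume "i \<in> {1..n}" "j \<in> {1..n}" "i < j"
  then show "apoint m i \<noteq> apoint m j"
    using part_antimono[OF diff_le_mono[OF less_imp_le[of i j], of 1], of m] by (simp add: apoint_def)
qed

text \<open>Since the a_i are distinct, the product vanishes exactly when it reaches the factor
  \<open>k = n - Suc i + part m i\<close>. For j < n the condition reads m_i - i < l_j - j.\<close>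

lemma fpow_avar_eq_0_iff:
  assumes "i < n"
  shows "fpow avar n (apoint m (Suc i)) (expo n l j) = 0 \<longleftrightarrow>
    int (part m i) - int i < int (part l j) + int (n - Suc j) - int n + 1"
proof -
  have "fpow avar n (apoint m (Suc i)) (expo n l j) = 0 \<longleftrightarrow>
      (\<exists>k<expo n l j. int (Suc i) - int (part m i) = int n - int k)"
    by (auto simp: fpow_def apoint_def)
  also have "\<dots> \<longleftrightarrow> n - Suc i + part m i < expo n l j"
    using assms by (auto intro!: exI[of _ "n - Suc i + part m i"])
  finally show ?thesis using assms by (auto simp: expo_def)
qed

text \<open>If row k of l is longer than that of m, then m_i - i \<le> m_k - k < l_k - k \<le> l_j -
  j for j \<le> k \<le> i, and this zero block forces the determinant to vanish.\<close>

lemma schur_quot_apoint_eq_0: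
  assumes "partition_length l \<le> n" "\<not> contained l m"
  shows "schur_quot avar (apoint m) n (expo n l) = 0"
proof -
  from assms(2) obtain k where k: "part m k < part l k" by (auto simp: contained_def not_le)
  then have "k < n"
    by (metis assms(1) leI less_nat_zero_code order_trans part_eq_0_iff)
  have "alt avar (apoint m) n (expo n l) = 0"
  proof (rule alt_zero_block[OF \<open>k < n\<close>])
    fix i j assume "k \<le> i" "i < n" "j \<le> k"
    then show "fpow avar n (apoint m (Suc i)) (expo n l j) = 0"
      using k part_antimono[of k i m] part_antimono[of j k l] by (simp add: fpow_avar_eq_0_iff)
  qed
  then show ?thesis
    using vand_nonzero[OF apoint_inj] by (simp add: alt_eq_schur_quot)
qed

text \<open>The numbers l_i - i decrease strictly, so the matrix vanishes below the diagonal and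
  nowhere on it.\<close>

lemma schur_quot_apoint_diag: "schur_quot avar (apoint l) n (expo n l) \<noteq> 0"
proof -
  let ?A = "mat n n (\<lambda>(i, j). fpow avar n (apoint l (Suc i)) (expo n l j))"
  have "upper_triangular ?A"
  proof (rule upper_triangularI)
    fix i j assume "j < i" "i < dim_row ?A"
    then show "?A $$ (i, j) = 0"
      using part_antimono[of j i l] by (simp add: fpow_avar_eq_0_iff)
  qed
  then have "det ?A = prod_list (diag_mat ?A)"
    by (rule det_upper_triangular[of _ n]) auto
  also have "\<dots> = (\<Prod>i = 0..<n. fpow avar n (apoint l (Suc i)) (expo n l i))"
    by (simp add: prod_list_diag_prod)
  also have "\<dots> \<noteq> 0"
    by (auto simp: fpow_avar_eq_0_iff)
  finally show ?thesis by (auto simp: alt_eq_schur_quot simp flip: alt_def)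
qed

text \<open>Among the indices with nonzero coefficient take j of least size: in the relation at j
  only its own summand survives.\<close>

lemma triangular_independent:
  fixes E :: "'i \<Rightarrow> 'i \<Rightarrow> 'r::idom" and sz :: "'i \<Rightarrow> nat"
  assumes "finite I" and diag: "\<And>i. i \<in> I \<Longrightarrow> E i i \<noteq> 0"
    and tri: "\<And>i j. i \<in> I \<Longrightarrow> j \<in> I \<Longrightarrow> sz j \<le> sz i \<Longrightarrow> i \<noteq> j \<Longrightarrow> E i j = 0"
    and sum: "\<And>j. j \<in> I \<Longrightarrow> (\<Sum>i\<in>I. c i * E i j) = 0"
    and "i \<in> I"
  shows "c i = 0"
proof (rule ccontr)
  assume "c i \<noteq> 0"
  then obtain j where j: "j \<in> I" "c j \<noteq> 0" and min: "\<And>k. k \<in> I \<Longrightarrow> c k \<noteq> 0 \<Longrightarrow> sz j \<le> sz k"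
    using ex_has_least_nat[of "\<lambda>k. k \<in> I \<and> c k \<noteq> 0" i sz] \<open>i \<in> I\<close> by blast
  have "c i * E i j = 0" if "i \<in> I - {j}" for i
    using min[of i] tri[of i j] that j(1) by (cases "c i = 0") auto
  then have "(\<Sum>i\<in>I. c i * E i j) = c j * E j j"
    using \<open>finite I\<close> j(1) by (simp only: sum.remove[of I j]) (simp add: sum.neutral)
  with sum diag j show False by simp
qed

lemma schur_quot_apoint_tri:
  assumes "partition_length l \<le> n" "psize m \<le> psize l" "l \<noteq> m"
  shows "schur_quot avar (apoint m) n (expo n l) = 0"
  using assms contained_psize_eq schur_quot_apoint_eq_0 by blast

lemma double_schur_poly_independent:
  assumes "finite I" "\<And>l. l \<in> I \<Longrightarrow> partition_length l \<le> n"
    and "(\<Sum>l\<in>I. xconst (c l) * double_schur_poly l n) = 0" and "l \<in> I"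
  shows "c l = 0"
proof (rule triangular_independent[of I "\<lambda>l m. schur_quot avar (apoint m) n (expo n l)" psize c])
  fix m
  have "0 = xeval (apoint m) (\<Sum>l\<in>I. xconst (c l) * double_schur_poly l n)"
    by (simp add: assms coeff_hom.f_0[OF xeval_hom])
  also have "\<dots> = (\<Sum>l\<in>I. c l * schur_quot avar (apoint m) n (expo n l))"
    by (simp add: coeff_hom_sum[OF xeval_hom] coeff_hom.f_mult[OF xeval_hom] double_schur_poly_eq
        assms(2) xeval_schur_quot)
  finally show "(\<Sum>l\<in>I. c l * schur_quot avar (apoint m) n (expo n l)) = 0" ..
qed (use assms schur_quot_apoint_diag schur_quot_apoint_tri in auto)

section \<open>Expansion of symmetric polynomials\<close>

lemma module_span_image:
  assumes "Modules.module scale" "finite I" "p \<in> module.span scale (s ` I)"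
  obtains c where "p = (\<Sum>i\<in>I. scale (c i) (s i))"
proof -
  interpret Modules.module scale by fact
  have "\<exists>c. p = (\<Sum>i\<in>I. scale (c i) (s i))"
    using assms(3)
  proof (induct rule: span_induct_alt)
    case base
    show ?case by (rule exI[of _ "\<lambda>_. 0"]) simp
  next
    case (step c x y)
    then obtain b i where y: "y = (\<Sum>i\<in>I. scale (b i) (s i))" and i: "i \<in> I" "x = s i" by auto
    have "scale c x + y = (\<Sum>j\<in>I. scale ((b(i := b i + c)) j) (s j))"
      using i assms(2) by (simp add: y sum.remove[of I i] scale_left_distrib)
    then show ?case by blast
  qed
  then show ?thesis using that by blast
qed

interpretation xmod: Modules.module "\<lambda>c p. xconst c * p"
  by standard (simp_all add: distrib_left distrib_right mpoly_const.f_add mpoly_const.f_mult mult_ac)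

text \<open>Factorial monomials replace ordinary ones because antisymmetrization turns them directly
  into alternants.\<close>

definition fprod :: "nat \<Rightarrow> (nat \<Rightarrow> nat) \<Rightarrow> xpoly"
  where "fprod n b = (\<Prod>i = 0..<n. fpow aconst n (xvar (Suc i)) (b i))"

definition fprod_span :: "nat \<Rightarrow> nat \<Rightarrow> xpoly set"
  where "fprod_span n d = xmod.span {fprod n b | b. (\<Sum>i = 0..<n. b i) \<le> d}"

lemma fprod_span_mono: "d \<le> e \<Longrightarrow> fprod_span n d \<subseteq> fprod_span n e"
  unfolding fprod_span_def by (rule xmod.span_mono) auto

lemma xvar_mult_fprod:
  assumes "i < n"
  shows "xvar (Suc i) * fprod n b = fprod n (b(i := Suc (b i))) + aconst (int n - int (b i)) * fprod n b"
proof -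
  have *: "fprod n c = fpow aconst n (xvar (Suc i)) (c i) *
      (\<Prod>k\<in>{0..<n} - {i}. fpow aconst n (xvar (Suc k)) (c k))" for c
    unfolding fprod_def using assms by (subst prod.remove[of _ i]) auto
  show ?thesis unfolding *[of b] *[of "b(i := Suc (b i))"]
    by (simp add: fpow_Suc algebra_simps)
qed

lemma fprod_span_mult_var:
  assumes "i \<in> {1..n}" "p \<in> fprod_span n d" shows "xvar i * p \<in> fprod_span n (Suc d)"
  using assms(2) unfolding fprod_span_def
proof (induct rule: xmod.span_induct_alt)
  case base
  then show ?case using xmod.span_zero by simp
next
  case (step c x y)
  obtain b where b: "x = fprod n b" "(\<Sum>i = 0..<n. b i) \<le> d" using step by blast
  obtain k where k: "i = Suc k" "k < n" using assms(1) by (cases i) auto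
  have "(\<Sum>i = 0..<n. (b(k := Suc (b k))) i) \<le> Suc d"
    using b(2) k by (simp add: sum.remove[of _ k])
  then have "xvar i * x \<in> xmod.span {fprod n b | b. (\<Sum>i = 0..<n. b i) \<le> Suc d}"
    unfolding b(1) k(1) xvar_mult_fprod[OF k(2)] using b(2)
    by (intro xmod.span_add xmod.span_scale xmod.span_base) auto
  then have "xconst c * (xvar i * x) + xvar i * y \<in> xmod.span {fprod n b | b. (\<Sum>i = 0..<n. b i) \<le> Suc d}"
    using step by (intro xmod.span_add xmod.span_scale)
  then show ?case by (simp add: algebra_simps)
qed

lemma fprod_span_mult_power:
  assumes "i \<in> {1..n}" "p \<in> fprod_span n d" shows "xvar i ^ k * p \<in> fprod_span n (d + k)"
  by (induct k) (use assms fprod_span_mult_var[OF assms(1)] in \<open>auto simp: mult.assoc\<close>)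

lemma fprod_span_all:
  assumes "mpoly_vars p \<subseteq> {1..n}" "xdegree_le p d" shows "p \<in> fprod_span n d"
proof -
  have mono: "(\<Prod>i\<in>A. xvar i ^ e i) \<in> fprod_span n (sum e A)" if "finite A" "A \<subseteq> {1..n}" for A e
    using that
  proof (induct A rule: finite_induct)
    case empty
    have "1 = fprod n (\<lambda>_. 0)" by (simp add: fprod_def)
    then show ?case unfolding fprod_span_def by (auto intro!: xmod.span_base exI[of _ "\<lambda>_. 0"])
  next
    case (insert i A)
    then show ?case using fprod_span_mult_power[of i n "\<Prod>i\<in>A. xvar i ^ e i" "sum e A" "e i"]
      by (simp add: add.commute)
  qed
  have "monom_eval xvar m \<in> fprod_span n d" if "m \<in> Poly_Mapping.keys p" for m
  proof -
    have "monom_eval xvar m \<in> fprod_span n (monom_degree m)"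
      unfolding monom_eval_def monom_degree_def
      by (rule mono) (use assms(1) that in \<open>auto simp: mpoly_vars_def\<close>)
    moreover have "monom_degree m \<le> d" using assms(2) that by (simp add: xdegree_le_def)
    ultimately show ?thesis using fprod_span_mono by blast
  qed
  then have "(\<Sum>m\<in>Poly_Mapping.keys p. xconst (Poly_Mapping.lookup p m) * monom_eval xvar m) \<in> fprod_span n d"
    unfolding fprod_span_def by (intro xmod.span_sum xmod.span_scale) auto
  then show ?thesis by (simp flip: mpoly_sum_monom)
qed

lemma strict_sort_exists:
  assumes "inj_on b {0..<n}"
  shows "\<exists>\<pi>. \<pi> permutes {0..<n::nat} \<and> (\<forall>i j. i < j \<longrightarrow> j < n \<longrightarrow> b (\<pi> j) < (b (\<pi> i) :: nat))"
proof -
  define xs where "xs = rev (sorted_list_of_set (b ` {0..<n}))"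
  have len: "length xs = n" and set: "set xs = b ` {0..<n}" and dist: "distinct xs"
    using assms by (simp_all add: xs_def card_image)
  have desc: "xs ! j < xs ! i" if "i < j" "j < n" for i j
    using that len strict_sorted_list_of_set[of "b ` {0..<n}"]
    by (auto simp: xs_def rev_nth sorted_wrt_iff_nth_less)
  let ?\<pi> = "\<lambda>i. if i \<in> {0..<n} then inv_into {0..<n} b (xs ! i) else i"
  have "bij_betw (\<lambda>i. xs ! i) {0..<n} (b ` {0..<n})"
    using bij_betw_nth[OF dist, of "{0..<n}"] len set by (simp add: atLeast0LessThan)
  moreover have "bij_betw (inv_into {0..<n} b) (b ` {0..<n}) {0..<n}"
    by (rule bij_betw_inv_into) (simp add: assms bij_betw_def)
  ultimately have "bij_betw (inv_into {0..<n} b \<circ> (\<lambda>i. xs ! i)) {0..<n} {0..<n}"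
    by (rule bij_betw_trans)
  then have "bij_betw ?\<pi> {0..<n} {0..<n}"
    by (rule bij_betw_cong[THEN iffD1, rotated]) auto
  then have "?\<pi> permutes {0..<n}" by (rule bij_imp_permutes) auto
  moreover have "b (?\<pi> i) = xs ! i" if "i < n" for i
    using that len set nth_mem[of i xs] by (simp add: f_inv_into_f)
  ultimately show ?thesis using desc by (intro exI[of _ ?\<pi>]) auto
qed

lemma strict_desc_gap:
  assumes "\<And>i j. i < j \<Longrightarrow> j < n \<Longrightarrow> g j < (g i :: nat)" "i \<le> j" "j < n"
  shows "g j + (j - i) \<le> g i"
  using assms(2,3)
proof (induct j)
  case (Suc j)
  show ?case
  proof (cases "i = Suc j")
    case False
    with Suc have "g j + (j - i) \<le> g i" "i \<le> j" by auto
    with assms(1)[of j "Suc j"] Suc show ?thesis by simp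
  qed simp
qed simp

text \<open>Repeated exponents give zero. Distinct ones can be sorted at the cost of a sign, and
  subtracting the staircase from a strictly decreasing sequence leaves a partition.\<close>

lemma alt_in_span:
  assumes "(\<Sum>i = 0..<n. b i) \<le> d + (\<Sum>i = 0..<n. n - Suc i)"
  shows "alt aconst xvar n b \<in>
    xmod.span ((\<lambda>l. alt aconst xvar n (expo n l)) ` {l. partition_length l \<le> n \<and> psize l \<le> d})"
proof (cases "inj_on b {0..<n}")
  case False
  then obtain i j where "i < n" "j < n" "i \<noteq> j" "b i = b j" by (auto simp: inj_on_def)
  then show ?thesis using xmod.span_zero by (simp add: alt_eq_exponents)
next
  case True
  then obtain \<pi> where \<pi>: "\<pi> permutes {0..<n}" and desc: "\<And>i j. i < j \<Longrightarrow> j < n \<Longrightarrow> b (\<pi> j) < b (\<pi> i)"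
    using strict_sort_exists by blast
  define g where "g = b \<circ> \<pi>"
  have gap: "g j + (j - i) \<le> g i" if "i \<le> j" "j < n" for i j
    using that desc by (intro strict_desc_gap[of n]) (auto simp: g_def)
  define f where "f = (\<lambda>j. if j < n then g j - (n - Suc j) else 0)"
  \<comment> \<open>Strict decrease keeps g above the staircase, so the truncated differences in
    \<open>f\<close> are exact.\<close>
  have low: "n - Suc j \<le> g j" if "j < n" for j
  proof -
    have "g (n - 1) + (n - 1 - j) \<le> g j" by (rule gap) (use that in auto)
    then show ?thesis by arith
  qed
  have "antimono f"
    unfolding f_def using gap low by (intro antimonoI) (fastforce simp: le_diff_conv)
  moreover have "finite {j. f j \<noteq> 0}"
    by (rule finite_subset[of _ "{..<n}"]) (auto simp: f_def split: if_splits)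
  ultimately have l: "part (Abs_partition f) = f" by (simp add: Abs_partition_inverse)
  let ?l = "Abs_partition f"
  have len: "partition_length ?l \<le> n"
    unfolding part_eq_0_iff[symmetric] l by (simp add: f_def)
  have ex: "expo n ?l j = g j" if "j < n" for j
    unfolding expo_def l using low[OF that] that by (simp add: f_def)
  have "(\<Sum>j = 0..<n. b j) = (\<Sum>j = 0..<n. g j)"
    using sum.permute[OF \<pi>, of b] by (simp add: g_def)
  also have "\<dots> = (\<Sum>j = 0..<n. expo n ?l j)"
    using ex by (intro sum.cong) auto
  also have "\<dots> = psize ?l + (\<Sum>j = 0..<n. n - Suc j)"
    unfolding expo_def sum.distrib by (simp add: psize_eq_sum[OF len] atLeast0LessThan)
  finally have "psize ?l \<le> d"
    using assms by simp
  moreover have "alt aconst xvar n b = of_int (sign \<pi>) * alt aconst xvar n (expo n ?l)"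
  proof -
    have "alt aconst xvar n (expo n ?l) = alt aconst xvar n g"
      by (rule alt_cong) (auto simp: ex)
    then show ?thesis
      by (cases \<pi> rule: sign_cases) (simp_all add: g_def alt_permute_exponents[OF \<pi>])
  qed
  moreover have "of_int (sign \<pi>) * p = xconst (of_int (sign \<pi>)) * p" for p
    by (cases \<pi> rule: sign_cases) (simp_all add: coeff_hom_uminus[OF xconst_hom])
  ultimately show ?thesis using len
    by (simp only:) (rule xmod.span_scale, rule xmod.span_base, blast)
qed

section \<open>Antisymmetrization\<close>

definition shifted_subst :: "nat \<Rightarrow> (nat \<Rightarrow> nat) \<Rightarrow> nat \<Rightarrow> xpoly"
  where "shifted_subst n \<pi> i = xvar (if i \<in> {1..n} then Suc (\<pi> (i - 1)) else i)"

definition antisymmetrize :: "nat \<Rightarrow> xpoly \<Rightarrow> xpoly"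
  where "antisymmetrize n p =
    (\<Sum>\<pi> | \<pi> permutes {0..<n}. of_int (sign \<pi>) * xsubst (shifted_subst n \<pi>) p)"

lemma antisymmetrize_add: "antisymmetrize n (p + q) = antisymmetrize n p + antisymmetrize n q"
  by (simp add: antisymmetrize_def xsubst_simps distrib_left sum.distrib)

lemma antisymmetrize_scale: "antisymmetrize n (xconst c * p) = xconst c * antisymmetrize n p"
  by (simp add: antisymmetrize_def xsubst_simps sum_distrib_left mult.left_commute)

lemma antisymmetrize_fprod: "antisymmetrize n (fprod n b) = alt aconst xvar n b"
proof -
  have "xsubst (shifted_subst n \<pi>) (fprod n b) = (\<Prod>i = 0..<n. fpow aconst n (xvar (Suc (\<pi> i))) (b i))"
    for \<pi>
    by (simp add: fprod_def coeff_hom_prod[OF xsubst_hom] hom_fpow[OF xsubst_hom] o_def xsubst_simps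
        shifted_subst_def)
  moreover have "alt aconst xvar n b = (\<Sum>\<pi> | \<pi> permutes {0..<n}.
      of_int (sign \<pi>) * (\<Prod>i = 0..<n. fpow aconst n (xvar (Suc (\<pi> i))) (b i)))"
    unfolding alt_transpose by (rule det_mat_leibniz)
  ultimately show ?thesis by (simp add: antisymmetrize_def)
qed

lemma of_nat_eq_xconst: "(of_nat k :: xpoly) = xconst (mpoly_const (of_nat k))"
  by (induct k) (simp_all add: mpoly_const.f_add)

text \<open>A permutation fixes p and multiplies the Vandermonde product by its sign, which the
  signed sum squares away: all n! summands are equal.\<close>

lemma antisymmetrize_symmetric_mult_vand:
  assumes "symmetric_xpoly n p"
  shows "antisymmetrize n (p * vand xvar n) = xconst (mpoly_const (fact n)) * (p * vand xvar n)"
proof -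
  have "of_int (sign \<pi>) * xsubst (shifted_subst n \<pi>) (p * vand xvar n) = p * vand xvar n"
    if \<pi>: "\<pi> permutes {0..<n}" for \<pi>
  proof -
    have "xsubst (shifted_subst n \<pi>) p = p"
      using assms permutes_unshift[OF \<pi>] unfolding symmetric_xpoly_def shifted_subst_def[abs_def] by blast
    moreover have "xsubst (shifted_subst n \<pi>) (vand xvar n) = vand (shifted_subst n \<pi>) n"
      using hom_vand[OF xsubst_hom, of "shifted_subst n \<pi>" xvar n] by (simp add: o_def xsubst_simps)
    moreover have "vand (shifted_subst n \<pi>) n = of_int (sign \<pi>) * vand xvar n"
      unfolding alt_staircase[of aconst, symmetric]
      by (rule alt_permute_vars[OF \<pi>]) (simp add: shifted_subst_def)
    ultimately show ?thesis
      by (cases \<pi> rule: sign_cases) (simp_all add: xsubst_simps)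
  qed
  then have "antisymmetrize n (p * vand xvar n) = of_nat (fact n) * (p * vand xvar n)"
    by (simp add: antisymmetrize_def card_permutations[of _ n])
  then show ?thesis unfolding of_nat_eq_xconst by simp
qed

lemma xdegree_le_vand: "xdegree_le (vand xvar n) (\<Sum>i = 0..<n. n - Suc i)"
proof -
  have "xdegree_le (vand xvar n) (\<Sum>i = 1..n. \<Sum>j = Suc i..n. 1)"
    unfolding vand_prod by (intro xdegree_le_prod xdegree_le_minus xdegree_le_var)
  also have "(\<Sum>i = 1..n. \<Sum>j = Suc i..n. 1) = (\<Sum>i = 0..<n. n - Suc i)"
    by (rule sum.reindex_bij_witness[of _ Suc "\<lambda>i. i - 1"]) auto
  finally show ?thesis .
qed

lemma mpoly_vars_vand: "mpoly_vars (vand xvar n) \<subseteq> {1..n}"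
  unfolding vand_prod diff_conv_add_uminus
  by (intro mpoly_vars_prod order_trans[OF mpoly_vars_add] Un_least) auto

text \<open>Up to the factor n!, invertible over the rationals, p times the Vandermonde product is
  its own antisymmetrization, hence a combination of alternants; the Vandermonde product is then
  cancelled.\<close>

lemma symmetric_xpoly_expansion:
  assumes "symmetric_xpoly n p" "xdegree_le p d"
  obtains c where "p = (\<Sum>l | psize l \<le> d. xconst (c l) * double_schur_poly l n)"
proof -
  let ?I = "{l. partition_length l \<le> n \<and> psize l \<le> d}"
  let ?d = "d + (\<Sum>i = 0..<n. n - Suc i)"
  have fin: "finite ?I" using finite_psize_le[of d] by (rule rev_finite_subset) auto
  have "mpoly_vars (p * vand xvar n) \<subseteq> {1..n}"
    using assms(1) mpoly_vars_vand[of n] mpoly_vars_mult[of p "vand xvar n"]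
    unfolding symmetric_xpoly_def by blast
  then have "p * vand xvar n \<in> fprod_span n ?d"
    by (rule fprod_span_all) (intro xdegree_le_mult assms xdegree_le_vand)
  then have "antisymmetrize n (p * vand xvar n) \<in> xmod.span ((\<lambda>l. alt aconst xvar n (expo n l)) ` ?I)"
    unfolding fprod_span_def
  proof (induct rule: xmod.span_induct_alt)
    case base
    have "antisymmetrize n 0 = 0" by (simp add: antisymmetrize_def xsubst_simps)
    then show ?case using xmod.span_zero by simp
  next
    case (step c x y)
    then obtain b where b: "x = fprod n b" "(\<Sum>i = 0..<n. b i) \<le> ?d" by blast
    show ?case
      unfolding antisymmetrize_add antisymmetrize_scale b(1) antisymmetrize_fprod
      by (intro xmod.span_add xmod.span_scale alt_in_span[OF b(2)] step(2))
  qed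
  then obtain c where "antisymmetrize n (p * vand xvar n) = (\<Sum>l\<in>?I. xconst (c l) * alt aconst xvar n (expo n l))"
    using module_span_image[OF xmod.module_axioms fin] by blast
  then have "(xconst (mpoly_const (fact n)) * p) * vand xvar n
      = (\<Sum>l\<in>?I. xconst (c l) * schur_quot aconst xvar n (expo n l)) * vand xvar n"
    unfolding antisymmetrize_symmetric_mult_vand[OF assms(1)] alt_eq_schur_quot sum_distrib_right
    by (simp only: mult.assoc)
  then have *: "xconst (mpoly_const (fact n)) * p
      = (\<Sum>l\<in>?I. xconst (c l) * schur_quot aconst xvar n (expo n l))"
    by (simp only: mult_cancel_right vand_xvar_nonzero simp_thms)
  define q :: qa where "q = mpoly_const (1 / fact n)"
  have "p = xconst q * (xconst (mpoly_const (fact n)) * p)"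
    by (simp add: q_def flip: mult.assoc mpoly_const.f_mult)
  also have "\<dots> = (\<Sum>l\<in>?I. xconst (q * c l) * schur_quot aconst xvar n (expo n l))"
    unfolding * sum_distrib_left mpoly_const.f_mult by (simp only: mult.assoc)
  finally have "p = (\<Sum>l\<in>?I. xconst (q * c l) * schur_quot aconst xvar n (expo n l))" .
  \<comment> \<open>Partitions with more than n rows contribute zero; including them makes the index
    set independent of n.\<close>
  also have "\<dots> = (\<Sum>l | psize l \<le> d. xconst (q * c l) * double_schur_poly l n)"
    using finite_psize_le by (intro sum.mono_neutral_cong_left) (auto simp: double_schur_poly_eq)
  finally show ?thesis by (rule that)
qed

section \<open>The basis of double Schur functions\<close>

lemma component_Suc:
  "xsubst (xvar(Suc n := xconst (avar (int (Suc n))))) (component P (Suc n)) = component P n"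
  using component[of P] unfolding double_symmetric_def by (auto dest: spec[of _ "Suc n"])

text \<open>Each component is recovered from the next one by a substitution, so a tail of the
  sequence determines the whole.\<close>

lemma dsym_eqI:
  assumes "\<And>n. N \<le> n \<Longrightarrow> component P n = component Q n" shows "P = Q"
proof -
  have "component P n = component Q n" if "n \<le> N" for n
    using that
  proof (induct rule: inc_induct)
    case (step n)
    then show ?case by (metis component_Suc)
  qed (simp add: assms)
  with assms show ?thesis by (metis component_inject ext linear)
qed

lemma component_sum: "component (sum g A) n = (\<Sum>i\<in>A. component (g i) n)"
  by (induct A rule: infinite_finite_induct) (simp_all add: zero_dsym.rep_eq component_simps)

text \<open>Each component is expanded separately. Specializing the last variable turns an expansion
  for \<open>Suc n\<close> into one for n; from n = d on, all partitions involved have at most n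
  rows, and independence forces equal coefficients.\<close>

lemma double_schur_expansion:
  obtains d c where "P = (\<Sum>l | psize l \<le> d. dsym_scale (c l) (double_schur l))"
proof -
  have "double_symmetric (component P)" using component[of P] by simp
  then obtain d where d: "\<And>n. xdegree_le (component P n) d" and sym: "\<And>n. symmetric_xpoly n (component P n)"
    unfolding double_symmetric_def by blast
  have "\<exists>c. component P n = (\<Sum>l | psize l \<le> d. xconst (c l) * double_schur_poly l n)" for n
    using symmetric_xpoly_expansion[OF sym d] by blast
  then have "\<forall>n. \<exists>c. component P n = (\<Sum>l | psize l \<le> d. xconst (c l) * double_schur_poly l n)" ..
  from choice[OF this] obtain c where
    c: "\<And>n. component P n = (\<Sum>l | psize l \<le> d. xconst (c n l) * double_schur_poly l n)"
    by blast
  have step: "c (Suc n) l = c n l" if "d \<le> n" "psize l \<le> d" for n l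
  proof -
    have "component P n = (\<Sum>l | psize l \<le> d. xconst (c (Suc n) l) * double_schur_poly l n)"
      unfolding component_Suc[of n P, symmetric] c[of "Suc n"] xsubst_simps
      by (simp only: component_Suc flip: component_double_schur)
    then have "(\<Sum>l | psize l \<le> d. xconst (c (Suc n) l - c n l) * double_schur_poly l n) = 0"
      by (simp add: c[of n] coeff_hom_diff[OF xconst_hom] left_diff_distrib sum_subtractf)
    moreover have "partition_length l \<le> n" if "l \<in> {l. psize l \<le> d}" for l
      using that \<open>d \<le> n\<close> partition_length_le_psize[of l] by simp
    ultimately have "c (Suc n) l - c n l = 0"
      using double_schur_poly_independent[OF finite_psize_le[of d], of n "\<lambda>l. c (Suc n) l - c n l" l]
        \<open>psize l \<le> d\<close> by blast
    then show ?thesis by simp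
  qed
  have stable: "c n l = c d l" if "d \<le> n" "psize l \<le> d" for n l
    using that(1)
  proof (induct rule: dec_induct)
    case (step m)
    then show ?case using \<open>\<And>n l. d \<le> n \<Longrightarrow> psize l \<le> d \<Longrightarrow> c (Suc n) l = c n l\<close>[of m l] that(2) by simp
  qed simp
  have "P = (\<Sum>l | psize l \<le> d. dsym_scale (c d l) (double_schur l))"
  proof (rule dsym_eqI[of d])
    fix n assume "d \<le> n"
    then show "component P n = component (\<Sum>l | psize l \<le> d. dsym_scale (c d l) (double_schur l)) n"
      unfolding c[of n] component_sum component_simps component_double_schur
      by (intro sum.cong refl) (simp only: mem_Collect_eq stable[of n])
  qed
  then show ?thesis by (rule that)
qed

section \<open>Power sums generate symmetric polynomials\<close>

text \<open>Augmented monomial symmetric sums: the listed exponents are attached to pairwise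
  distinct indices from A.\<close>

fun msum :: "(nat \<Rightarrow> 'r::comm_ring_1) \<Rightarrow> nat set \<Rightarrow> nat list \<Rightarrow> 'r"
  where
    "msum y A [] = 1"
  | "msum y A (k # ks) = (\<Sum>i\<in>A. y i ^ k * msum y (A - {i}) ks)"

lemma msum_swap:
  assumes "finite A"
  shows "(\<Sum>i\<in>A. y i ^ k * msum y (A - {i}) (k' # ks)) = msum y A (k' # k # ks)"
proof -
  have "(\<Sum>i\<in>A. y i ^ k * msum y (A - {i}) (k' # ks))
      = (\<Sum>i\<in>A. \<Sum>j | j \<in> A \<and> i \<noteq> j. y i ^ k * (y j ^ k' * msum y (A - {i} - {j}) ks))"
    by (simp only: msum.simps sum_distrib_left) (intro sum.cong refl, auto)
  also have "\<dots> = (\<Sum>j\<in>A. \<Sum>i | i \<in> A \<and> i \<noteq> j. y i ^ k * (y j ^ k' * msum y (A - {i} - {j}) ks))"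
    by (rule sum.swap_restrict[OF assms assms])
  also have "\<dots> = msum y A (k' # k # ks)"
    by (simp only: msum.simps sum_distrib_left)
      (intro sum.cong refl, auto simp: mult.left_commute Diff_insert2[symmetric] insert_commute)
  finally show ?thesis .
qed

text \<open>The index of the power sum either differs from all indices already chosen or equals the
  j-th of them, and then the exponents add.\<close>

lemma power_sum_mult_msum:
  assumes "finite A"
  shows "(\<Sum>i\<in>A. y i ^ k) * msum y A ks
    = msum y A (k # ks) + (\<Sum>j<length ks. msum y A (ks[j := ks ! j + k]))"
  using assms
proof (induct ks arbitrary: A)
  case Nil
  then show ?case by simp
next
  case (Cons k' ks)
  have "(\<Sum>i\<in>A. y i ^ k) * msum y A (k' # ks)
      = (\<Sum>i\<in>A. y i ^ k' * ((\<Sum>i\<in>A. y i ^ k) * msum y (A - {i}) ks))"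
    by (simp add: sum_distrib_left mult.left_commute)
  also have "\<dots> = (\<Sum>i\<in>A. y i ^ k' * (y i ^ k * msum y (A - {i}) ks
      + (\<Sum>i\<in>A - {i}. y i ^ k) * msum y (A - {i}) ks))"
    using Cons.prems by (intro sum.cong refl) (simp add: sum.remove distrib_right)
  also have "\<dots> = msum y A ((k' + k) # ks) + (\<Sum>i\<in>A. y i ^ k' * msum y (A - {i}) (k # ks))
      + (\<Sum>i\<in>A. y i ^ k' * (\<Sum>j<length ks. msum y (A - {i}) (ks[j := ks ! j + k])))"
    using Cons.prems
    by (simp only: Cons.hyps finite_Diff)
      (simp add: distrib_left sum.distrib power_add mult.assoc)
  also have "(\<Sum>i\<in>A. y i ^ k' * (\<Sum>j<length ks. msum y (A - {i}) (ks[j := ks ! j + k])))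
      = (\<Sum>j<length ks. msum y A (k' # ks[j := ks ! j + k]))"
    unfolding sum_distrib_left by (subst sum.swap) simp
  finally show ?case
    unfolding msum_swap[OF Cons.prems]
    by (simp only: list.size(4) add_Suc_right add_0_right sum.lessThan_Suc_shift)
      (simp add: algebra_simps)
qed

lemma msum_reindex:
  assumes "inj_on t A"
  shows "msum (\<lambda>i. y (t i)) A ks = msum y (t ` A) ks"
  using assms
proof (induct ks arbitrary: A)
  case (Cons k ks)
  have "msum (\<lambda>i. y (t i)) (A - {i}) ks = msum y (t ` A - {t i}) ks" if "i \<in> A" for i
    using Cons(1)[of "A - {i}"] Cons(2) that
    by (simp add: inj_on_diff inj_on_image_set_diff[of t A A "{i}"])
  then show ?case using Cons(2) by (simp add: sum.reindex)
qed simp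

text \<open>A permutation chooses distinct images one after the other. The induction splits off the
  image b of the first element a by writing it as the transposition of a and b after a permutation
  of the rest.\<close>

lemma sum_permutes_eq_msum:
  assumes "distinct xs"
  shows "(\<Sum>\<pi> | \<pi> permutes set xs. \<Prod>i\<in>set xs. y (\<pi> i) ^ e i) = msum y (set xs) (map e xs)"
  using assms
proof (induct xs arbitrary: y)
  case Nil
  then show ?case by simp
next
  case (Cons a xs)
  let ?S = "set xs"
  have "(\<Sum>\<pi> | \<pi> permutes insert a ?S. \<Prod>i\<in>insert a ?S. y (\<pi> i) ^ e i)
      = (\<Sum>b\<in>insert a ?S. \<Sum>q | q permutes ?S.
          \<Prod>i\<in>insert a ?S. y ((Transposition.transpose a b \<circ> q) i) ^ e i)"
    using Cons.prems by (intro sum_over_permutations_insert) auto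
  also have "\<dots> = (\<Sum>b\<in>insert a ?S. y b ^ e a * msum y (insert a ?S - {b}) (map e xs))"
  proof (intro sum.cong refl)
    fix b assume b: "b \<in> insert a ?S"
    have "(\<Prod>i\<in>insert a ?S. y ((Transposition.transpose a b \<circ> q) i) ^ e i)
        = y b ^ e a * (\<Prod>i\<in>?S. y (Transposition.transpose a b (q i)) ^ e i)"
      if "q permutes ?S" for q
      using Cons.prems permutes_not_in[OF that, of a] by simp
    then have "(\<Sum>q | q permutes ?S. \<Prod>i\<in>insert a ?S. y ((Transposition.transpose a b \<circ> q) i) ^ e i)
        = y b ^ e a * (\<Sum>q | q permutes ?S. \<Prod>i\<in>?S. y (Transposition.transpose a b (q i)) ^ e i)"
      by (simp add: sum_distrib_left)
    also have "\<dots> = y b ^ e a * msum y (Transposition.transpose a b ` ?S) (map e xs)"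
      using Cons by (subst Cons.hyps) (auto simp: msum_reindex)
    also have "Transposition.transpose a b ` ?S = insert a ?S - {b}"
      using b Cons.prems by (auto simp: transpose_def image_iff split: if_splits)
    finally show "(\<Sum>q | q permutes ?S. \<Prod>i\<in>insert a ?S. y ((Transposition.transpose a b \<circ> q) i) ^ e i)
        = y b ^ e a * msum y (insert a ?S - {b}) (map e xs)" .
  qed
  finally show ?case by simp
qed

section \<open>Weighted polynomials in the power sums\<close>

text \<open>The variable with index \<open>k\<close> stands for \<open>p\<^sub>k\<^sub>+\<^sub>1\<close> and has weight \<open>k + 1\<close>.\<close>

definition wdeg :: "(nat \<Rightarrow>\<^sub>0 nat) \<Rightarrow> nat"
  where "wdeg m = (\<Sum>v\<in>Poly_Mapping.keys m. Poly_Mapping.lookup m v * Suc v)"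

definition weight_le :: "xpoly \<Rightarrow> nat \<Rightarrow> bool"
  where "weight_le F d \<longleftrightarrow> (\<forall>m\<in>Poly_Mapping.keys F. wdeg m \<le> d)"

definition psum_eval :: "nat \<Rightarrow> xpoly \<Rightarrow> xpoly"
  where "psum_eval n = xsubst (\<lambda>k. double_psum_poly (Suc k) n)"

lemma wdeg_superset:
  assumes "finite S" "Poly_Mapping.keys m \<subseteq> S"
  shows "wdeg m = (\<Sum>v\<in>S. Poly_Mapping.lookup m v * Suc v)"
  unfolding wdeg_def using assms
  by (intro sum.mono_neutral_left) (auto simp: in_keys_iff)

lemma wdeg_add: "wdeg (m + m') = wdeg m + wdeg m'"
proof -
  let ?S = "Poly_Mapping.keys m \<union> Poly_Mapping.keys m'"
  have "wdeg (m + m') = (\<Sum>v\<in>?S. Poly_Mapping.lookup (m + m') v * Suc v)"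
    by (rule wdeg_superset) (auto dest: subsetD[OF keys_add])
  then show ?thesis
    by (simp only: lookup_add distrib_right sum.distrib) (simp add: wdeg_superset[of ?S])
qed

lemma weight_le_mono: "weight_le F d \<Longrightarrow> d \<le> e \<Longrightarrow> weight_le F e"
  by (force simp: weight_le_def)

lemma weight_le_add: "weight_le F d \<Longrightarrow> weight_le G d \<Longrightarrow> weight_le (F + G) d"
  using keys_add[of F G] by (fastforce simp: weight_le_def)

lemma weight_le_uminus: "weight_le F d \<Longrightarrow> weight_le (- F) d"
  by (simp add: weight_le_def in_keys_iff)

lemma weight_le_mult: "weight_le F d \<Longrightarrow> weight_le G e \<Longrightarrow> weight_le (F * G) (d + e)"
  using subsetD[OF keys_mult[of F G]] unfolding weight_le_def
  by (fastforce simp: wdeg_add intro: add_mono)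

lemma weight_le_const: "weight_le (xconst c) d"
  by (simp add: weight_le_def mpoly_const_def wdeg_def)

lemma weight_le_var: "weight_le (xvar k) (Suc k)"
  by (simp add: weight_le_def mpoly_var_def wdeg_def)

lemma weight_le_exists: "\<exists>d. weight_le F d"
  unfolding weight_le_def using finite_keys[of F] finite_nat_set_iff_bounded_le[of "wdeg ` Poly_Mapping.keys F"]
  by auto

definition psum_range :: "nat \<Rightarrow> nat \<Rightarrow> xpoly set"
  where "psum_range n d = {psum_eval n F | F. weight_le F d}"

lemma psum_range_const: "xconst c \<in> psum_range n d"
  unfolding psum_range_def psum_eval_def
  by (auto simp: xsubst_simps weight_le_const intro!: exI[of _ "xconst c"])

lemma psum_range_add: "p \<in> psum_range n d \<Longrightarrow> q \<in> psum_range n d \<Longrightarrow> p + q \<in> psum_range n d"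
  unfolding psum_range_def psum_eval_def by (auto simp: xsubst_simps(3)[symmetric] intro: weight_le_add)

lemma psum_range_mult: "p \<in> psum_range n d \<Longrightarrow> q \<in> psum_range n e \<Longrightarrow> p * q \<in> psum_range n (d + e)"
  unfolding psum_range_def psum_eval_def by (auto simp: xsubst_simps(6)[symmetric] intro: weight_le_mult)

lemma psum_range_scale: "p \<in> psum_range n d \<Longrightarrow> xconst c * p \<in> psum_range n d"
  using psum_range_mult[OF psum_range_const[of c n 0]] by simp

lemma psum_range_diff: "p \<in> psum_range n d \<Longrightarrow> q \<in> psum_range n d \<Longrightarrow> p - q \<in> psum_range n d"
  using psum_range_add[of p n d "xconst (- 1) * q"] psum_range_scale[of q n d "- 1"]
  by (simp add: coeff_hom_uminus[OF xconst_hom])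

lemma psum_range_0: "0 \<in> psum_range n d"
  using psum_range_const[of 0] by simp

lemma psum_range_sum: "(\<And>i. i \<in> A \<Longrightarrow> g i \<in> psum_range n d) \<Longrightarrow> sum g A \<in> psum_range n d"
  by (induct A rule: infinite_finite_induct) (auto intro: psum_range_add psum_range_0)

lemma psum_range_mono: "d \<le> e \<Longrightarrow> psum_range n d \<subseteq> psum_range n e"
  unfolding psum_range_def using weight_le_mono by blast

lemma power_sum_in_psum_range: "(\<Sum>i\<in>{1..n}. xvar i ^ k) \<in> psum_range n k"
proof (cases k)
  case 0
  then show ?thesis using psum_range_const[of "of_nat n" n 0] by (simp add: of_nat_eq_xconst)
      (metis of_nat_eq_xconst mpoly_const.f_1 psum_range_const)
next
  case (Suc r)
  have "double_psum_poly k n \<in> psum_range n k"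
    unfolding psum_range_def psum_eval_def Suc
    by (auto simp: xsubst_simps weight_le_var intro!: exI[of _ "xvar r"])
  moreover have "(\<Sum>i\<in>{1..n}. xvar i ^ k)
      = double_psum_poly k n + xconst (\<Sum>i\<in>{1..n}. avar (int i) ^ k)"
    by (simp add: double_psum_poly_def sum_subtractf coeff_hom_sum[OF xconst_hom])
  ultimately show ?thesis using psum_range_add psum_range_const by simp
qed

text \<open>\<open>power_sum_mult_msum\<close>, solved for its longest sum, leaves only shorter
  exponent lists of the same total degree and a product with a power sum.\<close>

lemma msum_in_psum_range: "msum xvar {1..n} ks \<in> psum_range n (sum_list ks)"
proof (induct "length ks" arbitrary: ks)
  case 0
  then show ?case using psum_range_const[of 1 n 0] by simp
next
  case (Suc r)
  then obtain k ks' where ks: "ks = k # ks'" "length ks' = r" by (cases ks) auto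
  have "sum_list (ks'[j := ks' ! j + k]) = sum_list ks" if "j < length ks'" for j
    using that by (simp add: sum_list_update ks elem_le_sum_list)
  then have "msum xvar {1..n} (ks'[j := ks' ! j + k]) \<in> psum_range n (sum_list ks)"
    if "j < length ks'" for j
    using Suc(1)[of "ks'[j := ks' ! j + k]"] ks that by simp
  moreover have "msum xvar {1..n} ks' \<in> psum_range n (sum_list ks')"
    using Suc(1)[of ks'] ks by simp
  then have "(\<Sum>i\<in>{1..n}. xvar i ^ k) * msum xvar {1..n} ks' \<in> psum_range n (sum_list ks)"
    using psum_range_mult[OF power_sum_in_psum_range[of k n]] by (simp add: ks(1))
  ultimately have "(\<Sum>i\<in>{1..n}. xvar i ^ k) * msum xvar {1..n} ks'
      - (\<Sum>j<length ks'. msum xvar {1..n} (ks'[j := ks' ! j + k])) \<in> psum_range n (sum_list ks)"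
    by (intro psum_range_diff psum_range_sum) auto
  then show ?case
    unfolding power_sum_mult_msum[OF finite_atLeastAtMost] ks(1) by simp
qed

text \<open>Averaging over all permutations turns each monomial into an augmented monomial sum. The
  bound on the weight is what later makes the representing polynomial independent of n.\<close>

lemma symmetric_in_psum_range:
  assumes "symmetric_xpoly n p" "xdegree_le p d" shows "p \<in> psum_range n d"
proof -
  have vars: "Poly_Mapping.keys m \<subseteq> {1..n}" if "m \<in> Poly_Mapping.keys p" for m
    using assms(1) that unfolding symmetric_xpoly_def mpoly_vars_def by blast
  have "xconst (mpoly_const (fact n)) * p = (\<Sum>\<pi> | \<pi> permutes {1..n}. xsubst (\<lambda>i. xvar (\<pi> i)) p)"
  proof -
    have "(\<Sum>\<pi> | \<pi> permutes {1..n}. xsubst (\<lambda>i. xvar (\<pi> i)) p) = (\<Sum>\<pi> | \<pi> permutes {1..n}. p)"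
      using assms(1) by (intro sum.cong refl) (simp add: symmetric_xpoly_def)
    also have "\<dots> = of_nat (fact n) * p"
      by (simp add: card_permutations[of _ n])
    finally show ?thesis unfolding of_nat_eq_xconst by simp
  qed
  also have "\<dots> = (\<Sum>m\<in>Poly_Mapping.keys p. xconst (Poly_Mapping.lookup p m) *
      (\<Sum>\<pi> | \<pi> permutes {1..n}. \<Prod>i\<in>{1..n}. xvar (\<pi> i) ^ Poly_Mapping.lookup m i))"
    unfolding xsubst_def mpoly_eval_def
    by (subst sum.swap) (simp add: sum_distrib_left monom_eval_superset[OF _ vars])
  also have "\<dots> \<in> psum_range n d"
  proof (rule psum_range_sum, rule psum_range_scale)
    fix m assume m: "m \<in> Poly_Mapping.keys p"
    let ?xs = "[1..<Suc n]"
    have xs: "set ?xs = {1..n}" by auto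
    have "(\<Sum>\<pi> | \<pi> permutes {1..n}. \<Prod>i\<in>{1..n}. xvar (\<pi> i) ^ Poly_Mapping.lookup m i)
        = msum xvar {1..n} (map (Poly_Mapping.lookup m) ?xs)"
      using sum_permutes_eq_msum[of ?xs xvar "Poly_Mapping.lookup m"] unfolding xs by simp
    moreover have "sum_list (map (Poly_Mapping.lookup m) ?xs) = monom_degree m"
      using vars[OF m] by (simp only: sum_list_distinct_conv_sum_set distinct_upt xs)
        (rule monom_degree_superset[symmetric], simp)
    ultimately have "(\<Sum>\<pi> | \<pi> permutes {1..n}. \<Prod>i\<in>{1..n}. xvar (\<pi> i) ^ Poly_Mapping.lookup m i)
        \<in> psum_range n (monom_degree m)"
      using msum_in_psum_range[of n "map (Poly_Mapping.lookup m) ?xs"] by (simp only:)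
    moreover have "psum_range n (monom_degree m) \<subseteq> psum_range n d"
      using assms(2) m by (intro psum_range_mono) (simp add: xdegree_le_def)
    ultimately show "(\<Sum>\<pi> | \<pi> permutes {1..n}. \<Prod>i\<in>{1..n}. xvar (\<pi> i) ^ Poly_Mapping.lookup m i)
        \<in> psum_range n d"
      by blast
  qed
  finally have "xconst (mpoly_const (1 / fact n)) * (xconst (mpoly_const (fact n)) * p) \<in> psum_range n d"
    by (rule psum_range_scale)
  then show ?thesis by (simp flip: mult.assoc mpoly_const.f_mult)
qed

section \<open>Partial derivatives\<close>

text \<open>Substitutes x_k + t for x_k, with t the outer variable. As this is a ring homomorphism,
  the product rule for the coefficient of t follows from multiplication of polynomials.\<close>

definition xtaylor :: "nat \<Rightarrow> xpoly \<Rightarrow> xpoly poly"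
  where "xtaylor k = mpoly_eval (\<lambda>c. [:xconst c:]) (\<lambda>j. [:xvar j, if j = k then 1 else 0:])"

definition xderiv :: "nat \<Rightarrow> xpoly \<Rightarrow> xpoly"
  where "xderiv k p = coeff (xtaylor k p) 1"

lemma xtaylor_hom: "coeff_hom (xtaylor k)"
  unfolding xtaylor_def
  by (rule coeff_hom_mpoly_eval) (standard, simp_all add: mpoly_const.f_add mpoly_const.f_mult one_pCons)

lemma coeff_xtaylor_0: "coeff (xtaylor k p) 0 = p"
proof -
  have hom: "coeff_hom (\<lambda>q::xpoly poly. coeff q 0)" by standard (simp_all add: coeff_mult)
  have "coeff (xtaylor k p) 0 = mpoly_eval xconst xvar p"
    unfolding xtaylor_def by (subst hom_mpoly_eval[OF hom]) (simp add: o_def)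
  then show ?thesis by (simp add: mpoly_eval_ident)
qed

lemma xderiv_const [simp]: "xderiv k (xconst c) = 0"
proof -
  have "coeff_hom (\<lambda>c. [:xconst c:])"
    by standard (simp_all add: mpoly_const.f_add mpoly_const.f_mult one_pCons)
  then show ?thesis by (simp add: xderiv_def xtaylor_def coeff_hom.eval_const)
qed

lemma xderiv_var [simp]: "xderiv k (xvar j) = (if j = k then 1 else 0)"
proof -
  have "coeff_hom (\<lambda>c. [:xconst c:])"
    by standard (simp_all add: mpoly_const.f_add mpoly_const.f_mult one_pCons)
  then show ?thesis by (simp add: xderiv_def xtaylor_def coeff_hom.eval_var)
qed

lemma xderiv_sum: "xderiv k (sum g A) = (\<Sum>i\<in>A. xderiv k (g i))"
  by (simp add: xderiv_def coeff_hom_sum[OF xtaylor_hom] coeff_sum)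

lemma xderiv_diff: "xderiv k (p - q) = xderiv k p - xderiv k q"
  by (simp add: xderiv_def coeff_hom_diff[OF xtaylor_hom])

lemma xderiv_mult: "xderiv k (p * q) = p * xderiv k q + xderiv k p * q"
  by (simp add: xderiv_def coeff_hom.f_mult[OF xtaylor_hom] coeff_mult coeff_xtaylor_0)

lemma xderiv_1 [simp]: "xderiv k 1 = 0"
  using xderiv_const[of k 1] by (simp del: xderiv_const)

lemma xderiv_power: "xderiv k (p ^ r) = of_nat r * p ^ (r - 1) * xderiv k p"
proof (induct r)
  case (Suc r)
  then show ?case by (cases r) (simp_all add: xderiv_mult algebra_simps)
qed simp

lemma xderiv_prod:
  assumes "finite S"
  shows "xderiv k (prod g S) = (\<Sum>v\<in>S. xderiv k (g v) * prod g (S - {v}))"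
  using assms
proof induct
  case (insert a S)
  have "prod g (insert a S - {v}) = g a * prod g (S - {v})" if "v \<in> S" for v
    using insert that by (subst insert_Diff_if) auto
  with insert show ?case
    by (simp add: xderiv_mult sum_distrib_left mult.left_commute mult.commute)
qed simp

lemma xderiv_monom_eval:
  "xderiv k (monom_eval h m) = (\<Sum>v\<in>Poly_Mapping.keys m.
    of_nat (Poly_Mapping.lookup m v) * monom_eval h (m - Poly_Mapping.single v 1) * xderiv k (h v))"
  unfolding monom_eval_def[of h m] xderiv_prod[OF finite_keys]
proof (rule sum.cong[OF refl])
  fix v assume v: "v \<in> Poly_Mapping.keys m"
  let ?m = "m - Poly_Mapping.single v 1"
  have "Poly_Mapping.keys ?m \<subseteq> Poly_Mapping.keys m"
    by (auto simp: in_keys_iff lookup_minus)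
  then have "monom_eval h ?m = (\<Prod>w\<in>Poly_Mapping.keys m. h w ^ Poly_Mapping.lookup ?m w)"
    by (intro monom_eval_superset) auto
  also have "\<dots> = h v ^ (Poly_Mapping.lookup m v - 1) *
      (\<Prod>w\<in>Poly_Mapping.keys m - {v}. h w ^ Poly_Mapping.lookup m w)"
    using v by (subst prod.remove[of _ v])
      (auto simp: lookup_minus lookup_single when_def intro!: prod.cong)
  finally show "xderiv k (h v ^ Poly_Mapping.lookup m v) *
      (\<Prod>v\<in>Poly_Mapping.keys m - {v}. h v ^ Poly_Mapping.lookup m v)
    = of_nat (Poly_Mapping.lookup m v) * monom_eval h ?m * xderiv k (h v)"
    by (simp add: xderiv_power mult_ac)
qed

lemma xderiv_eq_sum:
  "xderiv k F = (\<Sum>m\<in>Poly_Mapping.keys F. Poly_Mapping.single (m - Poly_Mapping.single k 1)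
    (Poly_Mapping.lookup F m * of_nat (Poly_Mapping.lookup m k)))"
proof -
  have of_nat_single: "(of_nat r :: xpoly) = Poly_Mapping.single 0 (of_nat r)" for r
    by (induct r) (simp_all add: single_add)
  have monom: "xderiv k (monom_eval xvar m)
      = of_nat (Poly_Mapping.lookup m k) * Poly_Mapping.single (m - Poly_Mapping.single k 1) 1" for m
  proof -
    have "xderiv k (monom_eval xvar m) = (\<Sum>v\<in>Poly_Mapping.keys m. if v = k then
        of_nat (Poly_Mapping.lookup m v) * monom_eval xvar (m - Poly_Mapping.single v 1) else 0)"
      unfolding xderiv_monom_eval by (intro sum.cong) auto
    also have "\<dots> = of_nat (Poly_Mapping.lookup m k) * monom_eval xvar (m - Poly_Mapping.single k 1)"
      by (auto simp: in_keys_iff)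
    finally show ?thesis by (simp only: monom_eval_var)
  qed
  have "xderiv k F = xderiv k (\<Sum>m\<in>Poly_Mapping.keys F. xconst (Poly_Mapping.lookup F m) * monom_eval xvar m)"
    by (simp flip: mpoly_sum_monom)
  also have "\<dots> = (\<Sum>m\<in>Poly_Mapping.keys F. Poly_Mapping.single (m - Poly_Mapping.single k 1)
      (Poly_Mapping.lookup F m * of_nat (Poly_Mapping.lookup m k)))"
    unfolding xderiv_sum
  proof (rule sum.cong[OF refl])
    fix m
    have "xderiv k (xconst (Poly_Mapping.lookup F m) * monom_eval xvar m) = xconst (Poly_Mapping.lookup F m)
        * (of_nat (Poly_Mapping.lookup m k) * Poly_Mapping.single (m - Poly_Mapping.single k 1) 1)"
      by (simp only: xderiv_mult monom xderiv_const mult_zero_left add_0_right)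
    then show "xderiv k (xconst (Poly_Mapping.lookup F m) * monom_eval xvar m)
        = Poly_Mapping.single (m - Poly_Mapping.single k 1)
          (Poly_Mapping.lookup F m * of_nat (Poly_Mapping.lookup m k))"
      unfolding of_nat_single mpoly_const_def mult_single by simp
  qed
  finally show ?thesis .
qed

lemma xderiv_chain:
  assumes "finite K" "mpoly_vars F \<subseteq> K"
  shows "xderiv i (xsubst h F) = (\<Sum>v\<in>K. xsubst h (xderiv v F) * xderiv i (h v))"
proof -
  let ?t = "\<lambda>m v. xconst (Poly_Mapping.lookup F m) * of_nat (Poly_Mapping.lookup m v) *
    monom_eval h (m - Poly_Mapping.single v 1) * xderiv i (h v)"
  have "xderiv i (xsubst h F) = (\<Sum>m\<in>Poly_Mapping.keys F. \<Sum>v\<in>Poly_Mapping.keys m. ?t m v)"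
    unfolding xsubst_def mpoly_eval_def xderiv_sum
    by (intro sum.cong refl) (simp add: xderiv_mult xderiv_monom_eval sum_distrib_left mult.assoc)
  also have "\<dots> = (\<Sum>m\<in>Poly_Mapping.keys F. \<Sum>v\<in>K. ?t m v)"
  proof (rule sum.cong[OF refl], rule sum.mono_neutral_left)
    show "Poly_Mapping.keys m \<subseteq> K" if "m \<in> Poly_Mapping.keys F" for m
      using assms(2) that by (auto simp: mpoly_vars_def)
  qed (use assms(1) in \<open>auto simp: in_keys_iff\<close>)
  also have "\<dots> = (\<Sum>v\<in>K. xsubst h (xderiv v F) * xderiv i (h v))"
  proof -
    have of_nat: "xconst (of_nat r) = of_nat r" for r
      by (induct r) (simp_all add: mpoly_const.f_add)
    show ?thesis
      by (subst sum.swap) (simp add: xderiv_eq_sum xsubst_simps xsubst_def mpoly_const.eval_single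
          mpoly_const.eval_sum sum_distrib_right mpoly_const.f_mult of_nat)
  qed
  finally show ?thesis .
qed

lemma lookup_eq_minus_plus:
  "Poly_Mapping.lookup m k \<noteq> (0::nat) \<Longrightarrow> m = (m - Poly_Mapping.single k 1) + Poly_Mapping.single k 1"
  by (rule poly_mapping_eqI) (auto simp: lookup_add lookup_minus lookup_single when_def)

lemma keys_xderiv:
  assumes "m \<in> Poly_Mapping.keys (xderiv k F)"
  shows "m + Poly_Mapping.single k 1 \<in> Poly_Mapping.keys F"
proof -
  have "Poly_Mapping.lookup (xderiv k F) m \<noteq> 0" using assms by (simp add: in_keys_iff)
  then obtain m' where m': "m' \<in> Poly_Mapping.keys F"
    "Poly_Mapping.lookup (Poly_Mapping.single (m' - Poly_Mapping.single k 1)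
      (Poly_Mapping.lookup F m' * of_nat (Poly_Mapping.lookup m' k))) m \<noteq> 0"
    unfolding xderiv_eq_sum lookup_sum by (metis (no_types, lifting) sum.not_neutral_contains_not_neutral)
  then have "m = m' - Poly_Mapping.single k 1" "Poly_Mapping.lookup m' k \<noteq> 0"
    by (auto simp: lookup_single when_def split: if_splits)
  then show ?thesis using m'(1) lookup_eq_minus_plus by metis
qed

text \<open>In characteristic zero a monomial m containing variable k leaves a nonzero coefficient
  at \<open>m - Poly_Mapping.single k 1\<close>, and no other monomial of F contributes
  there.\<close>

lemma xderiv_eq_0_imp_const:
  assumes "\<And>k. xderiv k F = 0" shows "F = xconst (Poly_Mapping.lookup F 0)"
proof -
  have "m = 0" if m: "m \<in> Poly_Mapping.keys F" for m
  proof (rule ccontr)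
    assume "m \<noteq> 0"
    then obtain k where k: "Poly_Mapping.lookup m k \<noteq> 0" by (metis poly_mapping_eqI lookup_zero)
    let ?e = "Poly_Mapping.single k (1::nat)"
    let ?c = "\<lambda>m. Poly_Mapping.lookup F m * of_nat (Poly_Mapping.lookup m k)"
    have "0 = Poly_Mapping.lookup (xderiv k F) (m - ?e)" by (simp add: assms)
    also have "\<dots> = (\<Sum>m'\<in>Poly_Mapping.keys F. ?c m' when m' - ?e = m - ?e)"
      by (simp add: xderiv_eq_sum lookup_sum lookup_single)
    also have "\<dots> = (\<Sum>m'\<in>Poly_Mapping.keys F. if m' = m then ?c m else 0)"
    proof (intro sum.cong refl)
      fix m'
      show "(?c m' when m' - ?e = m - ?e) = (if m' = m then ?c m else 0)"
        using lookup_eq_minus_plus[of m k] lookup_eq_minus_plus[of m' k] k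
        by (cases "Poly_Mapping.lookup m' k = 0") (auto simp: when_def)
    qed
    also have "\<dots> = ?c m" using m by simp
    finally show False using m k by (simp add: in_keys_iff)
  qed
  then show ?thesis
    by (intro poly_mapping_eqI) (metis in_keys_iff lookup_single_eq lookup_single_not_eq mpoly_const_def)
qed

section \<open>Algebraic independence of the power sums\<close>

lemma xderiv_double_psum_poly:
  assumes "i \<in> {1..n}"
  shows "xderiv i (double_psum_poly (Suc k) n) = of_nat (Suc k) * xvar i ^ k"
proof -
  have "xderiv i (double_psum_poly (Suc k) n)
      = (\<Sum>j\<in>{1..n}. if j = i then of_nat (Suc k) * xvar i ^ k else 0)"
    unfolding double_psum_poly_def xderiv_sum
    by (intro sum.cong refl) (simp add: xderiv_diff xderiv_power del: power_Suc of_nat_Suc)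
  then show ?thesis using assms by (simp del: of_nat_Suc)
qed

text \<open>Differentiating the relation by x_i makes each x_i a root of one polynomial of degree
  below d, whose coefficients are (v + 1) F_v(p) with F_v the partial derivatives of F. It has n
  \<ge> d distinct roots, hence is zero. The F_v have smaller weight, so they vanish by induction
  and F is constant.\<close>

lemma psum_eval_inject_0:
  assumes "weight_le F d" "d \<le> n" "psum_eval n F = 0" shows "F = 0"
  using assms
proof (induct d arbitrary: F rule: less_induct)
  case (less d)
  have vars: "v < d" if "m \<in> Poly_Mapping.keys F" "v \<in> Poly_Mapping.keys m" for m v
  proof -
    have "Poly_Mapping.lookup m v * Suc v \<le> wdeg m"
      unfolding wdeg_def using that(2) by (intro member_le_sum) auto
    moreover have "1 * Suc v \<le> Poly_Mapping.lookup m v * Suc v"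
      using that(2) by (intro mult_le_mono1) (simp add: in_keys_iff Suc_le_eq)
    ultimately show ?thesis using less.prems(1) that(1) by (fastforce simp: weight_le_def)
  qed
  let ?u = "\<Sum>v<d. monom (of_nat (Suc v) * psum_eval n (xderiv v F)) v"
  have root: "poly ?u (xvar i) = 0" if i: "i \<in> {1..n}" for i
  proof -
    have "0 = xderiv i (psum_eval n F)"
      using less.prems(3) xderiv_const[of i 0] by simp
    also have "\<dots> = (\<Sum>v<d. psum_eval n (xderiv v F) * (of_nat (Suc v) * xvar i ^ v))"
      unfolding psum_eval_def using vars
      by (subst xderiv_chain[of "{..<d}"]) (auto simp: mpoly_vars_def xderiv_double_psum_poly[OF i])
    also have "\<dots> = poly ?u (xvar i)"
      by (simp add: poly_sum poly_monom mult_ac)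
    finally show ?thesis ..
  qed
  have "?u = 0"
  proof (rule ccontr)
    assume "?u \<noteq> 0"
    have "n = card (xvar ` {1..n})"
      by (subst card_image) (auto simp: inj_on_def xvar_inj)
    also have "\<dots> \<le> card {x. poly ?u x = 0}"
      using root poly_roots_finite[OF \<open>?u \<noteq> 0\<close>] by (intro card_mono) auto
    also have "\<dots> \<le> degree ?u" by (rule card_poly_roots_bound[OF \<open>?u \<noteq> 0\<close>])
    finally have "n \<le> degree ?u" .
    moreover have "d \<noteq> 0" using \<open>?u \<noteq> 0\<close> by (intro notI) simp
    then have "degree ?u < d"
      by (intro degree_lessI) (auto simp: coeff_sum)
    ultimately show False using less.prems(2) by simp
  qed
  have "xderiv v F = 0" for v
  proof (cases "v < d")
    case True
    have "coeff ?u v = of_nat (Suc v) * psum_eval n (xderiv v F)"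
      using True by (simp add: coeff_sum del: of_nat_Suc)
    then have "psum_eval n (xderiv v F) = 0"
      using \<open>?u = 0\<close> by (simp del: of_nat_Suc)
    moreover have "weight_le (xderiv v F) (d - Suc v)"
      unfolding weight_le_def
    proof
      fix m assume "m \<in> Poly_Mapping.keys (xderiv v F)"
      then have "wdeg (m + Poly_Mapping.single v 1) \<le> d"
        using keys_xderiv less.prems(1) unfolding weight_le_def by blast
      then show "wdeg m \<le> d - Suc v" by (simp add: wdeg_add) (simp add: wdeg_def)
    qed
    ultimately show ?thesis using less.hyps[of "d - Suc v" "xderiv v F"] True less.prems(2) by simp
  next
    case False
    have "m \<notin> Poly_Mapping.keys (xderiv v F)" for m
      using keys_xderiv[of m v F] vars[of "m + Poly_Mapping.single v 1" v] False
      by (auto simp: in_keys_iff lookup_add)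
    then show ?thesis by (metis keys_eq_empty ex_in_conv)
  qed
  then have F: "F = xconst (Poly_Mapping.lookup F 0)" by (rule xderiv_eq_0_imp_const)
  have "psum_eval n F = F"
    by (subst F, subst (2) F) (simp add: psum_eval_def xsubst_simps)
  with less.prems(3) show ?case by simp
qed

section \<open>Existence and uniqueness of the comultiplication\<close>

text \<open>The polynomial type is reused as the free polynomial ring on the power sums. The map
  turns out to be bijective, which gives a model where homomorphisms can be prescribed on
  generators.\<close>

definition psum_poly :: "xpoly \<Rightarrow> dsym"
  where "psum_poly = mpoly_eval (\<lambda>c. dsym_scale c 1) (\<lambda>k. double_psum (Suc k))"

lemma dsym_const_hom: "coeff_hom (\<lambda>c. dsym_scale c 1)"
  by standard (simp_all add: dsym.scale_left_distrib dsym_scale_mult mult.commute)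

lemma component_hom: "coeff_hom (\<lambda>P. component P n)"
  by standard (simp_all add: zero_dsym.rep_eq one_dsym.rep_eq plus_dsym.rep_eq times_dsym.rep_eq)

lemma psum_poly_hom: "coeff_hom psum_poly"
  unfolding psum_poly_def by (rule coeff_hom_mpoly_eval[OF dsym_const_hom])

lemma psum_poly_const: "psum_poly (xconst c) = dsym_scale c 1"
  by (simp add: psum_poly_def coeff_hom.eval_const[OF dsym_const_hom])

lemma psum_poly_var: "psum_poly (xvar k) = double_psum (Suc k)"
  by (simp add: psum_poly_def coeff_hom.eval_var[OF dsym_const_hom])

lemma component_psum_poly: "component (psum_poly F) n = psum_eval n F"
  unfolding psum_poly_def psum_eval_def xsubst_def
  by (subst hom_mpoly_eval[OF component_hom])
    (simp add: o_def component_simps double_psum.rep_eq)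

lemma inj_psum_poly: "inj psum_poly"
proof (rule injI)
  fix F G assume eq: "psum_poly F = psum_poly G"
  obtain d where "weight_le (F - G) d" using weight_le_exists by blast
  moreover have "psum_eval d (F - G) = 0"
    using eq by (simp add: coeff_hom_diff[OF psum_poly_hom] zero_dsym.rep_eq flip: component_psum_poly)
  ultimately have "F - G = 0" using psum_eval_inject_0 by blast
  then show "F = G" by simp
qed

text \<open>For each n there is a representing polynomial of weight at most d, and algebraic
  independence makes these agree from n = d on.\<close>

lemma surj_psum_poly: "\<exists>F. P = psum_poly F"
proof -
  have "double_symmetric (component P)" using component[of P] by simp
  then obtain d where d: "\<And>n. xdegree_le (component P n) d" and sym: "\<And>n. symmetric_xpoly n (component P n)"
    unfolding double_symmetric_def by blast
  have "\<exists>F. component P n = psum_eval n F \<and> weight_le F d" for n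
    using symmetric_in_psum_range[OF sym d] unfolding psum_range_def by blast
  then have "\<forall>n. \<exists>F. component P n = psum_eval n F \<and> weight_le F d" ..
  from choice[OF this] obtain F where
    F: "\<And>n. component P n = psum_eval n (F n)" and wt: "\<And>n. weight_le (F n) d"
    by blast
  have step: "F (Suc n) = F n" if "d \<le> n" for n
  proof -
    have "psum_eval n (F (Suc n)) = psum_eval n (F n)"
      using component_Suc[of n "psum_poly (F (Suc n))"]
      unfolding component_psum_poly F[symmetric] component_Suc by simp
    then have 0: "psum_eval n (F (Suc n) - F n) = 0"
      by (simp add: psum_eval_def xsubst_simps)
    have "weight_le (F (Suc n) - F n) d"
      using weight_le_add[OF wt weight_le_uminus[OF wt], of "Suc n" n] by simp
    from psum_eval_inject_0[OF this that 0] show ?thesis by simp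
  qed
  have stable: "F n = F d" if "d \<le> n" for n
    using that
  proof (induct rule: dec_induct)
    case (step m)
    then show ?case using \<open>\<And>n. d \<le> n \<Longrightarrow> F (Suc n) = F n\<close>[of m] by simp
  qed simp
  have "P = psum_poly (F d)"
  proof (rule dsym_eqI[of d])
    fix n assume "d \<le> n"
    then show "component P n = component (psum_poly (F d)) n"
      unfolding component_psum_poly F[of n] by (simp only: stable[of n])
  qed
  then show ?thesis ..
qed

lemma tensor_scale_mult: "tensor_scale c u * v = tensor_scale c (u * v)" "u * tensor_scale c v = tensor_scale c (u * v)"
  by (transfer; simp add: free_scale_mult tensor_rel_refl)+

lemma tensor_const_hom: "coeff_hom (\<lambda>c. tensor_scale c 1)"
  by standard (simp_all add: tensor2.scale_left_distrib tensor_scale_mult mult.commute)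

definition tensor_psum_poly :: "xpoly \<Rightarrow> tensor2"
  where "tensor_psum_poly = mpoly_eval (\<lambda>c. tensor_scale c 1)
    (\<lambda>k. tensor (double_psum (Suc k)) 1 + tensor 1 (double_psum (Suc k)))"

lemma tensor_psum_poly_hom: "coeff_hom tensor_psum_poly"
  unfolding tensor_psum_poly_def by (rule coeff_hom_mpoly_eval[OF tensor_const_hom])

lemma is_coproduct_psum_poly:
  assumes "is_coproduct D" shows "D (psum_poly F) = tensor_psum_poly F"
proof -
  interpret D: Modules.module_hom dsym_scale tensor_scale D
    using assms by (simp add: is_coproduct_def)
  have "coeff_hom D"
    by standard (use assms in \<open>simp_all add: is_coproduct_def D.add D.zero\<close>)
  moreover have "D (dsym_scale c 1) = tensor_scale c 1" for c
    using assms by (simp add: D.scale is_coproduct_def)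
  ultimately show ?thesis
    using assms unfolding psum_poly_def tensor_psum_poly_def
    by (subst hom_mpoly_eval) (simp_all add: o_def is_coproduct_def)
qed

lemma is_coproduct_ex: "is_coproduct (\<lambda>P. tensor_psum_poly (inv_into UNIV psum_poly P))"
proof -
  have inv: "inv_into UNIV psum_poly (psum_poly F) = F" for F
    by (rule inv_f_f[OF inj_psum_poly])
  have psum: "psum_poly (inv_into UNIV psum_poly P) = P" for P
    using surj_psum_poly[of P] inv by auto
  note hom = psum_poly_hom[THEN coeff_hom.f_add] psum_poly_hom[THEN coeff_hom.f_mult]
  have inv_add: "inv_into UNIV psum_poly (P + Q) = inv_into UNIV psum_poly P + inv_into UNIV psum_poly Q" for P Q
    by (rule inv_f_eq[OF inj_psum_poly]) (simp add: hom psum)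
  have inv_mult: "inv_into UNIV psum_poly (P * Q) = inv_into UNIV psum_poly P * inv_into UNIV psum_poly Q" for P Q
    by (rule inv_f_eq[OF inj_psum_poly]) (simp add: hom psum)
  have inv_scale: "inv_into UNIV psum_poly (dsym_scale c P) = xconst c * inv_into UNIV psum_poly P" for c P
    by (rule inv_f_eq[OF inj_psum_poly]) (simp add: hom psum psum_poly_const dsym_scale_mult)
  have inv_1: "inv_into UNIV psum_poly 1 = 1"
    by (rule inv_f_eq[OF inj_psum_poly]) (simp add: coeff_hom.f_1[OF psum_poly_hom])
  have inv_var: "inv_into UNIV psum_poly (double_psum (Suc k)) = xvar k" for k
    by (rule inv_f_eq[OF inj_psum_poly]) (rule psum_poly_var)
  have const: "tensor_psum_poly (xconst c) = tensor_scale c 1" for c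
    by (simp add: tensor_psum_poly_def coeff_hom.eval_const[OF tensor_const_hom])
  have var: "tensor_psum_poly (xvar k)
      = tensor (double_psum (Suc k)) 1 + tensor 1 (double_psum (Suc k))" for k
    by (simp add: tensor_psum_poly_def coeff_hom.eval_var[OF tensor_const_hom])
  show ?thesis
    unfolding is_coproduct_def
  proof (intro conjI allI impI)
    show "Modules.module_hom dsym_scale tensor_scale (\<lambda>P. tensor_psum_poly (inv_into UNIV psum_poly P))"
      by (intro Modules.module_hom.intro dsym.module_axioms tensor2.module_axioms
          Modules.module_hom_axioms.intro)
        (simp_all add: inv_add inv_scale const tensor_scale_mult
          coeff_hom.f_add[OF tensor_psum_poly_hom] coeff_hom.f_mult[OF tensor_psum_poly_hom])
    fix k :: nat assume "1 \<le> k"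
    then show "tensor_psum_poly (inv_into UNIV psum_poly (double_psum k))
        = tensor (double_psum k) 1 + tensor 1 (double_psum k)"
      by (cases k) (auto simp: inv_var var)
  qed (simp_all add: inv_mult inv_1 coeff_hom.f_1[OF tensor_psum_poly_hom]
      coeff_hom.f_mult[OF tensor_psum_poly_hom])
qed

text \<open>The defining properties fix the map on the free model, and the inverse of
  \<open>psum_poly\<close> shows that such a map exists; so the description is met exactly
  once.\<close>

lemma coproduct_psum_poly: "coproduct (psum_poly F) = tensor_psum_poly F"
proof -
  have "D = (\<lambda>P. tensor_psum_poly (inv_into UNIV psum_poly P))" if "is_coproduct D" for D
  proof
    fix P
    obtain F where "P = psum_poly F" using surj_psum_poly by blast
    then show "D P = tensor_psum_poly (inv_into UNIV psum_poly P)"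
      using is_coproduct_psum_poly that is_coproduct_ex by metis
  qed
  then have "is_coproduct coproduct"
    unfolding coproduct_def by (rule theI[of is_coproduct, OF is_coproduct_ex])
  then show ?thesis by (rule is_coproduct_psum_poly)
qed

section \<open>Evaluation of tensors\<close>

definition dsym_point :: "(dsym \<Rightarrow> qa) \<Rightarrow> bool"
  where "dsym_point f \<longleftrightarrow> coeff_hom f \<and> (\<forall>c P. f (dsym_scale c P) = c * f P)"

lemma dsym_point_add: "dsym_point f \<Longrightarrow> f (P + Q) = f P + f Q"
  by (simp add: dsym_point_def coeff_hom.f_add[of f])

lemma dsym_point_mult: "dsym_point f \<Longrightarrow> f (P * Q) = f P * f Q"
  by (simp add: dsym_point_def coeff_hom.f_mult[of f])

lemma dsym_point_1: "dsym_point f \<Longrightarrow> f 1 = 1"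
  by (simp add: dsym_point_def coeff_hom.f_1[of f])

lemma dsym_point_scale: "dsym_point f \<Longrightarrow> f (dsym_scale c P) = c * f P"
  by (simp add: dsym_point_def)

definition pair_value :: "(dsym \<Rightarrow> qa) \<Rightarrow> (dsym \<Rightarrow> qa) \<Rightarrow> dsym_pair \<Rightarrow> qa"
  where "pair_value f g k = (case k of DPair P Q \<Rightarrow> f P * g Q)"

definition free_eval :: "(dsym \<Rightarrow> qa) \<Rightarrow> (dsym \<Rightarrow> qa) \<Rightarrow> free_pairs \<Rightarrow> qa"
  where "free_eval f g u = (\<Sum>k\<in>Poly_Mapping.keys u. Poly_Mapping.lookup u k * pair_value f g k)"

definition tensor_eval :: "(dsym \<Rightarrow> qa) \<Rightarrow> (dsym \<Rightarrow> qa) \<Rightarrow> tensor2 \<Rightarrow> qa"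
  where "tensor_eval f g t = free_eval f g (rep_tensor2 t)"

lemma free_eval_superset:
  assumes "finite S" "Poly_Mapping.keys u \<subseteq> S"
  shows "free_eval f g u = (\<Sum>k\<in>S. Poly_Mapping.lookup u k * pair_value f g k)"
  unfolding free_eval_def using assms
  by (intro sum.mono_neutral_left) (auto simp: in_keys_iff)

lemma free_eval_add: "free_eval f g (u + v) = free_eval f g u + free_eval f g v"
proof -
  let ?S = "Poly_Mapping.keys u \<union> Poly_Mapping.keys v"
  have "free_eval f g (u + v) = (\<Sum>k\<in>?S. Poly_Mapping.lookup (u + v) k * pair_value f g k)"
    by (rule free_eval_superset) (auto dest: subsetD[OF keys_add])
  then show ?thesis
    by (simp add: free_eval_superset[of ?S] lookup_add distrib_right sum.distrib)
qed

lemma free_eval_single: "free_eval f g (Poly_Mapping.single k c) = c * pair_value f g k"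
  by (cases "c = 0") (simp_all add: free_eval_def)

lemma free_eval_sum: "free_eval f g (sum h A) = (\<Sum>i\<in>A. free_eval f g (h i))"
  by (induct A rule: infinite_finite_induct) (simp_all add: free_eval_add, simp_all add: free_eval_def)

lemma pair_value_add:
  assumes "dsym_point f" "dsym_point g"
  shows "pair_value f g (k + k') = pair_value f g k * pair_value f g k'"
  by (cases k; cases k')
    (simp only: pair_value_def plus_dsym_pair.simps dsym_pair.case assms[THEN dsym_point_mult] mult_ac)

lemma free_eval_mult:
  assumes "dsym_point f" "dsym_point g"
  shows "free_eval f g (u * v) = free_eval f g u * free_eval f g v"
proof -
  let ?s = "\<lambda>u k. Poly_Mapping.single k (Poly_Mapping.lookup u k)"
  have "free_eval f g (u * v)
      = free_eval f g ((\<Sum>k\<in>Poly_Mapping.keys u. ?s u k) * (\<Sum>l\<in>Poly_Mapping.keys v. ?s v l))"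
    using poly_mapping_sum_single[of u] poly_mapping_sum_single[of v] by simp
  also have "\<dots> = (\<Sum>k\<in>Poly_Mapping.keys u. \<Sum>l\<in>Poly_Mapping.keys v.
      (Poly_Mapping.lookup u k * pair_value f g k) * (Poly_Mapping.lookup v l * pair_value f g l))"
    by (simp only: sum_product free_eval_sum mult_single free_eval_single pair_value_add[OF assms] mult_ac)
  also have "\<dots> = free_eval f g u * free_eval f g v"
    unfolding free_eval_def by (simp add: sum_product)
  finally show ?thesis .
qed

lemma free_eval_scale: "free_eval f g (free_scale c u) = c * free_eval f g u"
proof -
  have "free_eval f g (free_scale c u)
      = (\<Sum>k\<in>Poly_Mapping.keys u. Poly_Mapping.lookup (free_scale c u) k * pair_value f g k)"
    by (rule free_eval_superset) (auto simp: in_keys_iff lookup_free_scale)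
  then show ?thesis
    by (simp only: free_eval_def lookup_free_scale sum_distrib_left mult.assoc)
qed

lemma free_eval_gen: "free_eval f g (free_gen P Q) = f P * g Q"
  by (simp add: free_gen_def free_eval_single pair_value_def)

lemma free_eval_diff: "free_eval f g (u - v) = free_eval f g u - free_eval f g v"
  using free_eval_add[of f g "u - v" v] by simp

lemma free_eval_relator:
  assumes "dsym_point f" "dsym_point g" "r \<in> bilinear_relators"
  shows "free_eval f g r = 0"
  using assms(3)
  by cases (simp_all add: free_eval_diff free_eval_scale free_eval_gen
      assms(1,2)[THEN dsym_point_add] assms(1,2)[THEN dsym_point_scale] distrib_left distrib_right)

lemma free_eval_null:
  assumes "dsym_point f" "dsym_point g" "u \<in> tensor_null" shows "free_eval f g u = 0"
  using assms(3) unfolding tensor_null_def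
proof (induct rule: free_pairs.span_induct_alt)
  case base
  then show ?case by (simp add: free_eval_def)
next
  case (step c x y)
  then show ?case by (simp add: free_eval_add free_eval_scale free_eval_relator[OF assms(1,2)])
qed

text \<open>\<open>tensor_eval\<close> uses an arbitrary representative; the choice is immaterial
  because multiplicative linear functionals kill all bilinearity relations.\<close>

lemma tensor_eval_abs:
  assumes "dsym_point f" "dsym_point g"
  shows "tensor_eval f g (abs_tensor2 u) = free_eval f g u"
proof -
  have "tensor_rel (rep_tensor2 (abs_tensor2 u)) u"
    by (rule Quotient_rep_abs[OF Quotient_tensor2]) (rule tensor_rel_refl)
  then have "free_eval f g (rep_tensor2 (abs_tensor2 u) - u) = 0"
    unfolding tensor_rel_def by (rule free_eval_null[OF assms])
  then show ?thesis by (simp add: tensor_eval_def free_eval_diff)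
qed

lemma abs_tensor2_cases: obtains u where "t = abs_tensor2 u"
  using Quotient_abs_rep[OF Quotient_tensor2, of t] by metis

lemma tensor_eval_simps:
  assumes "dsym_point f" "dsym_point g"
  shows "tensor_eval f g (s + t) = tensor_eval f g s + tensor_eval f g t"
    "tensor_eval f g (s * t) = tensor_eval f g s * tensor_eval f g t"
    "tensor_eval f g (tensor_scale c t) = c * tensor_eval f g t"
    "tensor_eval f g (tensor P Q) = f P * g Q"
    "tensor_eval f g 0 = 0" "tensor_eval f g 1 = 1"
proof -
  obtain u v where [simp]: "s = abs_tensor2 u" "t = abs_tensor2 v" by (metis abs_tensor2_cases)
  note [simp] = tensor_eval_abs[OF assms]
  show "tensor_eval f g (s + t) = tensor_eval f g s + tensor_eval f g t"
    by (simp add: plus_tensor2.abs_eq free_eval_add)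
  show "tensor_eval f g (s * t) = tensor_eval f g s * tensor_eval f g t"
    by (simp add: times_tensor2.abs_eq free_eval_mult[OF assms])
  show "tensor_eval f g (tensor_scale c t) = c * tensor_eval f g t"
    by (simp add: tensor_scale.abs_eq free_eval_scale)
  show "tensor_eval f g (tensor P Q) = f P * g Q"
    by (simp add: tensor.abs_eq free_eval_gen)
  show "tensor_eval f g 0 = 0"
    by (simp add: zero_tensor2.abs_eq free_eval_def)
  have "(1 :: free_pairs) = free_gen 1 1"
    unfolding free_gen_def zero_dsym_pair_def[symmetric] by (rule single_one[symmetric])
  then have "free_eval f g 1 = 1"
    by (metis free_eval_gen assms[THEN dsym_point_1] mult_1)
  then show "tensor_eval f g 1 = 1"
    by (simp add: one_tensor2.abs_eq)
qed

lemma tensor_eval_sum: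
  assumes "dsym_point f" "dsym_point g"
  shows "tensor_eval f g (sum h A) = (\<Sum>i\<in>A. tensor_eval f g (h i))"
  by (induct A rule: infinite_finite_induct) (simp_all add: tensor_eval_simps[OF assms])

lemma tensor_bilinear:
  "tensor (P + P') Q = tensor P Q + tensor P' Q" "tensor P (Q + Q') = tensor P Q + tensor P Q'"
  "tensor (dsym_scale c P) Q = tensor_scale c (tensor P Q)"
  "tensor P (dsym_scale c Q) = tensor_scale c (tensor P Q)"
  by (transfer, simp only: tensor_rel_def tensor_null_def diff_diff_eq[symmetric],
      rule free_pairs.span_base, rule bilinear_relators.intros)+

lemma tensor_0_left: "tensor 0 Q = 0"
  using tensor_bilinear(1)[of 0 0 Q] by simp

lemma tensor_0_right: "tensor P 0 = 0"
  using tensor_bilinear(2)[of P 0 0] by simp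

lemma tensor_sum_left: "tensor (sum h A) Q = (\<Sum>i\<in>A. tensor (h i) Q)"
  by (induct A rule: infinite_finite_induct) (simp_all add: tensor_bilinear tensor_0_left)

lemma tensor_sum_right: "tensor P (sum h A) = (\<Sum>i\<in>A. tensor P (h i))"
  by (induct A rule: infinite_finite_induct) (simp_all add: tensor_bilinear tensor_0_right)

section \<open>Expansion of tensors in double Schur functions\<close>

definition schur_tensor :: "(partition \<times> partition \<Rightarrow>\<^sub>0 qa) \<Rightarrow> tensor2"
  where "schur_tensor c = (\<Sum>(l, m)\<in>Poly_Mapping.keys c.
      tensor_scale (Poly_Mapping.lookup c (l, m)) (tensor (double_schur l) (double_schur m)))"

lemma schur_tensor_superset:
  assumes "finite S" "Poly_Mapping.keys c \<subseteq> S"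
  shows "schur_tensor c = (\<Sum>(l, m)\<in>S.
    tensor_scale (Poly_Mapping.lookup c (l, m)) (tensor (double_schur l) (double_schur m)))"
  unfolding schur_tensor_def using assms
  by (intro sum.mono_neutral_left) (auto simp: in_keys_iff)

lemma schur_tensor_add: "schur_tensor (c + d) = schur_tensor c + schur_tensor d"
proof -
  let ?S = "Poly_Mapping.keys c \<union> Poly_Mapping.keys d"
  have "schur_tensor (c + d) = (\<Sum>(l, m)\<in>?S.
      tensor_scale (Poly_Mapping.lookup (c + d) (l, m)) (tensor (double_schur l) (double_schur m)))"
    by (rule schur_tensor_superset) (auto dest: subsetD[OF keys_add])
  then show ?thesis
    by (simp add: schur_tensor_superset[of ?S] lookup_add tensor2.scale_left_distrib split_def sum.distrib)
qed

lemma schur_tensor_single: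
  "schur_tensor (Poly_Mapping.single (l, m) a) = tensor_scale a (tensor (double_schur l) (double_schur m))"
  by (cases "a = 0") (simp_all add: schur_tensor_def)

lemma schur_tensor_exists: "\<exists>c. t = schur_tensor c"
proof -
  let ?S = "range (\<lambda>(l, m). tensor (double_schur l) (double_schur m))"
  have gen: "tensor P Q \<in> tensor2.span ?S" for P Q
  proof -
    obtain d c where P: "P = (\<Sum>l | psize l \<le> d. dsym_scale (c l) (double_schur l))"
      using double_schur_expansion by blast
    obtain e b where Q: "Q = (\<Sum>l | psize l \<le> e. dsym_scale (b l) (double_schur l))"
      using double_schur_expansion by blast
    show ?thesis
      unfolding P Q tensor_sum_left tensor_sum_right tensor_bilinear
      by (intro tensor2.span_sum tensor2.span_scale tensor2.span_base) auto
  qed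
  obtain u where u: "t = abs_tensor2 u" by (rule abs_tensor2_cases)
  have "abs_tensor2 (\<Sum>k\<in>A. Poly_Mapping.single k (Poly_Mapping.lookup u k)) \<in> tensor2.span ?S"
    if "finite A" for A
    using that
  proof induct
    case empty
    then show ?case using tensor2.span_zero by (simp add: zero_tensor2.abs_eq)
  next
    case (insert k A)
    obtain P Q where k: "k = DPair P Q" by (cases k)
    have "Poly_Mapping.single k (Poly_Mapping.lookup u k) = free_scale (Poly_Mapping.lookup u k) (free_gen P Q)"
      by (simp add: k free_scale_def free_gen_def mult_single)
    then have "abs_tensor2 (Poly_Mapping.single k (Poly_Mapping.lookup u k))
        = tensor_scale (Poly_Mapping.lookup u k) (tensor P Q)"
      by (simp add: tensor_scale.abs_eq tensor.abs_eq)
    then show ?case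
      using insert gen by (simp add: tensor2.span_add tensor2.span_scale flip: plus_tensor2.abs_eq)
  qed
  from this[OF finite_keys[of u]] have "t \<in> tensor2.span ?S"
    unfolding u poly_mapping_sum_single[of u, symmetric] .
  then show ?thesis
  proof (induct rule: tensor2.span_induct_alt)
    case base
    show ?case by (rule exI[of _ 0]) (simp add: schur_tensor_def)
  next
    case (step a x y)
    then obtain c l m where "y = schur_tensor c" "x = tensor (double_schur l) (double_schur m)" by auto
    then have "tensor_scale a x + y = schur_tensor (Poly_Mapping.single (l, m) a + c)"
      by (simp add: schur_tensor_add schur_tensor_single)
    then show ?case by blast
  qed
qed

section \<open>Evaluation of double symmetric functions at partitions\<close>

definition dsym_eval :: "partition \<Rightarrow> dsym \<Rightarrow> qa"
  where "dsym_eval m P = xeval (apoint m) (component P (partition_length m))"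

lemma xeval_xsubst: "xeval y (xsubst h p) = xeval (\<lambda>i. xeval y (h i)) p"
proof -
  have "xeval y \<circ> xconst = id" by (simp add: fun_eq_iff)
  then show ?thesis
    unfolding xsubst_def hom_mpoly_eval[OF xeval_hom] by (simp add: xeval_def o_def)
qed

text \<open>Beyond the length of m the i-th coordinate is a_i, exactly the value substituted in the
  compatibility condition, so extra variables do not change the result.\<close>

lemma dsym_eval_eq:
  assumes "partition_length m \<le> n"
  shows "dsym_eval m P = xeval (apoint m) (component P n)"
  using assms
proof (induct rule: dec_induct)
  case base
  then show ?case by (simp add: dsym_eval_def)
next
  case (step n)
  have "apoint m (Suc n) = avar (int (Suc n))"
    using step(1) part_eq_0_iff[of m n] by (simp add: apoint_def)
  then have "(\<lambda>i. xeval (apoint m) ((xvar(Suc n := xconst (avar (int (Suc n))))) i)) = apoint m"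
    by (auto simp: fun_eq_iff)
  then have "xeval (apoint m) (component P n) = xeval (apoint m) (component P (Suc n))"
    unfolding component_Suc[of n P, symmetric] xeval_xsubst by (simp only:)
  with step show ?case by simp
qed

lemma dsym_eval_point: "dsym_point (dsym_eval m)"
  unfolding dsym_point_def
proof
  show "coeff_hom (dsym_eval m)"
    using coeff_hom_comp[OF component_hom xeval_hom] by (simp add: o_def dsym_eval_def[abs_def])
  show "\<forall>c P. dsym_eval m (dsym_scale c P) = c * dsym_eval m P"
    by (simp add: dsym_eval_def component_simps coeff_hom.f_mult[OF xeval_hom])
qed

lemma dsym_eval_hom: "coeff_hom (dsym_eval m)"
  using dsym_eval_point by (simp add: dsym_point_def)

lemma dsym_eval_double_schur:
  assumes "partition_length m \<le> n" "partition_length l \<le> n"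
  shows "dsym_eval m (double_schur l) = schur_quot avar (apoint m) n (expo n l)"
  using assms by (simp add: dsym_eval_eq[of m n] component_double_schur double_schur_poly_eq xeval_schur_quot)

lemma dsym_eval_double_schur_eq_0:
  "\<not> contained l m \<Longrightarrow> dsym_eval m (double_schur l) = 0"
  using dsym_eval_double_schur[of m "max (partition_length m) (partition_length l)" l]
  by (simp add: schur_quot_apoint_eq_0)

lemma dsym_eval_double_schur_diag: "dsym_eval m (double_schur m) \<noteq> 0"
  using dsym_eval_double_schur[of m "partition_length m" m] by (simp add: schur_quot_apoint_diag)

lemma dsym_eval_double_schur_empty: "dsym_eval m (double_schur empty_partition) = 1"
  using dsym_eval_double_schur[of m "partition_length m" empty_partition] by simp

lemma dsym_eval_double_schur_tri:
  "psize m \<le> psize l \<Longrightarrow> l \<noteq> m \<Longrightarrow> dsym_eval m (double_schur l) = 0"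
  using contained_psize_eq dsym_eval_double_schur_eq_0 by blast

lemma dsym_eval_inject:
  assumes "\<And>m. dsym_eval m P = dsym_eval m Q" shows "P = Q"
proof -
  obtain d c where P: "P - Q = (\<Sum>l | psize l \<le> d. dsym_scale (c l) (double_schur l))"
    using double_schur_expansion by blast
  have "(\<Sum>l | psize l \<le> d. c l * dsym_eval m (double_schur l)) = 0" for m
  proof -
    have "(\<Sum>l | psize l \<le> d. c l * dsym_eval m (double_schur l)) = dsym_eval m (P - Q)"
      unfolding P coeff_hom_sum[OF dsym_eval_hom] by (simp only: dsym_point_scale[OF dsym_eval_point])
    also have "\<dots> = 0" by (simp add: coeff_hom_diff[OF dsym_eval_hom] assms)
    finally show ?thesis .
  qed
  then have "c l = 0" if "l \<in> {l. psize l \<le> d}" for l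
    using triangular_independent[of "{l. psize l \<le> d}" "\<lambda>l m. dsym_eval m (double_schur l)" psize c l]
      that finite_psize_le dsym_eval_double_schur_diag dsym_eval_double_schur_tri by blast
  then have "P - Q = 0" unfolding P by (intro sum.neutral) simp
  then show ?thesis by simp
qed

lemma subst_dual_hom: "coeff_hom subst_dual"
  unfolding subst_dual_def by (rule coeff_hom_mpoly_eval[OF mpoly_const.coeff_hom_axioms])

lemma subst_dual_avar [simp]: "subst_dual (avar i) = - avar (1 - i)"
  by (simp add: subst_dual_def)

text \<open>The contribution of one box: with rows and columns counted from 0, the box (i, j) moves
  the coordinate of its row from index i - j + 1 to i - j.\<close>

definition box_power :: "nat \<Rightarrow> nat \<times> nat \<Rightarrow> qa"
  where "box_power k = (\<lambda>(i, j). avar (int i - int j) ^ k - avar (int i - int j + 1) ^ k)"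

lemma dsym_eval_double_psum_eq:
  assumes "partition_length m \<le> n"
  shows "dsym_eval m (double_psum k) = (\<Sum>i = 1..n. apoint m i ^ k - avar (int i) ^ k)"
  by (simp add: dsym_eval_eq[OF assms] double_psum.rep_eq double_psum_poly_def
      coeff_hom_sum[OF xeval_hom] coeff_hom_diff[OF xeval_hom] coeff_hom_power[OF xeval_hom])

text \<open>Each row of the diagram telescopes, so conjugation becomes visible on power sums.\<close>

lemma dsym_eval_double_psum: "dsym_eval m (double_psum k) = sum (box_power k) (boxes m)"
proof -
  let ?n = "partition_length m"
  have row: "(\<Sum>j<r. box_power k (i, j)) = avar (int i + 1 - int r) ^ k - avar (int i + 1) ^ k" for i r
    by (induct r) (simp_all add: box_power_def algebra_simps)
  have "dsym_eval m (double_psum k) = (\<Sum>i = 1..?n. apoint m i ^ k - avar (int i) ^ k)"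
    by (rule dsym_eval_double_psum_eq) simp
  also have "\<dots> = (\<Sum>i<?n. \<Sum>j<part m i. box_power k (i, j))"
    unfolding row
    by (rule sum.reindex_bij_witness[of _ Suc "\<lambda>i. i - 1"]) (auto simp: apoint_def of_nat_diff)
  also have "\<dots> = sum (box_power k) (boxes m)"
    by (simp add: boxes_eq_Sigma[of m ?n] sum.Sigma)
  finally show ?thesis .
qed

text \<open>The indices j - i and j - i + 1 of the transposed box go to i - j + 1 and i - j. Their
  exchange gives one sign, the negations give k more.\<close>

lemma subst_dual_box_power: "subst_dual (box_power k (j, i)) = (- 1) ^ Suc k * box_power k (i, j)"
proof -
  have "subst_dual (box_power k (j, i)) = (- avar (int i - int j + 1)) ^ k - (- avar (int i - int j)) ^ k"
    by (simp add: box_power_def coeff_hom_diff[OF subst_dual_hom] coeff_hom_power[OF subst_dual_hom]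
        algebra_simps)
  also have "\<dots> = (- 1) ^ k * (avar (int i - int j + 1) ^ k - avar (int i - int j) ^ k)"
    unfolding power_minus[of "avar _"] by (simp only: right_diff_distrib)
  finally show ?thesis by (simp add: box_power_def right_diff_distrib)
qed

lemma subst_dual_double_psum:
  "subst_dual (dsym_eval (conj_partition m) (double_psum k)) = (- 1) ^ Suc k * dsym_eval m (double_psum k)"
proof -
  have "subst_dual (dsym_eval (conj_partition m) (double_psum k))
      = (\<Sum>b\<in>boxes m. subst_dual (box_power k (prod.swap b)))"
    by (simp add: dsym_eval_double_psum boxes_conj sum.reindex coeff_hom_sum[OF subst_dual_hom])
  also have "\<dots> = (\<Sum>b\<in>boxes m. (- 1) ^ Suc k * box_power k b)"
    by (intro sum.cong refl) (simp only: prod.swap_def subst_dual_box_power prod.collapse)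
  also have "\<dots> = (- 1) ^ Suc k * dsym_eval m (double_psum k)"
    by (simp only: dsym_eval_double_psum sum_distrib_left)
  finally show ?thesis .
qed

text \<open>The specialization \<open>a\<^sub>i \<mapsto> - i\<close> sends the value of \<open>p\<^sub>1\<close> to the number of boxes.\<close>

lemma dsym_eval_double_psum_1_inject:
  assumes "contained l m" "dsym_eval l (double_psum 1) = dsym_eval m (double_psum 1)"
  shows "l = m"
proof -
  let ?f = "mpoly_eval id (\<lambda>i. - of_int i) :: qa \<Rightarrow> rat"
  have hom: "coeff_hom ?f" by (rule coeff_hom_mpoly_eval[OF coeff_hom_id])
  have "?f (box_power 1 b) = 1" for b
    by (simp add: box_power_def split_def coeff_hom_diff[OF hom] coeff_hom.eval_var[OF coeff_hom_id])
  then have "?f (dsym_eval l (double_psum 1)) = of_nat (psize l)" for l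
    unfolding dsym_eval_double_psum coeff_hom_sum[OF hom] psize_def by (simp only:) simp
  then have "psize l = psize m" using assms(2) by (metis of_nat_eq_iff)
  then show ?thesis using assms(1) contained_psize_eq by simp
qed

section \<open>The Pieri rule\<close>

definition covers :: "partition \<Rightarrow> partition set"
  where "covers l = {k. contained l k \<and> psize k = Suc (psize l)}"

definition addable :: "partition \<Rightarrow> nat \<Rightarrow> bool"
  where "addable l j \<longleftrightarrow> (\<forall>i<j. part l j < part l i)"

text \<open>Meaningful only for addable rows: otherwise the updated sequence is not
  antitone.\<close>

definition add_box :: "partition \<Rightarrow> nat \<Rightarrow> partition"
  where "add_box l j = Abs_partition ((part l)(j := Suc (part l j)))"

lemma part_add_box:
  assumes "addable l j" shows "part (add_box l j) = (part l)(j := Suc (part l j))"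
proof -
  have "antimono ((part l)(j := Suc (part l j)))"
    using assms part_antimono[of _ _ l]
    by (intro antimonoI) (auto simp: addable_def Suc_le_eq le_Suc_eq)
  moreover have "finite {i. ((part l)(j := Suc (part l j))) i \<noteq> 0}"
    by (rule finite_subset[of _ "insert j {i. part l i \<noteq> 0}"])
      (use finite_part_support[of l] in auto)
  ultimately show ?thesis unfolding add_box_def by (subst Abs_partition_inverse) auto
qed

lemma boxes_add_box:
  assumes "addable l j" shows "boxes (add_box l j) = insert (j, part l j) (boxes l)"
  by (auto simp: boxes_def part_add_box[OF assms] less_Suc_eq split: if_splits)

lemma add_box_in_covers: "addable l j \<Longrightarrow> add_box l j \<in> covers l"
proof -
  have "(j, part l j) \<notin> boxes l" by (simp add: boxes_def)
  then show "add_box l j \<in> covers l" if "addable l j"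
    using that by (simp add: covers_def contained_iff_boxes psize_def boxes_add_box subset_insertI)
qed

lemma covers_imp_add_box:
  assumes "k \<in> covers l"
  obtains j where "addable l j" "k = add_box l j" "j \<le> partition_length l"
proof -
  have sub: "boxes l \<subseteq> boxes k" and card: "card (boxes k) = Suc (card (boxes l))"
    using assms by (auto simp: covers_def contained_iff_boxes psize_def)
  then have "card (boxes k - boxes l) = 1" by (simp add: card_Diff_subset)
  then obtain i j where "boxes k - boxes l = {(i, j)}" by (metis card_1_singletonE surj_pair)
  then have k: "boxes k = insert (i, j) (boxes l)" and new: "(i, j) \<notin> boxes l" using sub by auto
  have iff: "b < part k a \<longleftrightarrow> a = i \<and> b = j \<or> b < part l a" for a b
    using k by (auto simp: boxes_def set_eq_iff)
  have other: "part k a = part l a" if "a \<noteq> i" for a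
    using iff[of _ a] that by (meson linorder_neq_iff less_irrefl)
  have "{..<part k i} = insert j {..<part l i}" using iff[of _ i] by auto
  then have "card {..<part k i} = card (insert j {..<part l i})" by simp
  then have i: "part k i = Suc (part l i)" using new by (simp add: boxes_def)
  have add: "addable l i"
    unfolding addable_def
  proof (intro allI impI)
    fix a assume "a < i"
    then show "part l i < part l a" using part_antimono[of a i k] other[of a] i by simp
  qed
  moreover have "k = add_box l i"
    by (rule partition_eqI) (simp add: part_add_box[OF add] i other)
  moreover have "i \<le> partition_length l"
  proof (rule ccontr)
    assume "\<not> ?thesis"
    then have "part l i = 0" "part l (partition_length l) = 0" "partition_length l < i"
      by (auto simp: part_eq_0_iff)
    with add show False by (auto simp: addable_def)
  qed
  ultimately show ?thesis using that by blast
qed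

lemma covers_conj: "covers (conj_partition l) = conj_partition ` covers l"
proof
  show "covers (conj_partition l) \<subseteq> conj_partition ` covers l"
  proof
    fix k assume "k \<in> covers (conj_partition l)"
    then have "conj_partition k \<in> covers l"
      using contained_conj[of "conj_partition l" k] by (simp add: covers_def)
    then show "k \<in> conj_partition ` covers l" by (metis conj_conj image_eqI)
  qed
qed (auto simp: covers_def)

text \<open>In \<open>alt_pieri\<close>, raising exponent j adds a box to row j if that row is
  addable and otherwise creates a repeated exponent. The strict bound on the length leaves room for
  a new row.\<close>

lemma schur_quot_pieri:
  fixes x :: "nat \<Rightarrow> 'r::idom"
  assumes "inj_on x {1..n}" "partition_length l < n"
  shows "((\<Sum>i = 1..n. x i) - (\<Sum>i = 1..n. \<alpha> (int i - int (part l (i - 1))))) * schur_quot \<alpha> x n (expo n l)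
    = (\<Sum>k\<in>covers l. schur_quot \<alpha> x n (expo n k))"
proof -
  let ?A = "{j. j < n \<and> addable l j}"
  have upd: "alt \<alpha> x n ((expo n l)(j := Suc (expo n l j))) = (if addable l j then alt \<alpha> x n (expo n (add_box l j)) else 0)"
    if "j < n" for j
  proof (cases "addable l j")
    case True
    then show ?thesis by (auto simp: expo_def part_add_box intro!: alt_cong)
  next
    case False
    then obtain i where i: "i < j" "part l i \<le> part l j" by (auto simp: addable_def not_less)
    then have "i \<le> j - 1" by simp
    with i(2) have "part l (j - 1) \<le> part l j" using part_antimono[of i "j - 1" l] by simp
    then have "part l (j - 1) = part l j" using part_antimono[of "j - 1" j l] by simp
    then have "alt \<alpha> x n ((expo n l)(j := Suc (expo n l j))) = 0"
      using i that by (intro alt_eq_exponents[of "j - 1" n j]) (auto simp: expo_def)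
    then show ?thesis using False by simp
  qed
  have "(\<Sum>j<n. alt \<alpha> x n ((expo n l)(j := Suc (expo n l j)))) = (\<Sum>j\<in>?A. alt \<alpha> x n (expo n (add_box l j)))"
    using upd by (intro sum.mono_neutral_cong_right) auto
  also have "\<dots> = (\<Sum>k\<in>covers l. alt \<alpha> x n (expo n k))"
  proof (rule sum.reindex_cong[of "add_box l", symmetric])
    show "inj_on (add_box l) ?A"
    proof (rule inj_onI)
      fix i j assume "i \<in> ?A" "j \<in> ?A" and eq: "add_box l i = add_box l j"
      have "part (add_box l i) i = part (add_box l j) i" using eq by simp
      with \<open>i \<in> ?A\<close> \<open>j \<in> ?A\<close> show "i = j" by (auto simp: part_add_box split: if_splits)
    qed
    show "covers l = add_box l ` ?A"
      using assms(2) by (auto simp: add_box_in_covers image_iff elim!: covers_imp_add_box)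
  qed simp
  finally have "(\<Sum>i = 1..n. x i) * alt \<alpha> x n (expo n l) = (\<Sum>k\<in>covers l. alt \<alpha> x n (expo n k))
      + (\<Sum>j<n. \<alpha> (int n - int (expo n l j))) * alt \<alpha> x n (expo n l)"
    using alt_pieri[of x n \<alpha> "expo n l"] by simp
  \<comment> \<open>The staircase part of the exponent cancels n, leaving the index j + 1 - l_j of
    the point belonging to l.\<close>
  moreover have "(\<Sum>j<n. \<alpha> (int n - int (expo n l j))) = (\<Sum>i = 1..n. \<alpha> (int i - int (part l (i - 1))))"
    by (rule sum.reindex_bij_witness[of _ "\<lambda>i. i - 1" Suc])
      (auto simp: expo_def of_nat_diff intro!: arg_cong[where f = \<alpha>])
  ultimately have "((\<Sum>i = 1..n. x i) - (\<Sum>i = 1..n. \<alpha> (int i - int (part l (i - 1)))))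
      * schur_quot \<alpha> x n (expo n l) * vand x n = (\<Sum>k\<in>covers l. schur_quot \<alpha> x n (expo n k)) * vand x n"
    by (simp add: alt_eq_schur_quot left_diff_distrib sum_distrib_right mult.assoc)
  then show ?thesis using vand_nonzero[OF assms(1)] by simp
qed

lemma dsym_eval_pieri:
  "(dsym_eval m (double_psum 1) - dsym_eval l (double_psum 1)) * dsym_eval m (double_schur l)
    = (\<Sum>k\<in>covers l. dsym_eval m (double_schur k))"
proof -
  \<comment> \<open>One more variable than either partition needs, so that every cover of l fits as
    well.\<close>
  let ?n = "Suc (max (partition_length m) (partition_length l))"
  have "partition_length k \<le> ?n" if k: "k \<in> covers l" for k
  proof -
    obtain j where j: "addable l j" "k = add_box l j" "j \<le> partition_length l"
      using covers_imp_add_box[OF k] by blast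
    have "part l ?n = 0" by (simp add: part_eq_0_iff)
    then have "part k ?n = 0" using j by (simp add: part_add_box)
    then show ?thesis by (simp add: part_eq_0_iff)
  qed
  then have "(\<Sum>k\<in>covers l. dsym_eval m (double_schur k)) = (\<Sum>k\<in>covers l. schur_quot avar (apoint m) ?n (expo ?n k))"
    by (intro sum.cong refl dsym_eval_double_schur) auto
  also have "\<dots> = ((\<Sum>i = 1..?n. apoint m i) - (\<Sum>i = 1..?n. apoint l i)) * schur_quot avar (apoint m) ?n (expo ?n l)"
    unfolding apoint_def[of l] by (rule schur_quot_pieri[OF apoint_inj, symmetric]) simp
  also have "schur_quot avar (apoint m) ?n (expo ?n l) = dsym_eval m (double_schur l)"
    by (rule dsym_eval_double_schur[symmetric]) auto
  also have "(\<Sum>i = 1..?n. apoint m i) - (\<Sum>i = 1..?n. apoint l i)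
      = dsym_eval m (double_psum 1) - dsym_eval l (double_psum 1)"
  proof -
    have "dsym_eval m (double_psum 1) = (\<Sum>i = 1..?n. apoint m i) - (\<Sum>i = 1..?n. avar (int i))"
      by (subst dsym_eval_double_psum_eq[of m ?n]) (auto simp: sum_subtractf)
    moreover have "dsym_eval l (double_psum 1) = (\<Sum>i = 1..?n. apoint l i) - (\<Sum>i = 1..?n. avar (int i))"
      by (subst dsym_eval_double_psum_eq[of l ?n]) (auto simp: sum_subtractf)
    ultimately show ?thesis by (simp only: diff_diff_eq2 diff_add_cancel)
  qed
  finally show ?thesis ..
qed

section \<open>Symmetry under conjugation\<close>

text \<open>
  Both sides satisfy the same recurrence in \<open>l\<close>, so they agree up to a factor depending on \<open>m\<close>,
  and they take the value 1 at the empty partition.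
\<close>

lemma dsym_eval_conj:
  "subst_dual (dsym_eval (conj_partition m) (double_schur (conj_partition l))) = dsym_eval m (double_schur l)"
proof -
  define X where "X l = dsym_eval m (double_schur l)" for l
  define Y where "Y l = subst_dual (dsym_eval (conj_partition m) (double_schur (conj_partition l)))" for l
  define D where "D l = dsym_eval m (double_psum 1) - dsym_eval l (double_psum 1)" for l
  have X: "D l * X l = sum X (covers l)" for l
    unfolding D_def X_def by (rule dsym_eval_pieri)
  have Y: "D l * Y l = sum Y (covers l)" for l
  proof -
    \<comment> \<open>For p_1 the sign \<open>(- 1) ^ Suc 1\<close> is 1, so the factor of the
      conjugate recurrence becomes \<open>D l\<close> itself.\<close>
    have "subst_dual ((dsym_eval (conj_partition m) (double_psum 1) - dsym_eval (conj_partition l) (double_psum 1))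
        * dsym_eval (conj_partition m) (double_schur (conj_partition l))) = D l * Y l"
      by (simp only: coeff_hom.f_mult[OF subst_dual_hom] coeff_hom_diff[OF subst_dual_hom]
          subst_dual_double_psum D_def Y_def) simp
    moreover have "subst_dual (\<Sum>k\<in>covers (conj_partition l). dsym_eval (conj_partition m) (double_schur k)) = sum Y (covers l)"
      by (simp add: covers_conj sum.reindex inj_on_def coeff_hom_sum[OF subst_dual_hom] Y_def)
    ultimately show ?thesis unfolding dsym_eval_pieri by (rule trans[OF sym])
  qed
  have X0: "X l = 0" and Y0: "Y l = 0" if "\<not> contained l m" for l
    using that by (simp_all add: X_def Y_def dsym_eval_double_schur_eq_0 coeff_hom.f_0[OF subst_dual_hom])
  \<comment> \<open>Proportionality in cross-multiplied form. The induction descends from l = m,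
    each l being reduced to its covers; for l not contained in m both sides are zero.\<close>
  have prop_eq: "X l * Y m = Y l * X m" for l
  proof (induct "psize m - psize l" arbitrary: l rule: less_induct)
    case less
    show ?case
    proof (cases "contained l m \<and> l \<noteq> m")
      case True
      then have D: "D l \<noteq> 0" using dsym_eval_double_psum_1_inject[of l m] by (auto simp: D_def)
      have "psize l < psize m" using True contained_psize_eq not_le by blast
      then have "X k * Y m = Y k * X m" if "k \<in> covers l" for k
        using that by (intro less) (auto simp: covers_def)
      then have "D l * X l * Y m = D l * Y l * X m"
        unfolding X Y sum_distrib_right by (intro sum.cong refl)
      then have "D l * (X l * Y m) = D l * (Y l * X m)" by (simp only: mult.assoc)
      with D show ?thesis by (simp only: mult_cancel_left simp_thms)
    qed (use X0 Y0 in auto)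
  qed
  have "X empty_partition = 1" "Y empty_partition = 1"
    by (simp_all add: X_def Y_def dsym_eval_double_schur_empty coeff_hom.f_1[OF subst_dual_hom])
  with prop_eq[of empty_partition] have "Y m = X m" by simp
  moreover have "X m \<noteq> 0" by (simp add: X_def dsym_eval_double_schur_diag)
  ultimately have "X l = Y l" using prop_eq[of l] by simp
  then show ?thesis by (simp add: X_def Y_def)
qed

text \<open>The homomorphism \<open>\<omega>\<close>, lifted to polynomials in the power sums.\<close>

definition omega :: "xpoly \<Rightarrow> xpoly"
  where "omega = mpoly_eval (\<lambda>c. xconst (subst_dual c)) (\<lambda>k. (- 1) ^ k * xvar k)"

text \<open>Both sides are ring homomorphisms in F, so agreement on constants and variables
  suffices. The abstract form serves single points and pairs of points alike.\<close>

lemma omega_values: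
  assumes "coeff_hom f" "coeff_hom g"
    and "\<And>c. f (xconst c) = c" "\<And>c. g (xconst c) = c"
    and "\<And>k. f (xvar k) = (- 1) ^ k * subst_dual (g (xvar k))"
  shows "f (omega F) = subst_dual (g F)"
proof -
  have sign: "f ((- 1) ^ k) = (- 1) ^ k" for k
    by (simp add: coeff_hom_power[OF assms(1)] coeff_hom_uminus[OF assms(1)] coeff_hom.f_1[OF assms(1)])
  have "f (omega F) = mpoly_eval subst_dual (\<lambda>k. subst_dual (g (xvar k))) F"
    unfolding omega_def
    by (subst hom_mpoly_eval[OF assms(1)])
      (simp add: o_def assms(3,5) coeff_hom.f_mult[OF assms(1)] sign flip: mult.assoc power_mult_distrib)
  also have "\<dots> = (subst_dual \<circ> g) (mpoly_eval xconst xvar F)"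
    by (subst hom_mpoly_eval[OF coeff_hom_comp[OF assms(2) subst_dual_hom]]) (simp add: o_def assms(4))
  finally show ?thesis by (simp add: mpoly_eval_ident)
qed

lemma dsym_eval_psum_poly:
  "dsym_eval m (psum_poly (xconst c)) = c" "dsym_eval m (psum_poly (xvar k)) = dsym_eval m (double_psum (Suc k))"
  using dsym_point_scale[OF dsym_eval_point, of m c 1]
  by (simp_all add: psum_poly_const psum_poly_var dsym_point_1[OF dsym_eval_point])

lemma subst_dual_double_psum_Suc:
  "dsym_eval m (double_psum (Suc k)) = (- 1) ^ k * subst_dual (dsym_eval (conj_partition m) (double_psum (Suc k)))"
  unfolding subst_dual_double_psum by (simp flip: mult.assoc power_mult_distrib)

lemma dsym_eval_omega:
  "dsym_eval m (psum_poly (omega F)) = subst_dual (dsym_eval (conj_partition m) (psum_poly F))"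
proof -
  have hom: "coeff_hom (\<lambda>F. dsym_eval m (psum_poly F))" for m
    using coeff_hom_comp[OF psum_poly_hom dsym_eval_hom] by (simp add: o_def)
  show ?thesis
    by (rule omega_values[OF hom hom])
      (simp_all only: dsym_eval_psum_poly, rule subst_dual_double_psum_Suc)
qed

text \<open>Values at partitions separate elements of the ring, so \<open>dsym_eval_conj\<close>
  identifies the image.\<close>

lemma psum_poly_omega:
  assumes "psum_poly F = double_schur l"
  shows "psum_poly (omega F) = double_schur (conj_partition l)"
  using dsym_eval_conj[of _ "conj_partition l"]
  by (intro dsym_eval_inject) (simp add: dsym_eval_omega assms)

abbreviation pair_eval :: "partition \<Rightarrow> partition \<Rightarrow> tensor2 \<Rightarrow> qa"
  where "pair_eval m r \<equiv> tensor_eval (dsym_eval m) (dsym_eval r)"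

text \<open>As p_k is primitive, its coproduct takes the sum of its values at the two points, and
  both values obey the same sign rule. This is compatibility with the comultiplication, seen through
  evaluation.\<close>

lemma pair_eval_omega:
  "pair_eval m r (tensor_psum_poly (omega F))
    = subst_dual (pair_eval (conj_partition m) (conj_partition r) (tensor_psum_poly F))"
proof -
  note simps = tensor_eval_simps[OF dsym_eval_point dsym_eval_point]
  have hom: "coeff_hom (\<lambda>F. pair_eval m r (tensor_psum_poly F))" for m r
    by standard (simp_all add: simps coeff_hom.f_0[OF tensor_psum_poly_hom] coeff_hom.f_1[OF tensor_psum_poly_hom]
        coeff_hom.f_add[OF tensor_psum_poly_hom] coeff_hom.f_mult[OF tensor_psum_poly_hom])
  have const: "pair_eval m r (tensor_psum_poly (xconst c)) = c" for m r c
    by (simp add: tensor_psum_poly_def coeff_hom.eval_const[OF tensor_const_hom] simps)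
  have var: "pair_eval m r (tensor_psum_poly (xvar k))
      = dsym_eval m (double_psum (Suc k)) + dsym_eval r (double_psum (Suc k))" for m r k
    by (simp add: tensor_psum_poly_def coeff_hom.eval_var[OF tensor_const_hom] simps
        dsym_point_1[OF dsym_eval_point])
  show ?thesis
    by (rule omega_values[OF hom hom const const])
      (simp only: var coeff_hom.f_add[OF subst_dual_hom] distrib_left
        subst_dual_double_psum_Suc[of m] subst_dual_double_psum_Suc[of r])
qed

section \<open>Structure coefficients\<close>

lemma pair_eval_schur_tensor:
  assumes "finite S" "Poly_Mapping.keys c \<subseteq> S"
  shows "pair_eval m r (schur_tensor c) = (\<Sum>x\<in>S. Poly_Mapping.lookup c x *
    (dsym_eval m (double_schur (fst x)) * dsym_eval r (double_schur (snd x))))"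
  unfolding schur_tensor_superset[OF assms] tensor_eval_sum[OF dsym_eval_point dsym_eval_point]
  by (simp add: split_def tensor_eval_simps[OF dsym_eval_point dsym_eval_point])

text \<open>A product of values is nonzero only if both partitions are contained in those of the
  point, so pairs are triangular with respect to total size.\<close>

lemma pair_eval_coeffs_unique:
  assumes "finite S"
    and "\<And>m r. (\<Sum>x\<in>S. c x * (dsym_eval m (double_schur (fst x)) * dsym_eval r (double_schur (snd x)))) = 0"
    and "x \<in> S"
  shows "c x = 0"
proof (rule triangular_independent[of S "\<lambda>x y. dsym_eval (fst y) (double_schur (fst x)) *
    dsym_eval (snd y) (double_schur (snd x))" "\<lambda>x. psize (fst x) + psize (snd x)" c])
  fix x y :: "partition \<times> partition"
  assume le: "psize (fst y) + psize (snd y) \<le> psize (fst x) + psize (snd x)" and "x \<noteq> y"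
  show "dsym_eval (fst y) (double_schur (fst x)) * dsym_eval (snd y) (double_schur (snd x)) = 0"
  proof (rule ccontr)
    assume "\<not> ?thesis"
    then have "contained (fst x) (fst y)" "contained (snd x) (snd y)"
      using dsym_eval_double_schur_eq_0 by fastforce+
    with le contained_psize[OF this(1)] contained_psize[OF this(2)] have "fst x = fst y" "snd x = snd y"
      by (auto intro!: contained_psize_eq)
    with \<open>x \<noteq> y\<close> show False by (simp add: prod_eq_iff)
  qed
qed (use assms dsym_eval_double_schur_diag in auto)

lemma schur_tensor_inject:
  assumes "schur_tensor c = schur_tensor d" shows "c = d"
proof (rule poly_mapping_eqI)
  fix x
  let ?S = "insert x (Poly_Mapping.keys c \<union> Poly_Mapping.keys d)"
  let ?V = "\<lambda>m r x. dsym_eval m (double_schur (fst x)) * dsym_eval r (double_schur (snd x))"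
  have fin: "finite ?S" by simp
  have "(\<Sum>x\<in>?S. (Poly_Mapping.lookup c x - Poly_Mapping.lookup d x) * ?V m r x) = 0" for m r
  proof -
    have "pair_eval m r (schur_tensor c) = (\<Sum>x\<in>?S. Poly_Mapping.lookup c x * ?V m r x)"
      by (rule pair_eval_schur_tensor[OF fin]) auto
    moreover have "pair_eval m r (schur_tensor d) = (\<Sum>x\<in>?S. Poly_Mapping.lookup d x * ?V m r x)"
      by (rule pair_eval_schur_tensor[OF fin]) auto
    ultimately show ?thesis
      unfolding left_diff_distrib sum_subtractf using assms by (simp only: diff_self)
  qed
  then have "Poly_Mapping.lookup c x - Poly_Mapping.lookup d x = 0"
    by (rule pair_eval_coeffs_unique[OF fin]) simp
  then show "Poly_Mapping.lookup c x = Poly_Mapping.lookup d x" by simp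
qed

lemma schur_tensor_coproduct_coeffs: "schur_tensor (coproduct_coeffs n) = coproduct (double_schur n)"
proof -
  obtain c where c: "coproduct (double_schur n) = schur_tensor c" using schur_tensor_exists by blast
  have "coproduct_coeffs n = c"
    unfolding coproduct_coeffs_def schur_tensor_def[symmetric]
    by (rule the_equality) (use c schur_tensor_inject in auto)
  with c show ?thesis by simp
qed

theorem corollary4p2:
  fixes lam mu nu :: partition
  shows "dual_lr lam mu nu =
    subst_dual (dual_lr (conj_partition lam) (conj_partition mu) (conj_partition nu))"
proof -
  let ?c = "Poly_Mapping.lookup (coproduct_coeffs nu)"
  let ?d = "Poly_Mapping.lookup (coproduct_coeffs (conj_partition nu))"
  let ?conj = "map_prod conj_partition conj_partition"
  let ?V = "\<lambda>m r x. dsym_eval m (double_schur (fst x)) * dsym_eval r (double_schur (snd x))"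
  have conj_conj: "?conj (?conj x) = x" for x by (cases x) simp
  \<comment> \<open>The pair in question is added explicitly since its coefficients may vanish; the
    remaining pairs cover the supports of both sides, one of them transported by
    conjugation.\<close>
  define S where "S = insert (lam, mu) (Poly_Mapping.keys (coproduct_coeffs nu)
    \<union> ?conj ` Poly_Mapping.keys (coproduct_coeffs (conj_partition nu)))"
  have fin: "finite S" by (simp add: S_def)
  obtain F where F: "psum_poly F = double_schur (conj_partition nu)"
    using surj_psum_poly by metis
  have "(\<Sum>x\<in>S. (?c x - subst_dual (?d (?conj x))) * ?V m r x) = 0" for m r
  proof -
    let ?m = "conj_partition m" and ?r = "conj_partition r"
    have "(\<Sum>x\<in>S. ?c x * ?V m r x) = pair_eval m r (coproduct (double_schur nu))"
      unfolding schur_tensor_coproduct_coeffs[symmetric]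
      by (rule pair_eval_schur_tensor[symmetric, OF fin]) (auto simp: S_def)
    also have "\<dots> = pair_eval m r (tensor_psum_poly (omega F))"
      using psum_poly_omega[OF F] by (simp flip: coproduct_psum_poly)
    also have "\<dots> = subst_dual (pair_eval ?m ?r (coproduct (double_schur (conj_partition nu))))"
      by (simp add: pair_eval_omega coproduct_psum_poly flip: F)
    also have "pair_eval ?m ?r (coproduct (double_schur (conj_partition nu))) = (\<Sum>x\<in>?conj ` S. ?d x * ?V ?m ?r x)"
      unfolding schur_tensor_coproduct_coeffs[symmetric]
    proof (rule pair_eval_schur_tensor)
      show "Poly_Mapping.keys (coproduct_coeffs (conj_partition nu)) \<subseteq> ?conj ` S"
      proof
        fix x assume "x \<in> Poly_Mapping.keys (coproduct_coeffs (conj_partition nu))"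
        then have "?conj x \<in> S" by (simp add: S_def)
        then show "x \<in> ?conj ` S" using conj_conj by (metis image_eqI)
      qed
    qed (simp add: fin)
    also have "\<dots> = (\<Sum>x\<in>S. ?d (?conj x) * ?V ?m ?r (?conj x))"
      by (rule sum.reindex_cong[of ?conj]) (auto simp: inj_on_def)
    \<comment> \<open>On values the substitution undoes the conjugation of points and of Schur
      functions together, so it remains only on the coefficients.\<close>
    also have "subst_dual \<dots> = (\<Sum>x\<in>S. subst_dual (?d (?conj x)) * ?V m r x)"
      by (simp add: coeff_hom_sum[OF subst_dual_hom] coeff_hom.f_mult[OF subst_dual_hom] dsym_eval_conj)
    finally show ?thesis by (simp add: left_diff_distrib sum_subtractf)
  qed
  then have "?c (lam, mu) - subst_dual (?d (?conj (lam, mu))) = 0"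
    by (rule pair_eval_coeffs_unique[OF fin]) (simp add: S_def)
  then show ?thesis by (simp add: dual_lr_def)
qed

end
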